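(* Let $\mathbf{k}$ be an algebraically closed field of characteristic $2$. Then the $2$-adic dimensions $\mathrm{Dim}_\pm$ are not always additive on exact sequences: there exist a symmetric tensor category $\mathcal{C}$ over $\mathbf{k}$ and a short exact sequence $0\to X\to Y\to Z\to 0$ in $\mathcal{C}$ such that $\mathrm{Dim}_+(Y)\ne\mathrm{Dim}_+(X)+\mathrm{Dim}_+(Z)$ and $\mathrm{Dim}_-(Y)\ne\mathrm{Dim}_-(X)+\mathrm{Dim}_-(Z)$.
   Context: A symmetric tensor category over $\mathbf{k}$ is a $\mathbf{k}$-linear locally finite abelian rigid symmetric monoidal category with $\mathbf{k}$-bilinear tensor product and $\mathrm{End}(\mathbf{1})=\mathbf{k}$. The dimension of $X$ is $\dim(X):=\mathrm{ev}_X\circ c_{X,X^*}\circ\mathrm{coev}_X\in\mathbf{k}$, where $c$ is the commutativity constraint. $S^nX$ is the object of $S_n$-coinvariants of $X^{\otimes n}$, i.e. the degree $n$ part of the quotient $SX$ of the tensor algebra $TX$ by the two-sided ideal generated by the image of $c_{X,X}-1$. $\wedge^nX$ is the degree $n$ part of the quotient $\wedge X$ of $TX$ by the two-sided ideal generated by the kernel of $c_{X,X}-1$. With $p=2$: for $t=\sum_{j\ge0}t_jp^j\in\mathbb{Z}_p$ with digits $t_j\in\{0,\dots,p-1\}$, $(1+z)^t:=\prod_{j\ge0}(1+z^{p^j})^{t_j}\in\mathbb{F}_p[[z]]$. The $p$-adic dimensions $\mathrm{Dim}_\pm(X)\in\mathbb{Z}_p$ are the unique $p$-adic integers (they are known to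 exist) such that $$\sum_{j\ge0}\dim(S^jX)z^j=(1-z)^{-\mathrm{Dim}_+(X)},\qquad \sum_{j\ge0}\dim(\wedge^jX)z^j=(1+z)^{\mathrm{Dim}_-(X)}.$$ *)

theory Defs
  imports
    "HOL-Computational_Algebra.Computational_Algebra"
    "HOL-Analysis.Infinite_Products"
    "Jordan_Normal_Form.Matrix"
begin

section \<open>The 2-adic integers\<close>

text \<open>A 2-adic integer is a compatible family of residues modulo the powers of 2, i.e. an element
  of the inverse limit of the rings of integers modulo \<open>2 ^ n\<close>.\<close>

typedef two_adic = "{a :: nat \<Rightarrow> int. \<forall>n. a n = a (Suc n) mod 2 ^ n}"
  morphisms residue Abs_two_adic
  by (rule exI[of _ "\<lambda>_. 0"]) simp

setup_lifting type_definition_two_adic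

lemma mod_two_power_Suc: "(x :: int) mod (2 ^ Suc n) mod 2 ^ n = x mod 2 ^ n"
  by (rule mod_mod_cancel) simp

lemma residue_mod: "residue t n mod 2 ^ n = residue t n"
proof -
  have "residue t n = residue t (Suc n) mod 2 ^ n" using residue[of t] by blast
  then show ?thesis by (metis mod_mod_trivial)
qed

lemma residue_0 [simp]: "residue t 0 = 0"
  using residue_mod[of t 0] by simp

lemma two_adic_eqI: "(\<And>n. residue s n = residue t n) \<Longrightarrow> s = t"
  by (simp add: residue_inject[symmetric] fun_eq_iff)

lemma mod_compat:
  fixes a b a' b' m :: int
  assumes "a = a' mod m" and "b = b' mod m"
  shows "(a + b) mod m = (a' + b') mod m" and "(a - b) mod m = (a' - b') mod m"
    and "(a * b) mod m = (a' * b') mod m" and "(- a) mod m = (- a') mod m"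
  by (simp_all add: assms mod_simps)

instantiation two_adic :: comm_ring_1
begin

lift_definition zero_two_adic :: two_adic is "\<lambda>_. 0" by simp

lift_definition one_two_adic :: two_adic is "\<lambda>n. 1 mod 2 ^ n"
  by (simp only: mod_two_power_Suc simp_thms)

lift_definition plus_two_adic :: "two_adic \<Rightarrow> two_adic \<Rightarrow> two_adic"
  is "\<lambda>a b n. (a n + b n) mod 2 ^ n"
  unfolding mod_two_power_Suc by (intro allI mod_compat; blast)

lift_definition uminus_two_adic :: "two_adic \<Rightarrow> two_adic" is "\<lambda>a n. (- a n) mod 2 ^ n"
  unfolding mod_two_power_Suc by (intro allI mod_compat; blast)

lift_definition minus_two_adic :: "two_adic \<Rightarrow> two_adic \<Rightarrow> two_adic"
  is "\<lambda>a b n. (a n - b n) mod 2 ^ n"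
  unfolding mod_two_power_Suc by (intro allI mod_compat; blast)

lift_definition times_two_adic :: "two_adic \<Rightarrow> two_adic \<Rightarrow> two_adic"
  is "\<lambda>a b n. (a n * b n) mod 2 ^ n"
  unfolding mod_two_power_Suc by (intro allI mod_compat; blast)

lemmas residue_simps = zero_two_adic.rep_eq one_two_adic.rep_eq plus_two_adic.rep_eq
  uminus_two_adic.rep_eq minus_two_adic.rep_eq times_two_adic.rep_eq

instance
proof
  fix a b c :: two_adic
  show "a * b * c = a * (b * c)"
    by (rule two_adic_eqI) (simp add: residue_simps mod_simps mult.assoc)
  show "a * b = b * a"
    by (rule two_adic_eqI) (simp add: residue_simps mult.commute)
  show "1 * a = a"
    by (rule two_adic_eqI) (simp only: residue_simps mod_mult_left_eq mult_1 residue_mod)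
  show "a + b + c = a + (b + c)"
    by (rule two_adic_eqI) (simp add: residue_simps mod_simps add.assoc)
  show "a + b = b + a"
    by (rule two_adic_eqI) (simp add: residue_simps add.commute)
  show "0 + a = a"
    by (rule two_adic_eqI) (simp add: residue_simps residue_mod)
  show "- a + a = 0"
    by (rule two_adic_eqI) (simp add: residue_simps mod_simps)
  show "a - b = a + - b"
    by (rule two_adic_eqI) (simp add: residue_simps mod_simps)
  show "(a + b) * c = a * c + b * c"
    by (rule two_adic_eqI) (simp add: residue_simps mod_simps distrib_right)
  have "residue 0 1 \<noteq> residue 1 1"
    by (simp add: residue_simps)
  then show "(0 :: two_adic) \<noteq> 1"
    by metis
qed

end

definition digit :: "two_adic \<Rightarrow> nat \<Rightarrow> nat" where
  "digit t j = nat (residue t (Suc j) div 2 ^ j)"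

lemma residue_eq_sum_digits: "residue t n = (\<Sum>j<n. int (digit t j) * 2 ^ j)"
proof (induction n)
  case 0
  show ?case by simp
next
  case (Suc n)
  have *: "residue t n = residue t (Suc n) mod 2 ^ n" using residue[of t] by blast
  have "residue t (Suc n) mod 2 ^ Suc n = residue t (Suc n)" by (rule residue_mod)
  moreover have "0 \<le> residue t (Suc n) mod 2 ^ Suc n" by (rule pos_mod_sign) simp
  ultimately have "0 \<le> residue t (Suc n)" by simp
  then have d: "int (digit t n) = residue t (Suc n) div 2 ^ n"
    by (simp add: digit_def pos_imp_zdiv_nonneg_iff)
  have "residue t (Suc n) = residue t (Suc n) mod 2 ^ n + residue t (Suc n) div 2 ^ n * 2 ^ n"
    by (rule mod_div_mult_eq[symmetric])
  then have "residue t (Suc n) = residue t n + int (digit t n) * 2 ^ n"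
    by (simp only: d flip: *)
  then show ?case by (simp only: Suc.IH sum.lessThan_Suc)
qed

lemma digit_le_1: "digit t j \<le> 1"
proof -
  define r where "r = residue t (Suc j)"
  have "r mod 2 ^ Suc j = r" unfolding r_def by (rule residue_mod)
  moreover have "r mod 2 ^ Suc j < 2 ^ Suc j" by (rule pos_mod_bound) simp
  ultimately have r: "r < 2 ^ j * 2" by simp
  have "r div 2 ^ j < 2"
  proof (rule ccontr)
    assume "\<not> r div 2 ^ j < 2"
    then have "2 ^ j * 2 \<le> 2 ^ j * (r div 2 ^ j)" by (intro mult_left_mono) auto
    moreover have "2 ^ j * (r div 2 ^ j) + r mod 2 ^ j = r" by simp
    moreover have "0 \<le> r mod 2 ^ j" by simp
    ultimately show False using r by linarith
  qed
  then show ?thesis unfolding digit_def r_def by linarith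
qed

text \<open>The power \<open>(1 + w)\<^sup>t\<close> for a series \<open>w\<close> without constant term and a 2-adic exponent; the infinite
  product is taken in the topology of formal power series. The coefficients lie in the prime
  field, which is regarded as a subfield of \<open>'k\<close> throughout.\<close>

definition one_plus_powr :: "'k::comm_ring_1 fps \<Rightarrow> two_adic \<Rightarrow> 'k fps" where
  "one_plus_powr w t = prodinf (\<lambda>j. (1 + w ^ (2 ^ j)) ^ digit t j)"


section \<open>Symmetric tensor categories\<close>

text \<open>Morphism sets are given by \<open>Hom A B\<close> and are not required to be disjoint, so one and the same
  element of \<open>'m\<close> may be a morphism between several pairs of objects. Values of the operations
  outside of \<open>Obj\<close> and \<open>Hom\<close> are irrelevant. \<open>g \<cdot> f\<close> is the composite ``\<open>f\<close>, then \<open>g\<close>''.\<close>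

record ('k, 'o, 'm) tensor_cat =
  Obj :: "'o set"
  Hom :: "'o \<Rightarrow> 'o \<Rightarrow> 'm set"
  Idt :: "'o \<Rightarrow> 'm" (\<open>\<i>\<d>\<index>\<close>)
  Comp :: "'m \<Rightarrow> 'm \<Rightarrow> 'm" (infixr \<open>\<cdot>\<index>\<close> 55)
  Zero :: "'o \<Rightarrow> 'o \<Rightarrow> 'm" (\<open>\<zero>\<index>\<close>)
  Plus :: "'m \<Rightarrow> 'm \<Rightarrow> 'm" (infixl \<open>\<boxplus>\<index>\<close> 53)
  Scale :: "'k \<Rightarrow> 'm \<Rightarrow> 'm" (infixr \<open>\<star>\<index>\<close> 58)
  One :: "'o" (\<open>\<I>\<index>\<close>)
  TensO :: "'o \<Rightarrow> 'o \<Rightarrow> 'o" (infixr \<open>\<boxtimes>\<index>\<close> 70)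
  TensM :: "'m \<Rightarrow> 'm \<Rightarrow> 'm" (infixr \<open>\<diamondop>\<index>\<close> 70)
  Assoc :: "'o \<Rightarrow> 'o \<Rightarrow> 'o \<Rightarrow> 'm" (\<open>\<a>\<index>\<close>)
  Lunit :: "'o \<Rightarrow> 'm" (\<open>\<l>\<index>\<close>)
  Runit :: "'o \<Rightarrow> 'm" (\<open>\<r>\<index>\<close>)
  Braid :: "'o \<Rightarrow> 'o \<Rightarrow> 'm" (\<open>\<c>\<index>\<close>)

subsection \<open>Linear categories\<close>

locale linear_category =
  fixes C :: "('k::field, 'o, 'm) tensor_cat" (structure)
  assumes id_hom: "A \<in> Obj C \<Longrightarrow> \<i>\<d> A \<in> Hom C A A"
    and comp_hom: "\<lbrakk>A \<in> Obj C; B \<in> Obj C; D \<in> Obj C; f \<in> Hom C A B; g \<in> Hom C B D\<rbrakk>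
      \<Longrightarrow> g \<cdot> f \<in> Hom C A D"
    and comp_assoc: "\<lbrakk>A \<in> Obj C; B \<in> Obj C; D \<in> Obj C; E \<in> Obj C;
      f \<in> Hom C A B; g \<in> Hom C B D; h \<in> Hom C D E\<rbrakk> \<Longrightarrow> (h \<cdot> g) \<cdot> f = h \<cdot> (g \<cdot> f)"
    and comp_id: "\<lbrakk>A \<in> Obj C; B \<in> Obj C; f \<in> Hom C A B\<rbrakk> \<Longrightarrow> f \<cdot> \<i>\<d> A = f"
    and id_comp: "\<lbrakk>A \<in> Obj C; B \<in> Obj C; f \<in> Hom C A B\<rbrakk> \<Longrightarrow> \<i>\<d> B \<cdot> f = f"
    and zero_hom: "\<lbrakk>A \<in> Obj C; B \<in> Obj C\<rbrakk> \<Longrightarrow> \<zero> A B \<in> Hom C A B"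
    and plus_hom: "\<lbrakk>A \<in> Obj C; B \<in> Obj C; f \<in> Hom C A B; g \<in> Hom C A B\<rbrakk> \<Longrightarrow> f \<boxplus> g \<in> Hom C A B"
    and scale_hom: "\<lbrakk>A \<in> Obj C; B \<in> Obj C; f \<in> Hom C A B\<rbrakk> \<Longrightarrow> a \<star> f \<in> Hom C A B"
    and plus_assoc: "\<lbrakk>A \<in> Obj C; B \<in> Obj C; f \<in> Hom C A B; g \<in> Hom C A B; h \<in> Hom C A B\<rbrakk>
      \<Longrightarrow> (f \<boxplus> g) \<boxplus> h = f \<boxplus> (g \<boxplus> h)"
    and plus_commute: "\<lbrakk>A \<in> Obj C; B \<in> Obj C; f \<in> Hom C A B; g \<in> Hom C A B\<rbrakk> \<Longrightarrow> f \<boxplus> g = g \<boxplus> f"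
    and zero_plus: "\<lbrakk>A \<in> Obj C; B \<in> Obj C; f \<in> Hom C A B\<rbrakk> \<Longrightarrow> \<zero> A B \<boxplus> f = f"
    and plus_minus: "\<lbrakk>A \<in> Obj C; B \<in> Obj C; f \<in> Hom C A B\<rbrakk> \<Longrightarrow> f \<boxplus> (- 1) \<star> f = \<zero> A B"
    and scale_plus: "\<lbrakk>A \<in> Obj C; B \<in> Obj C; f \<in> Hom C A B; g \<in> Hom C A B\<rbrakk>
      \<Longrightarrow> a \<star> (f \<boxplus> g) = a \<star> f \<boxplus> a \<star> g"
    and add_scale: "\<lbrakk>A \<in> Obj C; B \<in> Obj C; f \<in> Hom C A B\<rbrakk> \<Longrightarrow> (a + b) \<star> f = a \<star> f \<boxplus> b \<star> f"
    and scale_scale: "\<lbrakk>A \<in> Obj C; B \<in> Obj C; f \<in> Hom C A B\<rbrakk> \<Longrightarrow> a \<star> b \<star> f = (a * b) \<star> f"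
    and one_scale: "\<lbrakk>A \<in> Obj C; B \<in> Obj C; f \<in> Hom C A B\<rbrakk> \<Longrightarrow> 1 \<star> f = f"
    and comp_plus: "\<lbrakk>A \<in> Obj C; B \<in> Obj C; D \<in> Obj C; f \<in> Hom C A B; f' \<in> Hom C A B; g \<in> Hom C B D\<rbrakk>
      \<Longrightarrow> g \<cdot> (f \<boxplus> f') = g \<cdot> f \<boxplus> g \<cdot> f'"
    and plus_comp: "\<lbrakk>A \<in> Obj C; B \<in> Obj C; D \<in> Obj C; f \<in> Hom C A B; g \<in> Hom C B D; g' \<in> Hom C B D\<rbrakk>
      \<Longrightarrow> (g \<boxplus> g') \<cdot> f = g \<cdot> f \<boxplus> g' \<cdot> f"
    and comp_scale: "\<lbrakk>A \<in> Obj C; B \<in> Obj C; D \<in> Obj C; f \<in> Hom C A B; g \<in> Hom C B D\<rbrakk>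
      \<Longrightarrow> g \<cdot> (a \<star> f) = a \<star> (g \<cdot> f)"
    and scale_comp: "\<lbrakk>A \<in> Obj C; B \<in> Obj C; D \<in> Obj C; f \<in> Hom C A B; g \<in> Hom C B D\<rbrakk>
      \<Longrightarrow> (a \<star> g) \<cdot> f = a \<star> (g \<cdot> f)"

subsection \<open>Abelian categories\<close>

definition is_zero :: "('k, 'o, 'm) tensor_cat \<Rightarrow> 'o \<Rightarrow> bool" where
  "is_zero C Z \<longleftrightarrow> Z \<in> Obj C \<and> (\<forall>A\<in>Obj C. (\<exists>!f. f \<in> Hom C Z A) \<and> (\<exists>!f. f \<in> Hom C A Z))"

definition is_inverse :: "('k, 'o, 'm) tensor_cat \<Rightarrow> 'o \<Rightarrow> 'o \<Rightarrow> 'm \<Rightarrow> 'm \<Rightarrow> bool" where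
  "is_inverse C A B f g \<longleftrightarrow> f \<in> Hom C A B \<and> g \<in> Hom C B A \<and>
     g \<cdot>\<^bsub>C\<^esub> f = \<i>\<d>\<^bsub>C\<^esub> A \<and> f \<cdot>\<^bsub>C\<^esub> g = \<i>\<d>\<^bsub>C\<^esub> B"

definition is_iso :: "('k, 'o, 'm) tensor_cat \<Rightarrow> 'o \<Rightarrow> 'o \<Rightarrow> 'm \<Rightarrow> bool" where
  "is_iso C A B f \<longleftrightarrow> (\<exists>g. is_inverse C A B f g)"

definition is_mono :: "('k, 'o, 'm) tensor_cat \<Rightarrow> 'o \<Rightarrow> 'o \<Rightarrow> 'm \<Rightarrow> bool" where
  "is_mono C A B f \<longleftrightarrow> f \<in> Hom C A B \<and>
     (\<forall>W\<in>Obj C. \<forall>g\<in>Hom C W A. \<forall>h\<in>Hom C W A. f \<cdot>\<^bsub>C\<^esub> g = f \<cdot>\<^bsub>C\<^esub> h \<longrightarrow> g = h)"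

definition is_epi :: "('k, 'o, 'm) tensor_cat \<Rightarrow> 'o \<Rightarrow> 'o \<Rightarrow> 'm \<Rightarrow> bool" where
  "is_epi C A B f \<longleftrightarrow> f \<in> Hom C A B \<and>
     (\<forall>W\<in>Obj C. \<forall>g\<in>Hom C B W. \<forall>h\<in>Hom C B W. g \<cdot>\<^bsub>C\<^esub> f = h \<cdot>\<^bsub>C\<^esub> f \<longrightarrow> g = h)"

text \<open>\<open>k : K \<rightarrow> A\<close> is a kernel of \<open>f : A \<rightarrow> B\<close>; \<open>q : B \<rightarrow> Q\<close> is a cokernel of \<open>f : A \<rightarrow> B\<close>.\<close>

definition is_kernel :: "('k, 'o, 'm) tensor_cat \<Rightarrow> 'o \<Rightarrow> 'o \<Rightarrow> 'm \<Rightarrow> 'o \<Rightarrow> 'm \<Rightarrow> bool" where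
  "is_kernel C A B f K k \<longleftrightarrow> f \<in> Hom C A B \<and> K \<in> Obj C \<and> k \<in> Hom C K A \<and> f \<cdot>\<^bsub>C\<^esub> k = \<zero>\<^bsub>C\<^esub> K B \<and>
     (\<forall>W\<in>Obj C. \<forall>h\<in>Hom C W A. f \<cdot>\<^bsub>C\<^esub> h = \<zero>\<^bsub>C\<^esub> W B \<longrightarrow> (\<exists>!u. u \<in> Hom C W K \<and> k \<cdot>\<^bsub>C\<^esub> u = h))"

definition is_cokernel :: "('k, 'o, 'm) tensor_cat \<Rightarrow> 'o \<Rightarrow> 'o \<Rightarrow> 'm \<Rightarrow> 'o \<Rightarrow> 'm \<Rightarrow> bool" where
  "is_cokernel C A B f Q q \<longleftrightarrow> f \<in> Hom C A B \<and> Q \<in> Obj C \<and> q \<in> Hom C B Q \<and> q \<cdot>\<^bsub>C\<^esub> f = \<zero>\<^bsub>C\<^esub> A Q \<and>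
     (\<forall>W\<in>Obj C. \<forall>h\<in>Hom C B W. h \<cdot>\<^bsub>C\<^esub> f = \<zero>\<^bsub>C\<^esub> A W \<longrightarrow> (\<exists>!u. u \<in> Hom C Q W \<and> u \<cdot>\<^bsub>C\<^esub> q = h))"

definition is_image :: "('k, 'o, 'm) tensor_cat \<Rightarrow> 'o \<Rightarrow> 'o \<Rightarrow> 'm \<Rightarrow> 'o \<Rightarrow> 'm \<Rightarrow> bool" where
  "is_image C A B f I i \<longleftrightarrow> (\<exists>Q q. is_cokernel C A B f Q q \<and> is_kernel C B Q q I i)"

definition is_biproduct ::
  "('k, 'o, 'm) tensor_cat \<Rightarrow> 'o \<Rightarrow> 'o \<Rightarrow> 'o \<Rightarrow> 'm \<Rightarrow> 'm \<Rightarrow> 'm \<Rightarrow> 'm \<Rightarrow> bool" where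
  "is_biproduct C A B S i\<^sub>1 i\<^sub>2 p\<^sub>1 p\<^sub>2 \<longleftrightarrow> S \<in> Obj C \<and>
     i\<^sub>1 \<in> Hom C A S \<and> i\<^sub>2 \<in> Hom C B S \<and> p\<^sub>1 \<in> Hom C S A \<and> p\<^sub>2 \<in> Hom C S B \<and>
     p\<^sub>1 \<cdot>\<^bsub>C\<^esub> i\<^sub>1 = \<i>\<d>\<^bsub>C\<^esub> A \<and> p\<^sub>2 \<cdot>\<^bsub>C\<^esub> i\<^sub>2 = \<i>\<d>\<^bsub>C\<^esub> B \<and>
     p\<^sub>2 \<cdot>\<^bsub>C\<^esub> i\<^sub>1 = \<zero>\<^bsub>C\<^esub> A B \<and> p\<^sub>1 \<cdot>\<^bsub>C\<^esub> i\<^sub>2 = \<zero>\<^bsub>C\<^esub> B A \<and>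
     (i\<^sub>1 \<cdot>\<^bsub>C\<^esub> p\<^sub>1) \<boxplus>\<^bsub>C\<^esub> (i\<^sub>2 \<cdot>\<^bsub>C\<^esub> p\<^sub>2) = \<i>\<d>\<^bsub>C\<^esub> S"

locale abelian_linear_category = linear_category +
  assumes ex_zero: "\<exists>Z. is_zero C Z"
    and ex_biproduct: "\<lbrakk>A \<in> Obj C; B \<in> Obj C\<rbrakk> \<Longrightarrow> \<exists>S i\<^sub>1 i\<^sub>2 p\<^sub>1 p\<^sub>2. is_biproduct C A B S i\<^sub>1 i\<^sub>2 p\<^sub>1 p\<^sub>2"
    and ex_kernel: "\<lbrakk>A \<in> Obj C; B \<in> Obj C; f \<in> Hom C A B\<rbrakk> \<Longrightarrow> \<exists>K k. is_kernel C A B f K k"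
    and ex_cokernel: "\<lbrakk>A \<in> Obj C; B \<in> Obj C; f \<in> Hom C A B\<rbrakk> \<Longrightarrow> \<exists>Q q. is_cokernel C A B f Q q"
    and mono_is_kernel: "\<lbrakk>A \<in> Obj C; B \<in> Obj C; is_mono C A B f\<rbrakk>
      \<Longrightarrow> \<exists>D\<in>Obj C. \<exists>g. is_kernel C B D g A f"
    and epi_is_cokernel: "\<lbrakk>A \<in> Obj C; B \<in> Obj C; is_epi C A B f\<rbrakk>
      \<Longrightarrow> \<exists>D\<in>Obj C. \<exists>g. is_cokernel C D A g B f"

text \<open>\<open>0 \<rightarrow> X \<rightarrow> Y \<rightarrow> Z \<rightarrow> 0\<close> is exact, with maps \<open>f : X \<rightarrow> Y\<close> and \<open>g : Y \<rightarrow> Z\<close>.\<close>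

definition short_exact :: "('k, 'o, 'm) tensor_cat \<Rightarrow> 'o \<Rightarrow> 'o \<Rightarrow> 'o \<Rightarrow> 'm \<Rightarrow> 'm \<Rightarrow> bool" where
  "short_exact C X Y Z f g \<longleftrightarrow> X \<in> Obj C \<and> Y \<in> Obj C \<and> Z \<in> Obj C \<and>
     is_kernel C Y Z g X f \<and> is_cokernel C X Y f Z g"

subsection \<open>Locally finite categories\<close>

definition is_simple :: "('k, 'o, 'm) tensor_cat \<Rightarrow> 'o \<Rightarrow> bool" where
  "is_simple C S \<longleftrightarrow> S \<in> Obj C \<and> \<not> is_zero C S \<and>
     (\<forall>W\<in>Obj C. \<forall>i. is_mono C W S i \<longrightarrow> is_zero C W \<or> is_iso C W S i)"

inductive finite_length :: "('k, 'o, 'm) tensor_cat \<Rightarrow> 'o \<Rightarrow> bool" for C where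
  zero: "is_zero C X \<Longrightarrow> finite_length C X"
| extension: "\<lbrakk>finite_length C X; short_exact C X Y S f g; is_simple C S\<rbrakk> \<Longrightarrow> finite_length C Y"

definition lin_comb :: "('k, 'o, 'm) tensor_cat \<Rightarrow> 'o \<Rightarrow> 'o \<Rightarrow> 'k list \<Rightarrow> 'm list \<Rightarrow> 'm" where
  "lin_comb C A B as fs = foldr (\<lambda>(a, f) s. a \<star>\<^bsub>C\<^esub> f \<boxplus>\<^bsub>C\<^esub> s) (zip as fs) (\<zero>\<^bsub>C\<^esub> A B)"

locale locally_finite_category = abelian_linear_category +
  assumes hom_finite_dim: "\<lbrakk>A \<in> Obj C; B \<in> Obj C\<rbrakk> \<Longrightarrow>
      \<exists>fs. set fs \<subseteq> Hom C A B \<and>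
           (\<forall>f\<in>Hom C A B. \<exists>as. length as = length fs \<and> f = lin_comb C A B as fs)"
    and all_finite_length: "A \<in> Obj C \<Longrightarrow> finite_length C A"

subsection \<open>Symmetric monoidal structure and duals\<close>

locale symmetric_monoidal_linear_category = linear_category +
  assumes one_obj: "\<I> \<in> Obj C"
    and tens_obj: "\<lbrakk>A \<in> Obj C; B \<in> Obj C\<rbrakk> \<Longrightarrow> A \<boxtimes> B \<in> Obj C"
    and tens_hom: "\<lbrakk>A \<in> Obj C; A' \<in> Obj C; B \<in> Obj C; B' \<in> Obj C; f \<in> Hom C A A'; g \<in> Hom C B B'\<rbrakk>
      \<Longrightarrow> f \<diamondop> g \<in> Hom C (A \<boxtimes> B) (A' \<boxtimes> B')"
    and tens_id: "\<lbrakk>A \<in> Obj C; B \<in> Obj C\<rbrakk> \<Longrightarrow> \<i>\<d> A \<diamondop> \<i>\<d> B = \<i>\<d> (A \<boxtimes> B)"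
    and tens_comp: "\<lbrakk>A \<in> Obj C; A' \<in> Obj C; A'' \<in> Obj C; B \<in> Obj C; B' \<in> Obj C; B'' \<in> Obj C;
      f \<in> Hom C A A'; f' \<in> Hom C A' A''; g \<in> Hom C B B'; g' \<in> Hom C B' B''\<rbrakk>
      \<Longrightarrow> (f' \<cdot> f) \<diamondop> (g' \<cdot> g) = (f' \<diamondop> g') \<cdot> (f \<diamondop> g)"
    and tens_plus: "\<lbrakk>A \<in> Obj C; A' \<in> Obj C; B \<in> Obj C; B' \<in> Obj C;
      f \<in> Hom C A A'; g \<in> Hom C B B'; g' \<in> Hom C B B'\<rbrakk>
      \<Longrightarrow> f \<diamondop> (g \<boxplus> g') = (f \<diamondop> g) \<boxplus> (f \<diamondop> g')"
    and plus_tens: "\<lbrakk>A \<in> Obj C; A' \<in> Obj C; B \<in> Obj C; B' \<in> Obj C;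
      f \<in> Hom C A A'; f' \<in> Hom C A A'; g \<in> Hom C B B'\<rbrakk>
      \<Longrightarrow> (f \<boxplus> f') \<diamondop> g = (f \<diamondop> g) \<boxplus> (f' \<diamondop> g)"
    and tens_scale: "\<lbrakk>A \<in> Obj C; A' \<in> Obj C; B \<in> Obj C; B' \<in> Obj C; f \<in> Hom C A A'; g \<in> Hom C B B'\<rbrakk>
      \<Longrightarrow> f \<diamondop> (a \<star> g) = a \<star> (f \<diamondop> g)"
    and scale_tens: "\<lbrakk>A \<in> Obj C; A' \<in> Obj C; B \<in> Obj C; B' \<in> Obj C; f \<in> Hom C A A'; g \<in> Hom C B B'\<rbrakk>
      \<Longrightarrow> (a \<star> f) \<diamondop> g = a \<star> (f \<diamondop> g)"
    and assoc_iso: "\<lbrakk>A \<in> Obj C; B \<in> Obj C; D \<in> Obj C\<rbrakk>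
      \<Longrightarrow> is_iso C ((A \<boxtimes> B) \<boxtimes> D) (A \<boxtimes> (B \<boxtimes> D)) (\<a> A B D)"
    and assoc_natural: "\<lbrakk>A \<in> Obj C; A' \<in> Obj C; B \<in> Obj C; B' \<in> Obj C; D \<in> Obj C; D' \<in> Obj C;
      f \<in> Hom C A A'; g \<in> Hom C B B'; h \<in> Hom C D D'\<rbrakk>
      \<Longrightarrow> \<a> A' B' D' \<cdot> ((f \<diamondop> g) \<diamondop> h) = (f \<diamondop> (g \<diamondop> h)) \<cdot> \<a> A B D"
    and lunit_iso: "A \<in> Obj C \<Longrightarrow> is_iso C (\<I> \<boxtimes> A) A (\<l> A)"
    and lunit_natural: "\<lbrakk>A \<in> Obj C; A' \<in> Obj C; f \<in> Hom C A A'\<rbrakk>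
      \<Longrightarrow> \<l> A' \<cdot> (\<i>\<d> \<I> \<diamondop> f) = f \<cdot> \<l> A"
    and runit_iso: "A \<in> Obj C \<Longrightarrow> is_iso C (A \<boxtimes> \<I>) A (\<r> A)"
    and runit_natural: "\<lbrakk>A \<in> Obj C; A' \<in> Obj C; f \<in> Hom C A A'\<rbrakk>
      \<Longrightarrow> \<r> A' \<cdot> (f \<diamondop> \<i>\<d> \<I>) = f \<cdot> \<r> A"
    and pentagon: "\<lbrakk>A \<in> Obj C; B \<in> Obj C; D \<in> Obj C; E \<in> Obj C\<rbrakk>
      \<Longrightarrow> \<a> A B (D \<boxtimes> E) \<cdot> \<a> (A \<boxtimes> B) D E
        = (\<i>\<d> A \<diamondop> \<a> B D E) \<cdot> \<a> A (B \<boxtimes> D) E \<cdot> (\<a> A B D \<diamondop> \<i>\<d> E)"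
    and triangle: "\<lbrakk>A \<in> Obj C; B \<in> Obj C\<rbrakk> \<Longrightarrow> (\<i>\<d> A \<diamondop> \<l> B) \<cdot> \<a> A \<I> B = \<r> A \<diamondop> \<i>\<d> B"
    and braid_hom: "\<lbrakk>A \<in> Obj C; B \<in> Obj C\<rbrakk> \<Longrightarrow> \<c> A B \<in> Hom C (A \<boxtimes> B) (B \<boxtimes> A)"
    and braid_natural: "\<lbrakk>A \<in> Obj C; A' \<in> Obj C; B \<in> Obj C; B' \<in> Obj C; f \<in> Hom C A A'; g \<in> Hom C B B'\<rbrakk>
      \<Longrightarrow> \<c> A' B' \<cdot> (f \<diamondop> g) = (g \<diamondop> f) \<cdot> \<c> A B"
    and braid_symmetric: "\<lbrakk>A \<in> Obj C; B \<in> Obj C\<rbrakk> \<Longrightarrow> \<c> B A \<cdot> \<c> A B = \<i>\<d> (A \<boxtimes> B)"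
    and hexagon: "\<lbrakk>A \<in> Obj C; B \<in> Obj C; D \<in> Obj C\<rbrakk>
      \<Longrightarrow> \<a> B D A \<cdot> \<c> A (B \<boxtimes> D) \<cdot> \<a> A B D
        = (\<i>\<d> B \<diamondop> \<c> A D) \<cdot> \<a> B A D \<cdot> (\<c> A B \<diamondop> \<i>\<d> D)"

text \<open>\<open>D\<close> is a left dual of \<open>X\<close>, with \<open>ev : D \<otimes> X \<rightarrow> 1\<close> and \<open>coev : 1 \<rightarrow> X \<otimes> D\<close>; equivalently,
  \<open>X\<close> is a right dual of \<open>D\<close>.\<close>

definition is_dual :: "('k, 'o, 'm) tensor_cat \<Rightarrow> 'o \<Rightarrow> 'o \<Rightarrow> 'm \<Rightarrow> 'm \<Rightarrow> bool" where
  "is_dual C X D ev coev \<longleftrightarrow> D \<in> Obj C \<and>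
     ev \<in> Hom C (D \<boxtimes>\<^bsub>C\<^esub> X) \<I>\<^bsub>C\<^esub> \<and> coev \<in> Hom C \<I>\<^bsub>C\<^esub> (X \<boxtimes>\<^bsub>C\<^esub> D) \<and>
     \<r>\<^bsub>C\<^esub> X \<cdot>\<^bsub>C\<^esub> (\<i>\<d>\<^bsub>C\<^esub> X \<diamondop>\<^bsub>C\<^esub> ev) \<cdot>\<^bsub>C\<^esub> \<a>\<^bsub>C\<^esub> X D X \<cdot>\<^bsub>C\<^esub> (coev \<diamondop>\<^bsub>C\<^esub> \<i>\<d>\<^bsub>C\<^esub> X) = \<l>\<^bsub>C\<^esub> X \<and>
     (\<exists>b. is_inverse C ((D \<boxtimes>\<^bsub>C\<^esub> X) \<boxtimes>\<^bsub>C\<^esub> D) (D \<boxtimes>\<^bsub>C\<^esub> (X \<boxtimes>\<^bsub>C\<^esub> D)) (\<a>\<^bsub>C\<^esub> D X D) b \<and>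
        \<l>\<^bsub>C\<^esub> D \<cdot>\<^bsub>C\<^esub> (ev \<diamondop>\<^bsub>C\<^esub> \<i>\<d>\<^bsub>C\<^esub> D) \<cdot>\<^bsub>C\<^esub> b \<cdot>\<^bsub>C\<^esub> (\<i>\<d>\<^bsub>C\<^esub> D \<diamondop>\<^bsub>C\<^esub> coev) = \<r>\<^bsub>C\<^esub> D)"

locale symmetric_tensor_category = locally_finite_category + symmetric_monoidal_linear_category +
  assumes left_rigid: "X \<in> Obj C \<Longrightarrow> \<exists>D ev coev. is_dual C X D ev coev"
    and right_rigid: "X \<in> Obj C \<Longrightarrow> \<exists>D\<in>Obj C. \<exists>ev coev. is_dual C D X ev coev"
    and end_one: "bij_betw (\<lambda>a. a \<star> \<i>\<d> \<I>) UNIV (Hom C \<I> \<I>)"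

text \<open>The dimension does not depend on the chosen dual, since duals are unique up to unique
  isomorphism.\<close>

definition cat_dim :: "('k, 'o, 'm) tensor_cat \<Rightarrow> 'o \<Rightarrow> 'k" where
  "cat_dim C X = (THE a. \<exists>D ev coev. is_dual C X D ev coev \<and>
     ev \<cdot>\<^bsub>C\<^esub> \<c>\<^bsub>C\<^esub> X D \<cdot>\<^bsub>C\<^esub> coev = a \<star>\<^bsub>C\<^esub> \<i>\<d>\<^bsub>C\<^esub> \<I>\<^bsub>C\<^esub>)"

subsection \<open>Symmetric and exterior powers\<close>

primrec tens_pow :: "('k, 'o, 'm) tensor_cat \<Rightarrow> 'o \<Rightarrow> nat \<Rightarrow> 'o" where
  "tens_pow C X 0 = \<I>\<^bsub>C\<^esub>"
| "tens_pow C X (Suc n) = X \<boxtimes>\<^bsub>C\<^esub> tens_pow C X n"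

text \<open>For \<open>j : J \<rightarrow> X \<otimes> X\<close>, the map \<open>ideal_map C X J j i m\<close> is
  \<open>id \<otimes> j \<otimes> id : X\<^sup>\<otimes>\<^sup>i \<otimes> J \<otimes> X\<^sup>\<otimes>\<^sup>m \<rightarrow> X\<^sup>\<otimes>\<^sup>(\<^sup>i\<^sup>+\<^sup>m\<^sup>+\<^sup>2\<^sup>)\<close>, with source \<open>ideal_src C X J i m\<close>. The degree \<open>n\<close> part of the
  two-sided ideal of \<open>TX\<close> generated by \<open>J\<close> is the sum of the images of these maps over all
  \<open>i + m + 2 = n\<close>; dividing it out means taking the joint cokernel of these maps.\<close>

primrec ideal_src :: "('k, 'o, 'm) tensor_cat \<Rightarrow> 'o \<Rightarrow> 'o \<Rightarrow> nat \<Rightarrow> nat \<Rightarrow> 'o" where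
  "ideal_src C X J 0 m = J \<boxtimes>\<^bsub>C\<^esub> tens_pow C X m"
| "ideal_src C X J (Suc i) m = X \<boxtimes>\<^bsub>C\<^esub> ideal_src C X J i m"

primrec ideal_map :: "('k, 'o, 'm) tensor_cat \<Rightarrow> 'o \<Rightarrow> 'm \<Rightarrow> nat \<Rightarrow> nat \<Rightarrow> 'm" where
  "ideal_map C X j 0 m = \<a>\<^bsub>C\<^esub> X X (tens_pow C X m) \<cdot>\<^bsub>C\<^esub> (j \<diamondop>\<^bsub>C\<^esub> \<i>\<d>\<^bsub>C\<^esub> (tens_pow C X m))"
| "ideal_map C X j (Suc i) m = \<i>\<d>\<^bsub>C\<^esub> X \<diamondop>\<^bsub>C\<^esub> ideal_map C X j i m"

definition is_degree_part ::
  "('k, 'o, 'm) tensor_cat \<Rightarrow> 'o \<Rightarrow> 'o \<Rightarrow> 'm \<Rightarrow> nat \<Rightarrow> 'o \<Rightarrow> 'm \<Rightarrow> bool" where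
  "is_degree_part C X J j n Q q \<longleftrightarrow> Q \<in> Obj C \<and> q \<in> Hom C (tens_pow C X n) Q \<and>
     (\<forall>i m. i + m + 2 = n \<longrightarrow> q \<cdot>\<^bsub>C\<^esub> ideal_map C X j i m = \<zero>\<^bsub>C\<^esub> (ideal_src C X J i m) Q) \<and>
     (\<forall>W\<in>Obj C. \<forall>h\<in>Hom C (tens_pow C X n) W.
        (\<forall>i m. i + m + 2 = n \<longrightarrow> h \<cdot>\<^bsub>C\<^esub> ideal_map C X j i m = \<zero>\<^bsub>C\<^esub> (ideal_src C X J i m) W) \<longrightarrow>
        (\<exists>!u. u \<in> Hom C Q W \<and> u \<cdot>\<^bsub>C\<^esub> q = h))"

definition braid_minus_id :: "('k::field, 'o, 'm) tensor_cat \<Rightarrow> 'o \<Rightarrow> 'm" where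
  "braid_minus_id C X = \<c>\<^bsub>C\<^esub> X X \<boxplus>\<^bsub>C\<^esub> (- 1) \<star>\<^bsub>C\<^esub> \<i>\<d>\<^bsub>C\<^esub> (X \<boxtimes>\<^bsub>C\<^esub> X)"

definition sym_pow :: "('k::field, 'o, 'm) tensor_cat \<Rightarrow> 'o \<Rightarrow> nat \<Rightarrow> 'o" where
  "sym_pow C X n = (SOME Q. \<exists>J j q.
     is_image C (X \<boxtimes>\<^bsub>C\<^esub> X) (X \<boxtimes>\<^bsub>C\<^esub> X) (braid_minus_id C X) J j \<and> is_degree_part C X J j n Q q)"

definition ext_pow :: "('k::field, 'o, 'm) tensor_cat \<Rightarrow> 'o \<Rightarrow> nat \<Rightarrow> 'o" where
  "ext_pow C X n = (SOME Q. \<exists>J j q.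
     is_kernel C (X \<boxtimes>\<^bsub>C\<^esub> X) (X \<boxtimes>\<^bsub>C\<^esub> X) (braid_minus_id C X) J j \<and> is_degree_part C X J j n Q q)"

subsection \<open>2-adic dimensions\<close>

text \<open>Here \<open>(1 - z)\<^sup>t\<close> is read as \<open>(1 + w)\<^sup>t\<close> with \<open>w = - z\<close>.\<close>

definition Dim_plus :: "('k::field, 'o, 'm) tensor_cat \<Rightarrow> 'o \<Rightarrow> two_adic" where
  "Dim_plus C X = (THE t.
     Abs_fps (\<lambda>j. cat_dim C (sym_pow C X j)) = one_plus_powr (- fps_X) (- t))"

definition Dim_minus :: "('k::field, 'o, 'm) tensor_cat \<Rightarrow> 'o \<Rightarrow> two_adic" where
  "Dim_minus C X = (THE t.
     Abs_fps (\<lambda>j. cat_dim C (ext_pow C X j)) = one_plus_powr fps_X t)"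

text \<open>HOL cannot quantify existentially over types, so the carrier types of objects and morphisms
  have to be fixed. No generality is lost: an algebraically closed field is infinite, and in a
  symmetric tensor category the full tensor subcategory generated by a single object, closed under
  subquotients, is equivalent to one with at most as many objects and morphisms as \<open>'k\<close> has
  elements. Hence it can be realised with objects and morphisms drawn from any type of at least
  that cardinality, such as \<open>'k mat\<close>.\<close>

type_synonym 'k small_tensor_cat = "('k, 'k mat, 'k mat) tensor_cat"

end

theory Submission
  imports Defs
begin

text \<open>The category consists of vector spaces with a square-zero endomorphism \<open>d\<close>, i.e. of modules over
  \<open>k[d]/d\<^sup>2\<close> with \<open>d\<close> primitive; in characteristic 2 this is a Hopf algebra, and \<open>R = 1 \<otimes> 1 + d \<otimes> d\<close> is a
  triangular structure on it, so that the flip composed with \<open>1 + d \<otimes> d\<close> is a symmetric braiding. Because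
  \<open>d\<^sup>2 = 0\<close>, the categorical dimension is still the vector space dimension modulo 2.

  Let \<open>P\<close> be the free module of rank one, with basis \<open>x\<close> and \<open>y = d x\<close>; it is an extension of \<open>1\<close> by \<open>1\<close>.
  The braiding sends \<open>x \<otimes> x\<close> to \<open>x \<otimes> x + y \<otimes> y\<close>, so that \<open>y\<^sup>2 = 0\<close> in \<open>S P\<close>. Moreover the kernel and the
  image of \<open>c - 1\<close> on \<open>P \<otimes> P\<close> coincide, so \<open>S P = \<Lambda> P = k[x, y]/y\<^sup>2\<close> has dimension 2 in every positive
  degree and both generating functions equal 1, that is, both 2-adic dimensions of \<open>P\<close> are 0, whereas
  those of the unit object are 1.\<close>

text \<open>This is the category known as Ver_4^+. Its categorical dimension, the vector space
  dimension modulo 2, is additive, so a failure can only show in a higher binary digit. A split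
  extension of 1 by 1 would have S = k[x, y] with Hilbert series (1 - z)^(-2); the relation y^2 = 0
  turns it into (1 + z)/(1 - z), which is 1 in characteristic 2. So 0 stands against 1 + 1, and the
  two agree modulo 2 but not modulo 4. The obstacle is that \<open>sym_pow\<close> and
  \<open>ext_pow\<close> are arbitrary choices, even of the generators \<open>J\<close> and
  \<open>j\<close> of the ideal. Everything is therefore reduced to linear algebra that no choice
  can affect: relations count only through their column space, and a quotient is recognised by a
  linear section, which need not commute with d. Kernels come with matrices \<open>L\<close> and
  \<open>G\<close> such that \<open>K * L + G * F\<close> is the identity, which turns each
  universal property into a matrix identity.\<close>

section \<open>Matrix algebra with side conditions on dimensions instead of carriers\<close>

lemma mult_assoc_dim:
  fixes A :: "'a::semiring_0 mat"
  assumes "dim_col A = dim_row B" "dim_col B = dim_row D"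
  shows "(A * B) * D = A * (B * D)"
  using assms by (intro assoc_mult_mat[of _ "dim_row A" "dim_col A" _ "dim_col B" _ "dim_col D"]) auto

lemma mult_add_dim:
  fixes A :: "'a::semiring_0 mat"
  assumes "dim_col A = dim_row B" "dim_row B = dim_row D" "dim_col B = dim_col D"
  shows "A * (B + D) = A * B + A * D"
  using assms by (intro mult_add_distrib_mat[of _ "dim_row A" "dim_col A" _ "dim_col B"]) auto

lemma add_mult_dim:
  fixes A :: "'a::semiring_0 mat"
  assumes "dim_col A = dim_row D" "dim_row B = dim_row A" "dim_col B = dim_col A"
  shows "(A + B) * D = A * D + B * D"
  using assms by (intro add_mult_distrib_mat[of _ "dim_row A" "dim_col A" _ _ "dim_col D"]) auto

lemma add_assoc_dim:
  fixes A :: "'a::monoid_add mat"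
  assumes "dim_row A = dim_row B" "dim_col A = dim_col B" "dim_row D = dim_row B" "dim_col D = dim_col B"
  shows "(A + B) + D = A + (B + D)"
  using assms by (intro eq_matI) (auto simp: add.assoc)

lemma add_commute_dim:
  fixes A :: "'a::ab_semigroup_add mat"
  assumes "dim_row A = dim_row B" "dim_col A = dim_col B"
  shows "A + B = B + A"
  using assms by (intro eq_matI) (auto simp: add.commute)

lemma smult_mult_dim:
  fixes A :: "'a::comm_semiring_0 mat"
  assumes "dim_col A = dim_row B"
  shows "(c \<cdot>\<^sub>m A) * B = c \<cdot>\<^sub>m (A * B)"
  using assms by (intro eq_matI) (auto simp: scalar_prod_def sum_distrib_left mult_ac)

lemma mult_smult_dim:
  fixes A :: "'a::comm_semiring_0 mat"
  assumes "dim_col A = dim_row B"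
  shows "A * (c \<cdot>\<^sub>m B) = c \<cdot>\<^sub>m (A * B)"
  using assms by (intro eq_matI) (auto simp: scalar_prod_def sum_distrib_left mult_ac)

lemma add_zero_dim [simp]:
  fixes A :: "'a::monoid_add mat"
  assumes "dim_row A = m" "dim_col A = n"
  shows "A + 0\<^sub>m m n = A" "0\<^sub>m m n + A = A"
  using assms by (auto intro!: eq_matI)

lemma index_mult_sum:
  "i < dim_row A \<Longrightarrow> j < dim_col B \<Longrightarrow> (A * B) $$ (i, j) = (\<Sum>k<dim_row B. A $$ (i, k) * B $$ (k, j))"
  if "dim_col A = dim_row B"
  using that by (auto simp: scalar_prod_def atLeast0LessThan)

lemma transpose_mult_dim:
  fixes A :: "'a::comm_semiring_0 mat"
  assumes "dim_col A = dim_row B"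
  shows "transpose_mat (A * B) = transpose_mat B * transpose_mat A"
  using assms by (intro transpose_mult[of _ "dim_row A" "dim_col A" _ "dim_col B"]) auto

lemma transpose_zero: "transpose_mat (0\<^sub>m m n) = 0\<^sub>m n m"
  by (intro eq_matI) auto

section \<open>Kronecker products\<close>

text \<open>Kronecker products code a pair (i, j) by the single index \<open>i * b + j\<close>,
  decoded by \<open>div b\<close> and \<open>mod b\<close>; this and the next lemmas collect the
  arithmetic of the coding.\<close>

lemma digits_less: "i < a \<Longrightarrow> j < b \<Longrightarrow> i * b + j < a * (b::nat)"
  using mult_le_mono1[of "Suc i" a b] by auto

lemma digitsE:
  assumes "k < a * (b::nat)"
  obtains i j where "i < a" "j < b" "k = i * b + j"
  using assms by (metis div_mult_mod_eq less_mult_imp_div_less mod_less_divisor mult_0_right not_gr_zero not_less_zero)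

lemma digits: "j < b \<Longrightarrow> (i * b + j) div b = i" "j < b \<Longrightarrow> (i * b + j) mod b = (j::nat)"
  by auto

lemma sum_div_mod:
  fixes f :: "nat \<Rightarrow> nat \<Rightarrow> 'a::comm_monoid_add"
  shows "(\<Sum>k<a * b. f (k div b) (k mod b)) = (\<Sum>i<a. \<Sum>j<b. f i j)"
proof -
  have "(\<Sum>i<a. \<Sum>j<b. f i j) = (\<Sum>(i, j)\<in>{..<a} \<times> {..<b}. f i j)"
    by (simp add: sum.cartesian_product)
  also have "\<dots> = (\<Sum>k<a * b. f (k div b) (k mod b))"
    by (rule sum.reindex_bij_witness[where i = "\<lambda>k. (k div b, k mod b)" and j = "\<lambda>(i, j). i * b + j"])
      (auto simp: digits_less elim!: digitsE)
  finally show ?thesis ..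
qed

definition kron :: "'a::semiring_0 mat \<Rightarrow> 'a mat \<Rightarrow> 'a mat" where
  "kron A B = mat (dim_row A * dim_row B) (dim_col A * dim_col B)
     (\<lambda>(i, j). A $$ (i div dim_row B, j div dim_col B) * B $$ (i mod dim_row B, j mod dim_col B))"

lemma kron_dim [simp]:
  "dim_row (kron A B) = dim_row A * dim_row B" "dim_col (kron A B) = dim_col A * dim_col B"
  by (simp_all add: kron_def)

lemma kron_index:
  "i < dim_row A * dim_row B \<Longrightarrow> j < dim_col A * dim_col B \<Longrightarrow>
   kron A B $$ (i, j) = A $$ (i div dim_row B, j div dim_col B) * B $$ (i mod dim_row B, j mod dim_col B)"
  by (simp add: kron_def)

lemma less_multD:
  assumes "i < a * (b::nat)" shows "i div b < a" "i mod b < b" "0 < b" "0 < a"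
  using assms by (auto simp: less_mult_imp_div_less intro!: Nat.gr0I mod_less_divisor)

lemma mat_eq_kronI:
  assumes "dim_row M = a * b" "dim_row N = a * b" "dim_col M = c * d" "dim_col N = c * d"
    and "\<And>i j k l. \<lbrakk>i < a; j < b; k < c; l < d\<rbrakk> \<Longrightarrow> M $$ (i * b + j, k * d + l) = N $$ (i * b + j, k * d + l)"
  shows "M = N"
  using assms(1-4) by (intro eq_matI) (auto simp: assms(5) elim!: digitsE)

text \<open>The mixed-product rule: the summation index splits into two digits and the double sum
  factors. It makes the tensor product of morphisms functorial.\<close>

lemma kron_mult:
  fixes A :: "'a::comm_semiring_0 mat"
  assumes "dim_col A = dim_row A'" "dim_col B = dim_row B'"
  shows "kron A B * kron A' B' = kron (A * A') (B * B')"
proof (rule eq_matI)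
  fix i j assume "i < dim_row (kron (A * A') (B * B'))" "j < dim_col (kron (A * A') (B * B'))"
  then have ij: "i < dim_row A * dim_row B" "j < dim_col A' * dim_col B'" by auto
  note b = less_multD[OF ij(1)] less_multD[OF ij(2)]
  let ?a = "\<lambda>k. A $$ (i div dim_row B, k) * A' $$ (k, j div dim_col B')"
  let ?b = "\<lambda>l. B $$ (i mod dim_row B, l) * B' $$ (l, j mod dim_col B')"
  have "(kron A B * kron A' B') $$ (i, j) = (\<Sum>k<dim_row A' * dim_row B'. kron A B $$ (i, k) * kron A' B' $$ (k, j))"
    using ij assms by (subst index_mult_sum) auto
  also have "\<dots> = (\<Sum>k<dim_row A' * dim_row B'. ?a (k div dim_row B') * ?b (k mod dim_row B'))"
    using ij assms by (intro sum.cong) (auto simp: kron_index mult_ac)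
  also have "\<dots> = (\<Sum>k<dim_row A'. \<Sum>l<dim_row B'. ?a k * ?b l)"
    by (rule sum_div_mod)
  also have "\<dots> = (\<Sum>k<dim_row A'. ?a k) * (\<Sum>l<dim_row B'. ?b l)"
    by (simp add: sum_product)
  also have "\<dots> = kron (A * A') (B * B') $$ (i, j)"
    using ij assms b by (simp add: kron_index index_mult_sum del: index_mult_mat(1))
  finally show "(kron A B * kron A' B') $$ (i, j) = kron (A * A') (B * B') $$ (i, j)" .
qed (use assms in auto)

lemma kron_assoc:
  fixes A :: "'a::comm_semiring_0 mat"
  shows "kron (kron A B) D = kron A (kron B D)"
proof (rule eq_matI)
  \<comment> \<open>Both bracketings decode an index into the same three digits, which is why
    associativity holds on the nose.\<close>
  have *: "i div (b * c) = i div c div b" "i mod (b * c) div c = i div c mod b" "i mod (b * c) mod c = i mod c"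
    if "0 < c" for i b c :: nat
    using that by (simp_all add: mult.commute[of b c] div_mult2_eq mod_mult2_eq)
  fix i j assume "i < dim_row (kron A (kron B D))" "j < dim_col (kron A (kron B D))"
  then have ij: "i < (dim_row A * dim_row B) * dim_row D" "j < (dim_col A * dim_col B) * dim_col D"
    by (auto simp: mult.assoc)
  note b = less_multD[OF ij(1)] less_multD[OF ij(2)]
  have "i mod (dim_row B * dim_row D) < dim_row B * dim_row D" "j mod (dim_col B * dim_col D) < dim_col B * dim_col D"
    using b by auto
  then show "kron (kron A B) D $$ (i, j) = kron A (kron B D) $$ (i, j)"
    using ij ij[unfolded mult.assoc] b by (simp add: kron_index * mult.assoc)
qed (auto simp: mult.assoc)

lemma kron_one: "kron (1\<^sub>m a) (1\<^sub>m b) = (1\<^sub>m (a * b) :: 'a::semiring_1 mat)"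
proof (rule eq_matI)
  fix i j assume "i < dim_row (1\<^sub>m (a * b) :: 'a mat)" "j < dim_col (1\<^sub>m (a * b) :: 'a mat)"
  then have ij: "i < a * b" "j < a * b" by auto
  note b = less_multD[OF ij(1)] less_multD[OF ij(2)]
  have "i = j \<longleftrightarrow> i div b = j div b \<and> i mod b = j mod b" by (metis div_mult_mod_eq)
  then show "kron (1\<^sub>m a) (1\<^sub>m b) $$ (i, j) = (1\<^sub>m (a * b) :: 'a mat) $$ (i, j)"
    using ij b by (auto simp: kron_index)
qed auto

lemma kron_one_left [simp]: "kron (1\<^sub>m (Suc 0)) A = (A :: 'a::semiring_1 mat)"
  by (rule eq_matI) (auto simp: kron_index)

lemma kron_one_right [simp]: "kron A (1\<^sub>m (Suc 0)) = (A :: 'a::semiring_1 mat)"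
  by (rule eq_matI) (auto simp: kron_index)

lemma kron_add_left:
  "dim_row A = dim_row B \<Longrightarrow> dim_col A = dim_col B \<Longrightarrow> kron (A + B) D = kron A D + kron B D"
  by (rule eq_matI) (auto simp: kron_index distrib_right less_multD)

lemma kron_add_right:
  "dim_row B = dim_row D \<Longrightarrow> dim_col B = dim_col D \<Longrightarrow> kron A (B + D) = kron A B + kron A D"
  by (rule eq_matI) (auto simp: kron_index distrib_left less_multD)

lemma kron_zero_left: "kron (0\<^sub>m a b) A = 0\<^sub>m (a * dim_row A) (b * dim_col A)"
  by (rule eq_matI) (auto simp: kron_index less_multD)

lemma kron_zero_right: "kron A (0\<^sub>m a b) = 0\<^sub>m (dim_row A * a) (dim_col A * b)"
  by (rule eq_matI) (auto simp: kron_index less_multD)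

lemma kron_smult_left: "kron (c \<cdot>\<^sub>m A) B = c \<cdot>\<^sub>m kron (A :: 'a::comm_semiring_0 mat) B"
  by (rule eq_matI) (auto simp: kron_index less_multD mult_ac)

lemma kron_smult_right: "kron A (c \<cdot>\<^sub>m B) = c \<cdot>\<^sub>m kron (A :: 'a::comm_semiring_0 mat) B"
  by (rule eq_matI) (auto simp: kron_index less_multD mult_ac)

section \<open>Permutation matrices and the flip\<close>

definition perm_mat :: "nat \<Rightarrow> (nat \<Rightarrow> nat) \<Rightarrow> 'a::zero_neq_one mat" where
  "perm_mat n p = mat n n (\<lambda>(r, s). if r = p s then 1 else 0)"

lemma perm_mat_dim [simp]: "dim_row (perm_mat n p) = n" "dim_col (perm_mat n p) = n"
  by (simp_all add: perm_mat_def)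

lemma perm_mat_mult:
  assumes "\<And>s. s < n \<Longrightarrow> q s < n"
  shows "perm_mat n p * perm_mat n q = (perm_mat n (p \<circ> q) :: 'a::comm_semiring_1 mat)"
proof (rule eq_matI, goal_cases)
  case (1 i j)
  then have "(perm_mat n p * perm_mat n q) $$ (i, j) = (\<Sum>k<n. perm_mat n p $$ (i, k) * perm_mat n q $$ (k, j))"
    by (subst index_mult_sum) auto
  also have "\<dots> = (\<Sum>k<n. if k = q j then (if i = p k then 1 else 0 :: 'a) else 0)"
    using 1 by (intro sum.cong) (auto simp: perm_mat_def)
  also have "\<dots> = perm_mat n (p \<circ> q) $$ (i, j)"
    using 1 assms by (simp add: perm_mat_def)
  finally show ?case .
qed auto

lemma perm_mat_cong:
  "(\<And>s. s < n \<Longrightarrow> p s = q s) \<Longrightarrow> perm_mat n p = perm_mat n q"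
  unfolding perm_mat_def by (intro eq_matI) auto

lemma perm_mat_id: "(\<And>s. s < n \<Longrightarrow> p s = s) \<Longrightarrow> perm_mat n p = 1\<^sub>m n"
  unfolding perm_mat_def by (intro eq_matI) auto

lemma kron_perm_mat:
  assumes "\<And>s. s < a \<Longrightarrow> p s < a" "\<And>s. s < b \<Longrightarrow> q s < b"
  shows "kron (perm_mat a p) (perm_mat b q)
    = (perm_mat (a * b) (\<lambda>s. p (s div b) * b + q (s mod b)) :: 'a::comm_semiring_1 mat)"
proof (rule mat_eq_kronI[where a = a and b = b and c = a and d = b])
  fix i j k l assume *: "i < a" "j < b" "k < a" "l < b"
  have "i * b + j = p k * b + q l \<longleftrightarrow> i = p k \<and> j = q l"
    using * assms by (metis Euclidean_Rings.div_eq_0_iff add.commute add.right_neutral div_mult_self1 mod_less mod_mult_self1 not_less_zero)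
  then show "kron (perm_mat a p) (perm_mat b q) $$ (i * b + j, k * b + l)
    = (perm_mat (a * b) (\<lambda>s. p (s div b) * b + q (s mod b)) :: 'a mat) $$ (i * b + j, k * b + l)"
    using * by (auto simp: kron_index digits_less perm_mat_def)
qed auto

text \<open>The flip of tensor factors of dimensions \<open>a\<close> and \<open>b\<close>: the
  index \<open>i * b + j\<close> of e_i \<otimes> e_j goes to \<open>j * a + i\<close>.\<close>

definition swap_mat :: "nat \<Rightarrow> nat \<Rightarrow> 'a::zero_neq_one mat" where
  "swap_mat a b = perm_mat (a * b) (\<lambda>s. s mod b * a + s div b)"

lemma swap_mat_dim [simp]: "dim_row (swap_mat a b) = a * b" "dim_col (swap_mat a b) = a * b"
  by (simp_all add: swap_mat_def)

lemma swap_index_less: "s < a * (b::nat) \<Longrightarrow> s mod b * a + s div b < a * b"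
  using digits_less[of "s mod b" b "s div b" a] less_multD[of s a b] by (simp add: mult.commute)

lemma swap_mat_swap_mat: "swap_mat b a * swap_mat a b = (1\<^sub>m (a * b) :: 'a::comm_semiring_1 mat)"
  unfolding swap_mat_def mult.commute[of b a]
  by (subst perm_mat_mult) (auto simp: swap_index_less less_multD intro!: perm_mat_id)

lemma swap_mat_one: "swap_mat (Suc 0) b = 1\<^sub>m b"
  unfolding swap_mat_def by (auto intro!: perm_mat_id)

lemma swap_mat_kron:
  fixes A :: "'a::comm_semiring_1 mat"
  shows "swap_mat (dim_row A) (dim_row B) * kron A B = kron B A * swap_mat (dim_col A) (dim_col B)"
proof (rule eq_matI, goal_cases)
  case (1 i j)
  then have i: "i < dim_row B * dim_row A" and j: "j < dim_col A * dim_col B" by (auto simp: mult.commute)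
  note b = less_multD[OF i] less_multD[OF j] swap_index_less[OF i] swap_index_less[OF j]
  \<comment> \<open>The flip has a single nonzero entry in each row and column: \<open>i'\<close> is
    the index that it sends to \<open>i\<close>, and \<open>j'\<close> is the image of
    \<open>j\<close>. Both sums below collapse to one term.\<close>
  define i' where "i' = i mod dim_row A * dim_row B + i div dim_row A"
  define j' where "j' = j mod dim_col B * dim_col A + j div dim_col B"
  have i': "i' < dim_row A * dim_row B" and j': "j' < dim_col B * dim_col A"
    using b by (auto simp: i'_def j'_def mult.commute)
  have ii: "i' mod dim_row B * dim_row A + i' div dim_row B = i" 
    using b by (auto simp: i'_def)
  have *: "i = k mod dim_row B * dim_row A + k div dim_row B \<longleftrightarrow> k = i'" if "k < dim_row A * dim_row B" for k
    using less_multD[OF that] ii by (auto simp: i'_def)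
  have "(swap_mat (dim_row A) (dim_row B) * kron A B) $$ (i, j)
    = (\<Sum>k<dim_row A * dim_row B. swap_mat (dim_row A) (dim_row B) $$ (i, k) * kron A B $$ (k, j))"
    using i j by (subst index_mult_sum) (auto simp: mult.commute)
  also have "\<dots> = (\<Sum>k<dim_row A * dim_row B. if k = i' then kron A B $$ (k, j) else 0)"
    using i by (intro sum.cong) (auto simp: swap_mat_def perm_mat_def mult.commute[of "dim_row B"] *)
  also have "\<dots> = kron A B $$ (i', j)" using i' by simp
  also have "\<dots> = kron B A $$ (i, j')"
    using i j i' j' b by (simp add: kron_index) (simp add: i'_def j'_def mult.commute)
  also have "\<dots> = (\<Sum>k<dim_col B * dim_col A. if k = j' then kron B A $$ (i, k) else 0)"
    using j' by simp
  also have "\<dots> = (\<Sum>k<dim_col B * dim_col A. kron B A $$ (i, k) * swap_mat (dim_col A) (dim_col B) $$ (k, j))"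
    using j by (intro sum.cong) (auto simp: swap_mat_def perm_mat_def mult.commute[of "dim_col B" "dim_col A"] j'_def)
  also have "\<dots> = (kron B A * swap_mat (dim_col A) (dim_col B)) $$ (i, j)"
    using i j by (subst index_mult_sum) (auto simp: mult.commute)
  finally show ?case .
qed (auto simp: mult.commute)

text \<open>All factors are permutation matrices, so this is a statement on index maps: carrying the
  first digit past the other two together amounts to carrying it past one and then the
  other.\<close>

lemma swap_mat_hexagon:
  "swap_mat a (b * d) = kron (1\<^sub>m b) (swap_mat a d) * kron (swap_mat a b) (1\<^sub>m d :: 'a::comm_semiring_1 mat)"
proof -
  have one: "1\<^sub>m n = (perm_mat n (\<lambda>s. s) :: 'a mat)" for n by (simp add: perm_mat_id)
  have e: "b * (a * d) = a * (b * d)" "a * b * d = a * (b * d)" by auto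
  have e2: "i * (b * d) + (j * d + k) = (i * b + j) * d + k" for i j k by (simp add: algebra_simps)
  have e3: "(j * a + i) * d + k = j * (a * d) + (i * d + k)" for i j k by (simp add: algebra_simps)
  show ?thesis unfolding one swap_mat_def
    apply (subst kron_perm_mat)
    apply (auto simp: swap_index_less)[2]
    apply (subst kron_perm_mat)
    apply (auto simp: swap_index_less)[2]
    unfolding e
    apply (subst perm_mat_mult)
    subgoal for s
      using digits_less[OF swap_index_less[of "s div d" a b], of "s mod d" d] less_multD[of s "a * b" d] by (simp add: e)
    apply (rule perm_mat_cong)
    subgoal for s
      unfolding o_def
      apply (erule digitsE)
      subgoal for i t
        apply (erule digitsE[where k = t])
        subgoal for j k
          using digits_less[of j b k d] digits_less[of i a k d] digits[of "j * d + k" "b * d" i, unfolded e2]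
          by (simp add: e2 e3 digits) (simp add: algebra_simps)
        done
      done
    done
qed

section \<open>Splitting off the kernel of a matrix\<close>

text \<open>One step of Gaussian elimination with pivot \<open>F $$ (i, j)\<close>. The columns of
  \<open>K\<close> span the kernel of row \<open>i\<close>, \<open>L\<close> forgets coordinate
  \<open>j\<close>, and \<open>G * F\<close> restores in that coordinate what \<open>K * L\<close>
  gets wrong, using row \<open>i\<close> only.\<close>

lemma pivot_split:
  fixes F :: "'a::field mat"
  assumes F: "F \<in> carrier_mat m (Suc n)" and ij: "i < m" "j < Suc n" "F $$ (i, j) \<noteq> 0"
  shows "\<exists>K L G. K \<in> carrier_mat (Suc n) n \<and> L \<in> carrier_mat n (Suc n) \<and> G \<in> carrier_mat (Suc n) m \<and>
    L * K = 1\<^sub>m n \<and> K * L + G * F = 1\<^sub>m (Suc n)"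
proof -
  \<comment> \<open>The increasing enumeration of all coordinates except \<open>j\<close>.\<close>
  define sk where "sk l = (if l < j then l else Suc l)" for l
  define K where "K = mat (Suc n) n (\<lambda>(p, l). if p = sk l then 1 else if p = j then - (F $$ (i, sk l) / F $$ (i, j)) else 0)"
  define L :: "'a mat" where "L = mat n (Suc n) (\<lambda>(l, p). if p = sk l then 1 else 0)"
  define G where "G = mat (Suc n) m (\<lambda>(p, q). if q = i then (if p = j then 1 / F $$ (i, j) else 0) else 0)"
  have sk: "sk l = sk l' \<longleftrightarrow> l = l'" "sk l \<noteq> j" "l < n \<Longrightarrow> sk l < Suc n" for l l'
    by (auto simp: sk_def)
  have sk_ex: "\<exists>l<n. p = sk l" if "p < Suc n" "p \<noteq> j" for p
  proof (cases "p < j")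
    case True
    then show ?thesis using ij by (intro exI[of _ p]) (simp add: sk_def)
  next
    case False
    then show ?thesis using that by (intro exI[of _ "p - 1"]) (simp add: sk_def, linarith)
  qed
  have 1: "L * K = 1\<^sub>m n"
  proof (rule eq_matI, goal_cases)
    case (1 l l')
    then have "(L * K) $$ (l, l') = (\<Sum>p<Suc n. L $$ (l, p) * K $$ (p, l'))"
      by (subst index_mult_sum) (auto simp: L_def K_def)
    also have "\<dots> = (\<Sum>p<Suc n. if p = sk l then K $$ (p, l') else 0)"
      using 1 by (intro sum.cong) (auto simp: L_def)
    also have "\<dots> = K $$ (sk l, l')" using 1 sk by (subst sum.delta) auto
    also have "\<dots> = 1\<^sub>m n $$ (l, l')" using 1 sk by (auto simp: K_def)
    finally show ?case .
  qed (auto simp: L_def K_def)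
  have 2: "K * L + G * F = 1\<^sub>m (Suc n)"
  proof (rule eq_matI, goal_cases)
    case (1 p p')
    then have p: "p < Suc n" "p' < Suc n" by auto
    have "(G * F) $$ (p, p') = (\<Sum>q<m. G $$ (p, q) * F $$ (q, p'))"
      using p F by (subst index_mult_sum) (auto simp: G_def)
    also have "\<dots> = (\<Sum>q<m. if q = i then (if p = j then F $$ (q, p') / F $$ (i, j) else 0) else 0)"
      using p by (intro sum.cong) (auto simp: G_def)
    also have "\<dots> = (if p = j then F $$ (i, p') / F $$ (i, j) else 0)"
      using ij by simp
    finally have G: "(G * F) $$ (p, p') = (if p = j then F $$ (i, p') / F $$ (i, j) else 0)" .
    have K: "(K * L) $$ (p, p') = (\<Sum>l<n. K $$ (p, l) * L $$ (l, p'))"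
      using p by (subst index_mult_sum) (auto simp: K_def L_def)
    have "(K * L + G * F) $$ (p, p') = (K * L) $$ (p, p') + (G * F) $$ (p, p')"
      using p F by (subst index_add_mat) (auto simp: G_def)
    moreover have "(K * L) $$ (p, p') + (G * F) $$ (p, p') = (if p = p' then 1 else 0)"
    proof (cases "p' = j")
      case True
      have "(K * L) $$ (p, p') = 0" unfolding K
        using p True sk(2) by (intro sum.neutral ballI) (simp add: L_def, metis)
      then show ?thesis using G True ij by auto
    next
      case False
      then obtain l where l: "l < n" "p' = sk l" using sk_ex p by blast
      have "(K * L) $$ (p, p') = (\<Sum>k<n. if k = l then K $$ (p, k) else 0)" unfolding K
        using p l sk by (intro sum.cong) (auto simp: L_def)
      also have "\<dots> = K $$ (p, l)" using l by simp
      also have "\<dots> = (if p = sk l then 1 else if p = j then - (F $$ (i, sk l) / F $$ (i, j)) else 0)"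
        using l p by (simp add: K_def)
      finally show ?thesis unfolding G using l(2) sk(2)[of l] by auto
    qed
    ultimately show ?case using p by simp
  qed (use F in \<open>auto simp: L_def K_def G_def\<close>)
  show ?thesis
    by (intro exI[of _ K] exI[of _ L] exI[of _ G] conjI 1 2) (auto simp: K_def L_def G_def)
qed

lemma add_diff_cancel_dim:
  fixes A :: "'a::ab_group_add mat"
  assumes "dim_row A = dim_row B" "dim_col A = dim_col B"
  shows "(A + B) - B = A"
  using assms by (intro eq_matI) auto

text \<open>The equation \<open>K * L + G * F = 1\<^sub>m n\<close> certifies that \<open>K\<close>
  exhausts the kernel: it gives \<open>v = K * (L * v)\<close> whenever \<open>F * v\<close>
  vanishes. The last clause, a drop in dimension for nonzero \<open>F\<close>, drives the induction
  on finite length.\<close>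

lemma kernel_split:
  fixes F :: "'a::field mat"
  assumes "F \<in> carrier_mat m n"
  shows "\<exists>k K L G. K \<in> carrier_mat n k \<and> L \<in> carrier_mat k n \<and> G \<in> carrier_mat n m \<and>
    L * K = 1\<^sub>m k \<and> F * K = 0\<^sub>m m k \<and> K * L + G * F = 1\<^sub>m n \<and> k \<le> n \<and> (F = 0\<^sub>m m n \<or> k < n)"
  using assms
proof (induction n arbitrary: F)
  case 0
  then show ?case
    by (intro exI[of _ "1\<^sub>m 0"] exI[of _ "0::nat"] exI[of _ "0\<^sub>m 0 m"]) auto
next
  case (Suc n)
  show ?case
  proof (cases "F = 0\<^sub>m m (Suc n)")
    case True
    then show ?thesis
      by (intro exI[of _ "1\<^sub>m (Suc n)"] exI[of _ "Suc n"] exI[of _ "0\<^sub>m (Suc n) m"]) auto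
  next
    case False
    then obtain i j where "i < m" "j < Suc n" "F $$ (i, j) \<noteq> 0"
      using Suc.prems by (metis carrier_matD eq_matI index_zero_mat)
    from pivot_split[OF Suc.prems this] obtain K\<^sub>1 L\<^sub>1 G\<^sub>1 where
      c1: "K\<^sub>1 \<in> carrier_mat (Suc n) n" "L\<^sub>1 \<in> carrier_mat n (Suc n)" "G\<^sub>1 \<in> carrier_mat (Suc n) m"
      and e1: "L\<^sub>1 * K\<^sub>1 = 1\<^sub>m n" "K\<^sub>1 * L\<^sub>1 + G\<^sub>1 * F = 1\<^sub>m (Suc n)" by blast
    have FK: "F * K\<^sub>1 \<in> carrier_mat m n" using Suc.prems c1 by simp
    from Suc.IH[OF FK] obtain k K\<^sub>2 L\<^sub>2 G\<^sub>2 where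
      c2: "K\<^sub>2 \<in> carrier_mat n k" "L\<^sub>2 \<in> carrier_mat k n" "G\<^sub>2 \<in> carrier_mat n m"
      and e2: "L\<^sub>2 * K\<^sub>2 = 1\<^sub>m k" "F * K\<^sub>1 * K\<^sub>2 = 0\<^sub>m m k" "K\<^sub>2 * L\<^sub>2 + G\<^sub>2 * (F * K\<^sub>1) = 1\<^sub>m n"
        "k \<le> n" by blast
    note dims = carrier_matD[OF Suc.prems] carrier_matD[OF c1(1)] carrier_matD[OF c1(2)] carrier_matD[OF c1(3)]
      carrier_matD[OF c2(1)] carrier_matD[OF c2(2)] carrier_matD[OF c2(3)]
    \<comment> \<open>\<open>M\<close> is made so that
      \<open>M * F = F * (K\<^sub>1 * L\<^sub>1)\<close>: the correction term obtained for the
      restricted map \<open>F * K\<^sub>1\<close> thereby becomes a left multiple of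
      \<open>F\<close> itself.\<close>
    define M where "M = 1\<^sub>m m - F * G\<^sub>1"
    have cM: "dim_row M = m" "dim_col M = m" using dims by (auto simp: M_def)
    have "F = F * (K\<^sub>1 * L\<^sub>1 + G\<^sub>1 * F)" using e1 dims by simp
    then have F: "F = F * (K\<^sub>1 * L\<^sub>1) + F * (G\<^sub>1 * F)" using dims by (simp add: mult_add_dim)
    have "M * F = F - F * G\<^sub>1 * F"
      unfolding M_def using Suc.prems c1 by (subst minus_mult_distrib_mat[of _ m m]) auto
    also have "\<dots> = F * (K\<^sub>1 * L\<^sub>1) + F * (G\<^sub>1 * F) - F * (G\<^sub>1 * F)"
      using F dims by (simp add: mult_assoc_dim)
    also have "\<dots> = F * (K\<^sub>1 * L\<^sub>1)"
      using dims by (simp add: add_diff_cancel_dim)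
    finally have MF: "M * F = F * (K\<^sub>1 * L\<^sub>1)" .
    let ?K = "K\<^sub>1 * K\<^sub>2" and ?L = "L\<^sub>2 * L\<^sub>1" and ?G = "G\<^sub>1 + K\<^sub>1 * G\<^sub>2 * M"
    have "?L * ?K = L\<^sub>2 * (L\<^sub>1 * K\<^sub>1) * K\<^sub>2" using dims by (simp add: mult_assoc_dim)
    then have 1: "?L * ?K = 1\<^sub>m k" using e1 e2 dims by simp
    have 2: "F * ?K = 0\<^sub>m m k" using e2(2) dims by (simp add: mult_assoc_dim)
    have "?K * ?L + ?G * F = K\<^sub>1 * (K\<^sub>2 * L\<^sub>2 + G\<^sub>2 * (F * K\<^sub>1)) * L\<^sub>1 + G\<^sub>1 * F"
      using dims cM MF by (simp add: mult_assoc_dim mult_add_dim add_mult_dim) (intro eq_matI, auto simp: add_ac simp del: index_mult_mat(1))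
    then have 3: "?K * ?L + ?G * F = 1\<^sub>m (Suc n)" using e1 e2 dims by simp
    show ?thesis
      by (intro exI[of _ k] exI[of _ ?K] exI[of _ ?L] exI[of _ ?G] conjI 1 2 3)
        (use c1 c2 cM \<open>k \<le> n\<close> in auto)
  qed
qed

lemma cokernel_split:
  fixes F :: "'a::field mat"
  assumes F: "F \<in> carrier_mat m n"
  shows "\<exists>k C S G. C \<in> carrier_mat k m \<and> S \<in> carrier_mat m k \<and> G \<in> carrier_mat n m \<and>
    C * S = 1\<^sub>m k \<and> C * F = 0\<^sub>m k n \<and> S * C + F * G = 1\<^sub>m m"
proof -
  have "transpose_mat F \<in> carrier_mat n m" using F by simp
  from kernel_split[OF this] obtain k K L G where c: "K \<in> carrier_mat m k" "L \<in> carrier_mat k m" "G \<in> carrier_mat m n"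
    and e: "L * K = 1\<^sub>m k" "transpose_mat F * K = 0\<^sub>m n k" "K * L + G * transpose_mat F = 1\<^sub>m m"
    by blast
  have "transpose_mat K * transpose_mat L = 1\<^sub>m k"
    by (metis e(1) c(1,2) transpose_mult transpose_one)
  moreover have "transpose_mat K * F = 0\<^sub>m k n"
    using arg_cong[OF e(2), of transpose_mat] c F by (simp add: transpose_mult_dim transpose_zero)
  moreover have "transpose_mat L * transpose_mat K + F * transpose_mat G = 1\<^sub>m m"
    using arg_cong[OF e(3), of transpose_mat] c F
    by (simp add: transpose_add[of _ m m] transpose_mult_dim)
  ultimately show ?thesis using c
    by (intro exI[of _ k] exI[of _ "transpose_mat K"] exI[of _ "transpose_mat L"] exI[of _ "transpose_mat G"]) simp
qed

section \<open>The category of square-zero matrices\<close>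

definition sqz :: "'a::comm_ring_1 mat set" where
  "sqz = {D. dim_col D = dim_row D \<and> D * D = 0\<^sub>m (dim_row D) (dim_row D)}"

definition intertwiners :: "'a::comm_ring_1 mat \<Rightarrow> 'a mat \<Rightarrow> 'a mat set" where
  "intertwiners D E = {F. dim_row F = dim_row E \<and> dim_col F = dim_row D \<and> E * F = F * D}"

definition tensor_sqz :: "'a::comm_ring_1 mat \<Rightarrow> 'a mat \<Rightarrow> 'a mat" where
  "tensor_sqz D E = kron D (1\<^sub>m (dim_row E)) + kron (1\<^sub>m (dim_row D)) E"

definition braid_sqz :: "'a::comm_ring_1 mat \<Rightarrow> 'a mat \<Rightarrow> 'a mat" where
  "braid_sqz D E = swap_mat (dim_row D) (dim_row E) * (1\<^sub>m (dim_row D * dim_row E) + kron D E)"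

text \<open>The Kronecker product is strictly associative and unital, so all constraints except the braiding
  are identity matrices.\<close>

definition sqz_cat :: "'k::field small_tensor_cat" where
  "sqz_cat = \<lparr>Obj = sqz, Hom = intertwiners, Idt = (\<lambda>D. 1\<^sub>m (dim_row D)), Comp = (*),
     Zero = (\<lambda>D E. 0\<^sub>m (dim_row E) (dim_row D)), Plus = (+), Scale = (\<cdot>\<^sub>m),
     One = 0\<^sub>m 1 1, TensO = tensor_sqz, TensM = kron,
     Assoc = (\<lambda>D E F. 1\<^sub>m (dim_row D * dim_row E * dim_row F)),
     Lunit = (\<lambda>D. 1\<^sub>m (dim_row D)), Runit = (\<lambda>D. 1\<^sub>m (dim_row D)), Braid = braid_sqz\<rparr>"

lemma sqz_cat_simps [simp]:
  "Obj sqz_cat = sqz" "Hom sqz_cat = intertwiners" "Idt sqz_cat D = 1\<^sub>m (dim_row D)" "Comp sqz_cat = (*)"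
  "Zero sqz_cat D E = 0\<^sub>m (dim_row E) (dim_row D)" "Plus sqz_cat = (+)" "Scale sqz_cat = (\<cdot>\<^sub>m)"
  "One sqz_cat = 0\<^sub>m (Suc 0) (Suc 0)" "TensO sqz_cat = tensor_sqz" "TensM sqz_cat = kron"
  "Assoc sqz_cat D E F = 1\<^sub>m (dim_row D * dim_row E * dim_row F)"
  "Lunit sqz_cat D = 1\<^sub>m (dim_row D)" "Runit sqz_cat D = 1\<^sub>m (dim_row D)" "Braid sqz_cat = braid_sqz"
  by (simp_all add: sqz_cat_def)

lemma sqzI: "dim_row D = n \<Longrightarrow> dim_col D = n \<Longrightarrow> D * D = 0\<^sub>m n n \<Longrightarrow> D \<in> sqz"
  by (simp add: sqz_def)

lemma sqzD: "D \<in> sqz \<Longrightarrow> dim_col D = dim_row D" "D \<in> sqz \<Longrightarrow> D * D = 0\<^sub>m (dim_row D) (dim_row D)"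
  by (simp_all add: sqz_def)

lemma intertwinersI:
  "dim_row F = dim_row E \<Longrightarrow> dim_col F = dim_row D \<Longrightarrow> E * F = F * D \<Longrightarrow> F \<in> intertwiners D E"
  by (simp add: intertwiners_def)

lemma intertwinersD:
  assumes "F \<in> intertwiners D E"
  shows "dim_row F = dim_row E" "dim_col F = dim_row D" "E * F = F * D"
  using assms by (simp_all add: intertwiners_def)

lemma comp_intertwiners:
  assumes "A \<in> sqz" "B \<in> sqz" "D \<in> sqz" "F \<in> intertwiners A B" "G \<in> intertwiners B D"
  shows "G * F \<in> intertwiners A D"
proof (rule intertwinersI)
  note d = intertwinersD[OF assms(4)] intertwinersD[OF assms(5)] assms(1-3)[THEN sqzD(1)]
  have "D * (G * F) = (D * G) * F" using d by (intro mult_assoc_dim[symmetric]) auto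
  also have "\<dots> = G * (B * F)" unfolding d(6) using d by (intro mult_assoc_dim) auto
  also have "\<dots> = G * F * A" unfolding d(3) using d by (intro mult_assoc_dim[symmetric]) auto
  finally show "D * (G * F) = G * F * A" .
qed (use assms in \<open>auto dest: intertwinersD\<close>)

lemma zero_intertwiner: "A \<in> sqz \<Longrightarrow> B \<in> sqz \<Longrightarrow> 0\<^sub>m (dim_row B) (dim_row A) \<in> intertwiners A B"
  by (intro intertwinersI) (auto simp: sqz_def)

lemma one_intertwiner: "A \<in> sqz \<Longrightarrow> 1\<^sub>m (dim_row A) \<in> intertwiners A A"
  by (intro intertwinersI) (auto simp: sqz_def)

lemma add_intertwiners:
  assumes "A \<in> sqz" "B \<in> sqz" "F \<in> intertwiners A B" "G \<in> intertwiners A B"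
  shows "F + G \<in> intertwiners A B"
proof -
  note d = intertwinersD[OF assms(3)] intertwinersD[OF assms(4)] assms(1,2)[THEN sqzD(1)]
  show ?thesis by (rule intertwinersI) (use d in \<open>simp_all add: mult_add_dim add_mult_dim\<close>)
qed

lemma smult_intertwiners:
  assumes "A \<in> sqz" "B \<in> sqz" "F \<in> intertwiners A B"
  shows "c \<cdot>\<^sub>m F \<in> intertwiners A B"
proof -
  note d = intertwinersD[OF assms(3)] assms(1,2)[THEN sqzD(1)]
  show ?thesis by (rule intertwinersI) (use d in \<open>simp_all add: mult_smult_dim smult_mult_dim\<close>)
qed

lemma linear_category_sqz: "linear_category (sqz_cat :: 'k::field small_tensor_cat)"
proof (unfold_locales, goal_cases)
  case 1 then show ?case by (simp add: one_intertwiner)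
next
  case (2 A B D f g) then show ?case using comp_intertwiners[of A B D] by simp
next
  case 3 then show ?case by (simp add: intertwiners_def mult_assoc_dim)
next
  case 6 then show ?case by (simp add: zero_intertwiner)
next
  case 7 then show ?case by (simp add: add_intertwiners)
next
  case 8 then show ?case by (simp add: smult_intertwiners)
next
  case 9 then show ?case by (simp add: intertwiners_def add_assoc_dim)
next
  case 10 then show ?case by (simp add: intertwiners_def add_commute_dim)
next
  case 17 then show ?case by (simp add: intertwiners_def mult_add_dim)
next
  case 18 then show ?case by (simp add: intertwiners_def add_mult_dim)
next
  case 19 then show ?case by (simp add: intertwiners_def mult_smult_dim)
next
  case 20 then show ?case by (simp add: intertwiners_def smult_mult_dim)
qed (auto simp: intertwiners_def algebra_simps intro!: eq_matI simp del: index_mult_mat(1))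

section \<open>Transposition as a contravariant duality\<close>

lemma sqz_transpose: "D \<in> sqz \<Longrightarrow> transpose_mat D \<in> sqz"
  by (auto simp: sqz_def transpose_zero simp flip: transpose_mult_dim)

lemma transpose_intertwiners:
  assumes "A \<in> sqz" "B \<in> sqz" "F \<in> intertwiners A B"
  shows "transpose_mat F \<in> intertwiners (transpose_mat B) (transpose_mat A)"
  using assms arg_cong[OF intertwinersD(3)[OF assms(3)], of transpose_mat]
  by (intro intertwinersI) (auto simp: intertwiners_def sqz_def simp flip: transpose_mult_dim)

lemma transpose_intertwinersD:
  assumes "A \<in> sqz" "B \<in> sqz" "F \<in> intertwiners A (transpose_mat B)"
  shows "transpose_mat F \<in> intertwiners B (transpose_mat A)"
  using transpose_intertwiners[OF assms(1) sqz_transpose[OF assms(2)] assms(3)] by simp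

text \<open>Transposition is a contravariant involution of the category, so it exchanges the two
  universal properties. Cokernels and epimorphisms are reduced in this way to kernels and
  monomorphisms.\<close>

lemma is_cokernel_transpose:
  fixes A :: "'k::field mat"
  assumes k: "is_kernel sqz_cat A B F K k" and o: "A \<in> sqz" "B \<in> sqz"
  shows "is_cokernel sqz_cat (transpose_mat B) (transpose_mat A) (transpose_mat F) (transpose_mat K) (transpose_mat k)"
proof -
  from k have K: "K \<in> sqz" and F: "F \<in> intertwiners A B" and k': "k \<in> intertwiners K A" and 0: "F * k = 0\<^sub>m (dim_row B) (dim_row K)"
    by (simp_all add: is_kernel_def)
  note d = intertwinersD[OF F] intertwinersD[OF k'] sqzD(1)[OF K] sqzD(1)[OF o(1)] sqzD(1)[OF o(2)]
  have tr: "x = y \<longleftrightarrow> transpose_mat x = transpose_mat y" for x y :: "'k mat"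
    by (metis transpose_transpose)
  show ?thesis
    unfolding is_cokernel_def sqz_cat_simps
  proof (intro conjI ballI impI)
    show "transpose_mat k * transpose_mat F = 0\<^sub>m (dim_row (transpose_mat K)) (dim_row (transpose_mat B))"
      using d by (simp add: 0 transpose_zero flip: transpose_mult_dim)
  next
    fix W h assume W: "W \<in> sqz" and h: "h \<in> intertwiners (transpose_mat A) W"
      and h0: "h * transpose_mat F = 0\<^sub>m (dim_row W) (dim_row (transpose_mat B))"
    note dh = intertwinersD[OF h] sqzD(1)[OF W]
    have h': "transpose_mat h \<in> intertwiners (transpose_mat W) A"
      using transpose_intertwiners[OF sqz_transpose[OF o(1)] W h] by simp
    have "F * transpose_mat h = 0\<^sub>m (dim_row B) (dim_row (transpose_mat W))"
      using arg_cong[OF h0, of transpose_mat] d dh by (simp add: transpose_mult_dim transpose_zero)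
    with k h' sqz_transpose[OF W] obtain u where u: "u \<in> intertwiners (transpose_mat W) K" "k * u = transpose_mat h"
      and un: "\<And>v. v \<in> intertwiners (transpose_mat W) K \<Longrightarrow> k * v = transpose_mat h \<Longrightarrow> v = u"
      unfolding is_kernel_def sqz_cat_simps by blast
    show "\<exists>!u. u \<in> intertwiners (transpose_mat K) W \<and> u * transpose_mat k = h"
    proof (rule ex1I[of _ "transpose_mat u"], intro conjI)
      show "transpose_mat u \<in> intertwiners (transpose_mat K) W"
        using transpose_intertwiners[OF sqz_transpose[OF W] K u(1)] by simp
      show "transpose_mat u * transpose_mat k = h"
        using u(2) d intertwinersD[OF u(1)] by (simp flip: transpose_mult_dim)
    next
      fix v assume v: "v \<in> intertwiners (transpose_mat K) W \<and> v * transpose_mat k = h"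
      have "transpose_mat v \<in> intertwiners (transpose_mat W) K"
        using transpose_intertwiners[OF sqz_transpose[OF K] W, of v] v by simp
      moreover have "k * transpose_mat v = transpose_mat h"
        using v d by (auto simp: intertwiners_def transpose_mult_dim)
      ultimately show "v = transpose_mat u" using un tr by auto
    qed
  qed (use K F k' o in \<open>auto intro: sqz_transpose transpose_intertwiners\<close>)
qed

lemma is_mono_transpose:
  fixes A :: "'k::field mat"
  assumes e: "is_epi sqz_cat A B F" and o: "A \<in> sqz" "B \<in> sqz"
  shows "is_mono sqz_cat (transpose_mat B) (transpose_mat A) (transpose_mat F)"
proof -
  from e have F: "F \<in> intertwiners A B" by (simp add: is_epi_def)
  note d = intertwinersD[OF F] sqzD(1)[OF o(1)] sqzD(1)[OF o(2)]
  show ?thesis unfolding is_mono_def sqz_cat_simps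
  proof (intro conjI ballI impI)
    fix W g h assume W: "W \<in> sqz" and gh: "g \<in> intertwiners W (transpose_mat B)" "h \<in> intertwiners W (transpose_mat B)"
      and eq: "transpose_mat F * g = transpose_mat F * h"
    note d' = intertwinersD[OF gh(1)] intertwinersD[OF gh(2)]
    have "transpose_mat g * F = transpose_mat h * F"
      using arg_cong[OF eq, of transpose_mat] d d' by (simp add: transpose_mult_dim)
    with e sqz_transpose[OF W] gh[THEN transpose_intertwinersD[OF W o(2)]]
    have "transpose_mat g = transpose_mat h"
      unfolding is_epi_def sqz_cat_simps by blast
    then show "g = h" by (metis transpose_transpose)
  qed (use F o in \<open>auto intro: transpose_intertwiners\<close>)
qed

section \<open>Kernels, cokernels and normality of monomorphisms\<close>

text \<open>\<open>A * u\<close> and \<open>u * W\<close> have the same product with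
  \<open>K\<close>, and the linear left inverse \<open>L\<close> cancels \<open>K\<close>. So a
  linear factor of a morphism through \<open>K\<close> is automatically a morphism.\<close>

lemma intertwiner_cancel_left:
  assumes o: "A \<in> sqz" "B \<in> sqz" "W \<in> sqz" and K: "K \<in> intertwiners A B"
    and L: "dim_row L = dim_row A" "dim_col L = dim_row B" "L * K = 1\<^sub>m (dim_row A)"
    and u: "dim_row u = dim_row A" "dim_col u = dim_row W" and Ku: "K * u \<in> intertwiners W B"
  shows "u \<in> intertwiners W A"
proof (rule intertwinersI)
  note d = intertwinersD(1,2)[OF K] L(1,2) u sqzD(1)[OF o(1)] sqzD(1)[OF o(2)] sqzD(1)[OF o(3)]
  have "K * (A * u) = (B * K) * u" using d intertwinersD(3)[OF K] by (simp add: mult_assoc_dim)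
  also have "\<dots> = B * (K * u)" using d by (intro mult_assoc_dim) auto
  also have "\<dots> = K * (u * W)" using d intertwinersD(3)[OF Ku] by (simp add: mult_assoc_dim)
  finally have "L * K * (A * u) = L * K * (u * W)" using d by (simp add: mult_assoc_dim)
  then show "A * u = u * W" using d L(3) by simp
qed (use u in auto)

text \<open>The way in which the certificate of \<open>kernel_split\<close> is used: applied to
  \<open>H\<close>, its second term vanishes, so \<open>H\<close> factors through \<open>K\<close>
  by \<open>L * H\<close>.\<close>

lemma mult_split:
  fixes K :: "'a::semiring_1 mat"
  assumes d: "dim_row K = n" "dim_col K = dim_row L" "dim_col L = n" "dim_row G = n" "dim_col G = dim_row F" "dim_col F = n"
    and H: "dim_row H = n" "K * L + G * F = 1\<^sub>m n" "F * H = 0\<^sub>m (dim_row F) (dim_col H)"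
  shows "K * (L * H) = H"
proof -
  have "H = (K * L + G * F) * H" using H by simp
  also have "\<dots> = K * (L * H) + G * (F * H)" using d H(1) by (simp add: add_mult_dim mult_assoc_dim)
  also have "\<dots> = K * (L * H)" using d H by simp
  finally show ?thesis ..
qed

text \<open>Since \<open>F\<close> commutes with the differentials, \<open>A\<close> preserves the
  kernel of \<open>F\<close>; \<open>L * A * K\<close> is the restricted differential in the basis
  formed by the columns of \<open>K\<close>.\<close>

lemma is_kernel_split:
  fixes A :: "'k::field mat"
  assumes o: "A \<in> sqz" "B \<in> sqz" and F: "F \<in> intertwiners A B"
    and K: "K \<in> carrier_mat (dim_row A) k" and L: "L \<in> carrier_mat k (dim_row A)" and G: "G \<in> carrier_mat (dim_row A) (dim_row B)"
    and e: "L * K = 1\<^sub>m k" "F * K = 0\<^sub>m (dim_row B) k" "K * L + G * F = 1\<^sub>m (dim_row A)"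
  shows "L * A * K \<in> sqz" "is_kernel sqz_cat A B F (L * A * K) K"
proof -
  note d = carrier_matD[OF K] carrier_matD[OF L] carrier_matD[OF G] intertwinersD(1,2)[OF F] sqzD(1)[OF o(1)] sqzD(1)[OF o(2)]
  note split = mult_split[of K "dim_row A" L G F, OF _ _ _ _ _ _ _ e(3)]
  have "F * (A * K) = B * F * K" using d intertwinersD(3)[OF F] by (simp add: mult_assoc_dim)
  also have "\<dots> = 0\<^sub>m (dim_row B) k" using d e(2) by (simp add: mult_assoc_dim)
  finally have "F * (A * K) = 0\<^sub>m (dim_row B) k" .
  then have AK: "K * (L * (A * K)) = A * K" using d by (intro split) auto
  let ?A = "L * A * K"
  have "?A * ?A = L * A * (K * (L * (A * K)))" using d by (simp add: mult_assoc_dim)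
  also have "\<dots> = L * (A * A) * K" unfolding AK using d by (simp add: mult_assoc_dim)
  also have "\<dots> = 0\<^sub>m k k" using d sqzD(2)[OF o(1)] by simp
  finally show 1: "?A \<in> sqz" using d by (intro sqzI) auto
  have 2: "K \<in> intertwiners ?A A" using d AK by (intro intertwinersI) (auto simp: mult_assoc_dim)
  show "is_kernel sqz_cat A B F ?A K"
    unfolding is_kernel_def sqz_cat_simps
  proof (intro conjI ballI impI)
    fix W h assume W: "W \<in> sqz" and h: "h \<in> intertwiners W A" and Fh: "F * h = 0\<^sub>m (dim_row B) (dim_row W)"
    note dh = intertwinersD(1,2)[OF h]
    have Kh: "K * (L * h) = h" using d dh Fh by (intro split) auto
    show "\<exists>!u. u \<in> intertwiners W ?A \<and> K * u = h"
    proof (rule ex1I[of _ "L * h"])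
      have "L * h \<in> intertwiners W ?A"
        by (rule intertwiner_cancel_left[OF 1 o(1) W 2, of L]) (use d dh e(1) Kh h in auto)
      then show "L * h \<in> intertwiners W ?A \<and> K * (L * h) = h" using Kh by blast
    next
      fix u assume "u \<in> intertwiners W ?A \<and> K * u = h"
      then have u: "K * u = h" "dim_row u = k" using d by (auto dest: intertwinersD(1))
      have "L * h = L * K * u" unfolding u(1)[symmetric] using d u(2) by (simp add: mult_assoc_dim)
      then show "u = L * h" using e(1) u(2) by simp
    qed
  qed (use 1 2 F d e in auto)
qed

lemma ex_kernel_sqz:
  fixes A :: "'k::field mat"
  assumes o: "A \<in> sqz" "B \<in> sqz" and F: "F \<in> intertwiners A B"
  shows "\<exists>K k. is_kernel sqz_cat A B F K k"
  using kernel_split[of F "dim_row B" "dim_row A"] is_kernel_split[OF o F] intertwinersD(1,2)[OF F]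
  by (metis carrier_matI)

lemma ex_cokernel_sqz:
  fixes A :: "'k::field mat"
  assumes o: "A \<in> sqz" "B \<in> sqz" and F: "F \<in> intertwiners A B"
  shows "\<exists>Q q. is_cokernel sqz_cat A B F Q q"
  using is_cokernel_transpose[of "transpose_mat B" "transpose_mat A" "transpose_mat F"]
    ex_kernel_sqz[OF sqz_transpose[OF o(2)] sqz_transpose[OF o(1)] transpose_intertwiners[OF o F]] sqz_transpose[OF o(1)] sqz_transpose[OF o(2)]
  by (auto; blast)

text \<open>\<open>C * B\<close> annihilates the columns of \<open>F\<close> and so factors through
  \<open>C\<close>; \<open>C * B * S\<close> is the differential induced on the quotient.\<close>

lemma cokernel_object:
  fixes A :: "'k::field mat"
  assumes o: "A \<in> sqz" "B \<in> sqz" and F: "F \<in> intertwiners A B"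
    and c: "C \<in> carrier_mat r (dim_row B)" "S \<in> carrier_mat (dim_row B) r" "G \<in> carrier_mat (dim_row A) (dim_row B)"
    and e: "C * F = 0\<^sub>m r (dim_row A)" "S * C + F * G = 1\<^sub>m (dim_row B)"
  shows "C * B * S \<in> sqz" "C \<in> intertwiners B (C * B * S)"
proof -
  note dF = intertwinersD(1,2)[OF F] sqzD(1)[OF o(1)] sqzD(1)[OF o(2)]
  note dc = carrier_matD[OF c(1)] carrier_matD[OF c(2)] carrier_matD[OF c(3)]
  let ?D = "C * B * S"
  have "C * B * F = C * F * A" using dc dF intertwinersD(3)[OF F] by (simp add: mult_assoc_dim)
  then have CBF: "C * B * F = 0\<^sub>m r (dim_row A)" using dc dF e by simp
  have "C * B = C * B * (S * C + F * G)" using dc dF e by simp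
  also have "\<dots> = ?D * C + (C * B * F) * G" using dc dF by (simp add: mult_add_dim mult_assoc_dim)
  also have "\<dots> = ?D * C" using dc dF CBF by simp
  finally have CB: "?D * C = C * B" ..
  have "?D * ?D = ?D * C * B * S" using dc dF by (simp add: mult_assoc_dim)
  also have "\<dots> = C * (B * B) * S" unfolding CB using dc dF by (simp add: mult_assoc_dim)
  finally show "?D \<in> sqz" using dc dF sqzD(2)[OF o(2)] by (intro sqzI) auto
  show "C \<in> intertwiners B ?D" using dc dF CB by (intro intertwinersI) auto
qed

text \<open>Cancelling the mono \<open>F\<close> in \<open>F * K = 0\<close> gives
  \<open>K = 0\<close>, and the certificate collapses to a left inverse \<open>G\<close> of
  \<open>F\<close>; then \<open>F\<close> is a kernel of the quotient map \<open>C\<close>. The left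
  inverse is kept as a conclusion because it also serves to show that the unit is simple.\<close>

lemma mono_is_kernel_sqz:
  fixes A :: "'k::field mat"
  assumes o: "A \<in> sqz" "B \<in> sqz" and m: "is_mono sqz_cat A B F"
  shows "\<exists>D\<in>sqz. \<exists>g. is_kernel sqz_cat B D g A F"
    and "\<exists>G\<in>carrier_mat (dim_row A) (dim_row B). G * F = 1\<^sub>m (dim_row A)"
proof -
  from m have F: "F \<in> intertwiners A B" by (simp add: is_mono_def)
  note dF = intertwinersD(1,2)[OF F] sqzD(1)[OF o(1)] sqzD(1)[OF o(2)]
  then have cF: "F \<in> carrier_mat (dim_row B) (dim_row A)" by auto
  from kernel_split[OF cF] obtain k K L G where K: "K \<in> carrier_mat (dim_row A) k" "L \<in> carrier_mat k (dim_row A)"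
    "G \<in> carrier_mat (dim_row A) (dim_row B)"
    and e: "L * K = 1\<^sub>m k" "F * K = 0\<^sub>m (dim_row B) k" "K * L + G * F = 1\<^sub>m (dim_row A)"
    by blast
  note dK = carrier_matD[OF K(1)] carrier_matD[OF K(2)] carrier_matD[OF K(3)]
  note ker = is_kernel_split[OF o F K e]
  let ?K = "L * A * K"
  have "K \<in> intertwiners ?K A" using ker(2) by (simp add: is_kernel_def)
  moreover have "0\<^sub>m (dim_row A) k \<in> intertwiners ?K A" using zero_intertwiner[OF ker(1) o(1)] dK by simp
  moreover have "F * K = F * 0\<^sub>m (dim_row A) k" using e(2) dF by simp
  ultimately have K0: "K = 0\<^sub>m (dim_row A) k"
    using m ker(1) unfolding is_mono_def sqz_cat_simps by blast
  have GF: "G * F = 1\<^sub>m (dim_row A)" using e(3) dK dF unfolding K0 by simp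
  then show "\<exists>G\<in>carrier_mat (dim_row A) (dim_row B). G * F = 1\<^sub>m (dim_row A)" using K(3) by blast
  from cokernel_split[OF cF] obtain r C S G' where c: "C \<in> carrier_mat r (dim_row B)" "S \<in> carrier_mat (dim_row B) r"
    "G' \<in> carrier_mat (dim_row A) (dim_row B)"
    and e': "C * F = 0\<^sub>m r (dim_row A)" "S * C + F * G' = 1\<^sub>m (dim_row B)" by blast
  note dc = carrier_matD[OF c(1)] carrier_matD[OF c(2)] carrier_matD[OF c(3)]
  let ?D = "C * B * S"
  note D = cokernel_object[OF o F c e'(1,2)]
  have C: "C \<in> intertwiners B ?D" by (rule D(2))
  have "is_kernel sqz_cat B ?D C A F"
    unfolding is_kernel_def sqz_cat_simps
  proof (intro conjI ballI impI)
    fix W h assume W: "W \<in> sqz" and h: "h \<in> intertwiners W B" and Ch: "C * h = 0\<^sub>m (dim_row ?D) (dim_row W)"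
    note dh = intertwinersD(1,2)[OF h]
    have "h = (S * C + F * G') * h" using dh e' by simp
    also have "\<dots> = S * (C * h) + F * (G' * h)" using dh dc dF by (simp add: add_mult_dim mult_assoc_dim)
    also have "\<dots> = F * (G' * h)" using dh dc dF Ch by simp
    finally have Fh: "F * (G' * h) = h" ..
    show "\<exists>!u. u \<in> intertwiners W A \<and> F * u = h"
    proof (rule ex1I[of _ "G' * h"])
      have "G' * h \<in> intertwiners W A"
        by (rule intertwiner_cancel_left[OF o W F, of G]) (use dF dc dh dK Fh h GF in auto)
      then show "G' * h \<in> intertwiners W A \<and> F * (G' * h) = h" using Fh by blast
    next
      fix u assume u: "u \<in> intertwiners W A \<and> F * u = h"
      with Fh have "G * (F * (G' * h)) = G * (F * u)" by simp
      then show "u = G' * h" using GF u dF dc dh dK by (auto simp: intertwiners_def simp flip: mult_assoc_dim)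
    qed
  qed (use o D(1) C F dc e' in auto)
  with D(1) show "\<exists>D\<in>sqz. \<exists>g. is_kernel sqz_cat B D g A F" by blast
qed

lemma epi_is_cokernel_sqz:
  fixes A :: "'k::field mat"
  assumes o: "A \<in> sqz" "B \<in> sqz" and e: "is_epi sqz_cat A B F"
  shows "\<exists>D\<in>sqz. \<exists>g. is_cokernel sqz_cat D A g B F"
proof -
  from mono_is_kernel_sqz(1)[OF sqz_transpose[OF o(2)] sqz_transpose[OF o(1)] is_mono_transpose[OF e o]]
  obtain D g where D: "D \<in> sqz" "is_kernel sqz_cat (transpose_mat A) D g (transpose_mat B) (transpose_mat F)" by blast
  from is_cokernel_transpose[OF this(2) sqz_transpose[OF o(1)] D(1)] sqz_transpose[OF D(1)] show ?thesis
    by auto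
qed

section \<open>Zero objects and biproducts\<close>

lemma is_zero_sqz:
  assumes "A \<in> sqz" "dim_row A = 0"
  shows "is_zero (sqz_cat :: 'k::field small_tensor_cat) A"
proof -
  have "\<exists>!f. f \<in> intertwiners A B" if "B \<in> sqz" for B
    using assms(2) by (intro ex1I[where P = "\<lambda>f. f \<in> _", OF zero_intertwiner[OF assms(1) that]]) (auto simp: intertwiners_def)
  moreover have "\<exists>!f. f \<in> intertwiners B A" if "B \<in> sqz" for B
    using assms(2) by (intro ex1I[where P = "\<lambda>f. f \<in> _", OF zero_intertwiner[OF that assms(1)]]) (auto simp: intertwiners_def)
  ultimately show ?thesis using assms(1) by (simp add: is_zero_def)
qed

lemma one_mat_eq_zero_mat_iff: "1\<^sub>m n = (0\<^sub>m n n :: 'a::zero_neq_one mat) \<longleftrightarrow> n = 0"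
  by (auto simp: mat_eq_iff)

lemma row_right_inverse:
  fixes v :: "'a::field mat"
  assumes "v \<in> carrier_mat 1 n" "v \<noteq> 0\<^sub>m 1 n"
  shows "\<exists>H\<in>carrier_mat n 1. v * H = 1\<^sub>m 1"
proof -
  obtain j where j: "j < n" "v $$ (0, j) \<noteq> 0"
    using assms by (auto simp: mat_eq_iff)
  define H where "H = mat n 1 (\<lambda>(p, q). if p = j then 1 / v $$ (0, j) else 0)"
  have "v * H = 1\<^sub>m 1"
  proof (rule eq_matI, goal_cases)
    case (1 p q)
    then have "(v * H) $$ (p, q) = (\<Sum>k<n. v $$ (0, k) * H $$ (k, 0))"
      using assms by (subst index_mult_sum) (auto simp: H_def)
    also have "\<dots> = (\<Sum>k<n. if k = j then v $$ (0, j) / v $$ (0, j) else 0)"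
      by (intro sum.cong) (auto simp: H_def)
    finally show ?case using j 1 by simp
  qed (use assms in \<open>auto simp: H_def\<close>)
  then show ?thesis by (intro bexI[of _ H]) (auto simp: H_def)
qed

lemma mult_four_block_dim:
  fixes A1 :: "'a::semiring_1 mat"
  assumes "dim_row B1 = dim_row A1" "dim_col C1 = dim_col A1" "dim_row D1 = dim_row C1" "dim_col D1 = dim_col B1"
    "dim_row B2 = dim_row A2" "dim_col C2 = dim_col A2" "dim_row D2 = dim_row C2" "dim_col D2 = dim_col B2"
    "dim_col A1 = dim_row A2" "dim_col B1 = dim_row C2"
  shows "four_block_mat A1 B1 C1 D1 * four_block_mat A2 B2 C2 D2
    = four_block_mat (A1 * A2 + B1 * C2) (A1 * B2 + B1 * D2) (C1 * A2 + D1 * C2) (C1 * B2 + D1 * D2)"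
  by (rule mult_four_block_mat[of _ "dim_row A1" "dim_col A1" _ "dim_col B1" _ "dim_row C1" _ _ "dim_col A2" _ "dim_col B2"])
    (simp_all only: carrier_mat_def mem_Collect_eq assms simp_thms)

lemma ex_biproduct_sqz:
  fixes A :: "'k::field mat"
  assumes o: "A \<in> sqz" "B \<in> sqz"
  shows "\<exists>S i\<^sub>1 i\<^sub>2 p\<^sub>1 p\<^sub>2. is_biproduct sqz_cat A B S i\<^sub>1 i\<^sub>2 p\<^sub>1 p\<^sub>2"
proof -
  define a b where "a = dim_row A" and "b = dim_row B"
  have c: "A \<in> carrier_mat a a" "B \<in> carrier_mat b b" using o by (auto simp: sqz_def a_def b_def)
  have sq: "A * A = 0\<^sub>m a a" "B * B = 0\<^sub>m b b" using o by (auto simp: sqz_def a_def b_def)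
  define S where "S = four_block_mat A (0\<^sub>m a b) (0\<^sub>m b a) B"
  define i\<^sub>1 :: "'k mat" where "i\<^sub>1 = four_block_mat (1\<^sub>m a) (0\<^sub>m a 0) (0\<^sub>m b a) (0\<^sub>m b 0)"
  define i\<^sub>2 :: "'k mat" where "i\<^sub>2 = four_block_mat (0\<^sub>m a 0) (0\<^sub>m a b) (0\<^sub>m b 0) (1\<^sub>m b)"
  define p\<^sub>1 :: "'k mat" where "p\<^sub>1 = four_block_mat (1\<^sub>m a) (0\<^sub>m a b) (0\<^sub>m 0 a) (0\<^sub>m 0 b)"
  define p\<^sub>2 :: "'k mat" where "p\<^sub>2 = four_block_mat (0\<^sub>m 0 a) (0\<^sub>m 0 b) (0\<^sub>m b a) (1\<^sub>m b)"
  note defs = S_def i\<^sub>1_def i\<^sub>2_def p\<^sub>1_def p\<^sub>2_def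
  note ab = a_def[symmetric] b_def[symmetric]
  have dims: "dim_row S = a + b" "dim_col S = a + b" "dim_row i\<^sub>1 = a + b" "dim_col i\<^sub>1 = a"
    "dim_row i\<^sub>2 = a + b" "dim_col i\<^sub>2 = b" "dim_row p\<^sub>1 = a" "dim_col p\<^sub>1 = a + b" "dim_row p\<^sub>2 = b" "dim_col p\<^sub>2 = a + b"
    using c by (auto simp: defs)
  \<comment> \<open>Empty blocks put \<open>A\<close> and \<open>B\<close> into four-block shape, so
    that products with the injections and projections are computed blockwise.\<close>
  have A: "A = four_block_mat A (0\<^sub>m a 0) (0\<^sub>m 0 a) (0\<^sub>m 0 0)" and B: "B = four_block_mat (0\<^sub>m 0 0) (0\<^sub>m 0 b) (0\<^sub>m b 0) B"
    using c by (auto intro!: eq_matI)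
  note m = mult_four_block_dim carrier_matD[OF c(1)] carrier_matD[OF c(2)] sq add_four_block_mat[of _ a a _ b _ b]
  have S: "S \<in> sqz" using dims by (intro sqzI[of _ "a + b"]) (simp_all add: S_def m)
  have "S * i\<^sub>1 = i\<^sub>1 * A" "S * i\<^sub>2 = i\<^sub>2 * B" "A * p\<^sub>1 = p\<^sub>1 * S" "B * p\<^sub>2 = p\<^sub>2 * S"
    by ((subst A | subst B), simp add: defs m)+
  then have h: "i\<^sub>1 \<in> intertwiners A S" "i\<^sub>2 \<in> intertwiners B S" "p\<^sub>1 \<in> intertwiners S A" "p\<^sub>2 \<in> intertwiners S B"
    using dims by (auto simp: intertwiners_def ab)
  have e: "p\<^sub>1 * i\<^sub>1 = 1\<^sub>m a" "p\<^sub>2 * i\<^sub>2 = 1\<^sub>m b" "p\<^sub>2 * i\<^sub>1 = 0\<^sub>m b a" "p\<^sub>1 * i\<^sub>2 = 0\<^sub>m a b"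
    "i\<^sub>1 * p\<^sub>1 + i\<^sub>2 * p\<^sub>2 = 1\<^sub>m (a + b)"
    by (simp_all add: defs m) (auto intro!: eq_matI)
  show ?thesis
    unfolding is_biproduct_def using S h e dims
    by (intro exI[of _ S] exI[of _ i\<^sub>1] exI[of _ i\<^sub>2] exI[of _ p\<^sub>1] exI[of _ p\<^sub>2]) (simp add: ab)
qed

section \<open>Simplicity of the unit and finite length\<close>

text \<open>The mono \<open>i\<close> has a linear left inverse \<open>G\<close>. If
  \<open>i\<close> vanishes, this forces dimension 0. Otherwise the row \<open>i\<close> has a right
  inverse, which must equal \<open>G\<close>; and \<open>i * W = 0\<close> then forces
  \<open>W = 0\<close>, so that \<open>G\<close> is a morphism.\<close>

lemma invertible_unit_or_zero:
  fixes W :: "'k::field mat"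
  assumes W: "W \<in> sqz" and m: "is_mono sqz_cat W (0\<^sub>m 1 1) i"
  shows "is_zero sqz_cat W \<or> is_iso sqz_cat W (0\<^sub>m 1 1) i"
proof -
  have I: "0\<^sub>m 1 1 \<in> sqz" by (simp add: sqz_def)
  from m have i: "i \<in> intertwiners W (0\<^sub>m 1 1)" by (simp add: is_mono_def)
  note d = intertwinersD(1,2)[OF i] sqzD(1)[OF W]
  obtain G where G: "G \<in> carrier_mat (dim_row W) 1" "G * i = 1\<^sub>m (dim_row W)"
    using mono_is_kernel_sqz(2)[OF W I m] by auto
  show ?thesis
  proof (cases "i = 0\<^sub>m 1 (dim_row W)")
    case True
    then have "1\<^sub>m (dim_row W) = (0\<^sub>m (dim_row W) (dim_row W) :: 'k mat)" using G by simp
    then have "dim_row W = 0" by (simp only: one_mat_eq_zero_mat_iff)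
    then show ?thesis using is_zero_sqz W by blast
  next
    case False
    moreover have "i \<in> carrier_mat 1 (dim_row W)" using d by auto
    ultimately obtain H where H: "H \<in> carrier_mat (dim_row W) 1" and iH: "i * H = 1\<^sub>m 1"
      using row_right_inverse by blast
    note dH = carrier_matD[OF H]
    have "G = G * (i * H)" using iH G by simp
    also have "\<dots> = H" using G d dH by (simp flip: mult_assoc_dim)
    finally have "G = H" .
    then have iG: "i * G = 1\<^sub>m 1" using iH by simp
    have "i * W = 0\<^sub>m 1 (dim_row W)" using intertwinersD(3)[OF i] d by simp
    then have "G * i * W = 0\<^sub>m (dim_row W) (dim_row W)" using G(1) d by (simp add: mult_assoc_dim)
    then have "W = 0\<^sub>m (dim_row W) (dim_row W)" using G(2) by simp
    then have "W * G = 0\<^sub>m (dim_row W) 1" using G(1) by (metis carrier_matD left_mult_zero_mat')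
    then have "G \<in> intertwiners (0\<^sub>m 1 1) W" using G(1) by (intro intertwinersI) auto
    then have "is_inverse sqz_cat W (0\<^sub>m 1 1) i G"
      using i G(2) iG by (simp add: is_inverse_def)
    then show ?thesis by (auto simp: is_iso_def)
  qed
qed

lemma simple_unit: "is_simple (sqz_cat :: 'k::field small_tensor_cat) (0\<^sub>m 1 1)"
proof -
  have I: "(0\<^sub>m 1 1 :: 'k mat) \<in> sqz" by (simp add: sqz_def)
  have "\<not> is_zero (sqz_cat :: 'k small_tensor_cat) (0\<^sub>m 1 1)"
  proof
    assume "is_zero (sqz_cat :: 'k small_tensor_cat) (0\<^sub>m 1 1)"
    then have "\<exists>!f. f \<in> intertwiners (0\<^sub>m 1 1) (0\<^sub>m 1 1 :: 'k mat)" using I by (simp add: is_zero_def)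
    with zero_intertwiner[OF I I] one_intertwiner[OF I] have "1\<^sub>m 1 = (0\<^sub>m 1 1 :: 'k mat)" by auto
    then show False by (simp only: one_mat_eq_zero_mat_iff)
  qed
  then show ?thesis using invertible_unit_or_zero I unfolding is_simple_def by (simp, blast)
qed

lemma row_cokernel:
  fixes A :: "'k::field mat"
  assumes o: "A \<in> sqz" "B \<in> sqz" and Ki: "K \<in> intertwiners B A" and vi: "v \<in> intertwiners A (0\<^sub>m 1 1)"
    and v: "v \<in> carrier_mat 1 (dim_row A)" "v \<noteq> 0\<^sub>m 1 (dim_row A)"
    and K: "K \<in> carrier_mat (dim_row A) k" "L \<in> carrier_mat k (dim_row A)" "G \<in> carrier_mat (dim_row A) 1"
    and e: "v * K = 0\<^sub>m 1 k" "K * L + G * v = 1\<^sub>m (dim_row A)"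
  shows "is_cokernel sqz_cat B A K (0\<^sub>m 1 1) v"
proof -
  have I: "(0\<^sub>m 1 1 :: 'k mat) \<in> sqz" by (simp add: sqz_def)
  note d = carrier_matD[OF v(1)] carrier_matD[OF K(1)] carrier_matD[OF K(2)] carrier_matD[OF K(3)] sqzD(1)[OF o(1)]
  obtain H where H: "H \<in> carrier_mat (dim_row A) 1" "v * H = 1\<^sub>m 1"
    using row_right_inverse[OF v] by blast
  note dH = carrier_matD[OF H(1)]
  show ?thesis unfolding is_cokernel_def sqz_cat_simps
  proof (intro conjI ballI impI)
    show "v * K = 0\<^sub>m (dim_row (0\<^sub>m 1 1)) (dim_row B)"
      using e(1) intertwinersD(2)[OF Ki] d by simp
  next
    fix W h assume W: "W \<in> sqz" and h: "h \<in> intertwiners A W" and hK: "h * K = 0\<^sub>m (dim_row W) (dim_row B)"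
    note dh = intertwinersD(1,2)[OF h] sqzD(1)[OF W]
    have "h = h * (K * L + G * v)" using dh e by simp
    also have "\<dots> = (h * K) * L + (h * G) * v" using dh d by (simp add: mult_add_dim mult_assoc_dim)
    also have "\<dots> = (h * G) * v" using dh d hK intertwinersD(2)[OF Ki] by simp
    finally have hGv: "(h * G) * v = h" ..
    \<comment> \<open>Multiplying by \<open>H\<close> on the right cancels \<open>v\<close>; the
      product vanishes because \<open>v * A\<close> does.\<close>
    have "W * (h * G) = (W * ((h * G) * v)) * H" using d dh dH H(2) by (simp add: mult_assoc_dim)
    also have "\<dots> = (h * G) * (v * A) * H"
      unfolding hGv intertwinersD(3)[OF h] by (subst hGv[symmetric]) (use d dh dH in \<open>simp add: mult_assoc_dim\<close>)
    also have "\<dots> = 0\<^sub>m (dim_row W) 1"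
      using intertwinersD(3)[OF vi] d dh dH by (simp flip: intertwinersD(3)[OF vi])
    finally have hG: "h * G \<in> intertwiners (0\<^sub>m 1 1) W"
      using d dh by (intro intertwinersI) auto
    show "\<exists>!u. u \<in> intertwiners (0\<^sub>m 1 1) W \<and> u * v = h"
    proof (rule ex1I[of _ "h * G"])
      fix u assume u: "u \<in> intertwiners (0\<^sub>m 1 1) W \<and> u * v = h"
      then have du: "dim_col u = 1" by (auto simp: intertwiners_def)
      have "u * v * H = h * G * v * H" using u hGv by simp
      then show "u = h * G" using d dh dH du H(2) by (simp add: mult_assoc_dim)
    qed (use hG hGv in simp)
  qed (use Ki vi I in auto)
qed

text \<open>Every nonzero object maps onto the unit: a nonzero row \<open>v\<close> with
  \<open>v * A = 0\<close> can be any nonzero row if \<open>A\<close> vanishes, and is otherwise a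
  nonzero row of \<open>A\<close> itself, since \<open>A * A = 0\<close>. The kernel of
  \<open>v\<close> has smaller dimension.\<close>

lemma finite_length_sqz:
  assumes "A \<in> sqz"
  shows "finite_length (sqz_cat :: 'k::field small_tensor_cat) A"
  using assms
proof (induction "dim_row A" arbitrary: A rule: less_induct)
  case less
  note A = less.prems
  have I: "(0\<^sub>m 1 1 :: 'k mat) \<in> sqz" by (simp add: sqz_def)
  show ?case
  proof (cases "dim_row A = 0")
    case True
    then show ?thesis using is_zero_sqz A by (blast intro: finite_length.zero)
  next
    case False
    let ?n = "dim_row A"
    have "\<exists>v\<in>carrier_mat 1 ?n. v \<noteq> 0\<^sub>m 1 ?n \<and> v * A = 0\<^sub>m 1 ?n"
    proof (cases "A = 0\<^sub>m ?n ?n")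
      case True
      have "mat 1 ?n (\<lambda>_. 1) \<noteq> (0\<^sub>m 1 ?n :: 'k mat)"
        using False by (auto simp: mat_eq_iff)
      then show ?thesis using True
        by (intro bexI[of _ "mat 1 ?n (\<lambda>_. 1)"]) (auto, metis dim_col_mat(1) dim_row_mat(1) right_mult_zero_mat')
    next
      case F: False
      then obtain i j where ij: "i < ?n" "j < ?n" "A $$ (i, j) \<noteq> 0"
        using sqzD(1)[OF A] by (auto simp: mat_eq_iff)
      define v where "v = mat 1 ?n (\<lambda>(p, q). A $$ (i, q))"
      have "v * A = 0\<^sub>m 1 ?n"
      proof (rule eq_matI, goal_cases)
        case (1 p q)
        then have "(v * A) $$ (p, q) = (\<Sum>k<?n. A $$ (i, k) * A $$ (k, q))"
          using sqzD(1)[OF A] by (subst index_mult_sum) (auto simp: v_def)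
        also have "\<dots> = (A * A) $$ (i, q)"
          using 1 ij sqzD(1)[OF A] by (subst index_mult_sum) auto
        finally show ?case using 1 ij sqzD(2)[OF A] by simp
      qed (use sqzD(1)[OF A] in \<open>auto simp: v_def\<close>)
      moreover have "v \<noteq> 0\<^sub>m 1 ?n" using ij by (auto simp: v_def mat_eq_iff)
      moreover have "v \<in> carrier_mat 1 ?n" by (simp add: v_def)
      ultimately show ?thesis by blast
    qed
    then obtain v where v: "v \<in> carrier_mat 1 ?n" "v \<noteq> 0\<^sub>m 1 ?n" "v * A = 0\<^sub>m 1 ?n" by blast
    have vi: "v \<in> intertwiners A (0\<^sub>m 1 1)" using v by (intro intertwinersI) auto
    from kernel_split[OF v(1)] obtain k K L G where K: "K \<in> carrier_mat ?n k" "L \<in> carrier_mat k ?n" "G \<in> carrier_mat ?n 1"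
      and e: "L * K = 1\<^sub>m k" "v * K = 0\<^sub>m 1 k" "K * L + G * v = 1\<^sub>m ?n" and kn: "k < ?n"
      using v(2) by blast
    note ker = is_kernel_split[OF A I vi K(1,2), of G, simplified, OF K(3)[simplified] e(1) e(2)[simplified] e(3)]
    have fl: "finite_length (sqz_cat :: 'k small_tensor_cat) (L * A * K)"
      using less.hyps[of "L * A * K"] ker(1) kn K by auto
    have "is_cokernel sqz_cat (L * A * K) A K (0\<^sub>m 1 1) v"
      using row_cokernel[OF A ker(1) _ vi v(1,2) K e(2,3)] ker(2) by (simp add: is_kernel_def)
    with ker I A fl simple_unit show ?thesis
      by (intro finite_length.extension[OF fl, of A "0\<^sub>m 1 1" K v]) (auto simp: short_exact_def)
  qed
qed

section \<open>Finite-dimensional morphism spaces\<close>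

text \<open>Elimination position by position: \<open>I\<close> contains all positions where elements
  of the subspace \<open>S\<close> may be nonzero. If some \<open>s\<close> is nonzero at
  \<open>p\<close>, it joins the spanning list, and subtracting multiples of it reduces to the
  elements that vanish at \<open>p\<close>.\<close>

lemma hom_finite_dim_aux:
  fixes S :: "'k::field mat set" and A B :: "'k mat"
  assumes "finite I" "S \<subseteq> carrier_mat (dim_row B) (dim_row A)"
    and "\<And>f g. f \<in> S \<Longrightarrow> g \<in> S \<Longrightarrow> f + g \<in> S" "\<And>c f. f \<in> S \<Longrightarrow> c \<cdot>\<^sub>m f \<in> S"
    and "\<And>f i j. f \<in> S \<Longrightarrow> i < dim_row B \<Longrightarrow> j < dim_row A \<Longrightarrow> (i, j) \<notin> I \<Longrightarrow> f $$ (i, j) = 0"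
  shows "\<exists>fs. set fs \<subseteq> S \<and> (\<forall>f\<in>S. \<exists>as. length as = length fs \<and> f = lin_comb sqz_cat A B as fs)"
  using assms
proof (induction I arbitrary: S rule: finite_induct)
  case empty
  then show ?case by (intro exI[of _ "[]"]) (auto simp: lin_comb_def intro!: eq_matI)
next
  case (insert p I)
  show ?case
  proof (cases "\<exists>s\<in>S. s $$ p \<noteq> 0 \<and> fst p < dim_row B \<and> snd p < dim_row A")
    case False
    have "f $$ (i, j) = 0" if "f \<in> S" "i < dim_row B" "j < dim_row A" "(i, j) \<notin> I" for f i j
      using False insert.prems(4)[of f i j] that by (cases "(i, j) = p") auto
    then show ?thesis
      using insert.prems(1-3) by (intro insert.IH) auto
  next
    case True
    then obtain s where s: "s \<in> S" "s $$ p \<noteq> 0" and p: "fst p < dim_row B" "snd p < dim_row A" by blast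
    define S' where "S' = {f \<in> S. f $$ p = 0}"
    have car: "dim_row f = dim_row B" "dim_col f = dim_row A" if "f \<in> S" for f
      using insert.prems(1) that by auto
    have "\<exists>fs. set fs \<subseteq> S' \<and> (\<forall>f\<in>S'. \<exists>as. length as = length fs \<and> f = lin_comb sqz_cat A B as fs)"
    proof (rule insert.IH)
      show "S' \<subseteq> carrier_mat (dim_row B) (dim_row A)" using insert.prems(1) by (auto simp: S'_def)
      show "f + g \<in> S'" if "f \<in> S'" "g \<in> S'" for f g
        using that p insert.prems(2) car by (cases p) (auto simp: S'_def)
      show "c \<cdot>\<^sub>m f \<in> S'" if "f \<in> S'" for c f
        using that p insert.prems(3) car by (cases p) (auto simp: S'_def)
      show "f $$ (i, j) = 0" if "f \<in> S'" "i < dim_row B" "j < dim_row A" "(i, j) \<notin> I" for f i j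
        using that insert.prems(4)[of f i j] by (cases "(i, j) = p") (auto simp: S'_def)
    qed
    then obtain fs where fs: "set fs \<subseteq> S'"
      and sp: "\<And>f. f \<in> S' \<Longrightarrow> \<exists>as. length as = length fs \<and> f = lin_comb sqz_cat A B as fs" by blast
    have "\<exists>as. length as = length (s # fs) \<and> f = lin_comb sqz_cat A B as (s # fs)" if f: "f \<in> S" for f
    proof -
      let ?c = "f $$ p / s $$ p"
      have "f + (- ?c) \<cdot>\<^sub>m s \<in> S'"
        using f s p insert.prems(2,3) car[OF f] car[OF s(1)] by (cases p) (auto simp: S'_def)
      then obtain as where as: "length as = length fs" "f + (- ?c) \<cdot>\<^sub>m s = lin_comb sqz_cat A B as fs"
        using sp by blast
      have "f = ?c \<cdot>\<^sub>m s + (f + (- ?c) \<cdot>\<^sub>m s)"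
        using car[OF f] car[OF s(1)] by (intro eq_matI) auto
      then have "f = lin_comb sqz_cat A B (?c # as) (s # fs)"
        unfolding as(2) by (simp add: lin_comb_def)
      then show ?thesis using as(1) by (intro exI[of _ "?c # as"]) simp
    qed
    moreover have "set (s # fs) \<subseteq> S" using fs s by (auto simp: S'_def)
    ultimately show ?thesis by blast
  qed
qed

lemma hom_finite_dim_sqz:
  fixes A B :: "'k::field mat"
  assumes "A \<in> sqz" "B \<in> sqz"
  shows "\<exists>fs. set fs \<subseteq> intertwiners A B \<and>
    (\<forall>f\<in>intertwiners A B. \<exists>as. length as = length fs \<and> f = lin_comb sqz_cat A B as fs)"
  by (rule hom_finite_dim_aux[where I = "{..<dim_row B} \<times> {..<dim_row A}"])
    (use assms in \<open>auto intro: add_intertwiners smult_intertwiners dest: intertwinersD\<close>)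

lemma locally_finite_sqz: "locally_finite_category (sqz_cat :: 'k::field small_tensor_cat)"
proof (intro locally_finite_category.intro abelian_linear_category.intro linear_category_sqz
    abelian_linear_category_axioms.intro locally_finite_category_axioms.intro, goal_cases)
  case 1
  have "(0\<^sub>m 0 0 :: 'k mat) \<in> sqz" by (simp add: sqz_def)
  then show ?case using is_zero_sqz by (metis index_zero_mat(2))
qed (simp_all add: ex_biproduct_sqz ex_kernel_sqz ex_cokernel_sqz mono_is_kernel_sqz epi_is_cokernel_sqz
    hom_finite_dim_sqz finite_length_sqz)

section \<open>The symmetric monoidal structure\<close>

lemma tensor_sqz_dim [simp]:
  "dim_row (tensor_sqz A B) = dim_row A * dim_row B"
  "dim_col A = dim_row A \<Longrightarrow> dim_col B = dim_row B \<Longrightarrow> dim_col (tensor_sqz A B) = dim_row A * dim_row B"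
  by (simp_all add: tensor_sqz_def)

lemma add_self_char_2:
  fixes A :: "'a::ring_1 mat"
  assumes "CHAR('a) = 2"
  shows "A + A = 0\<^sub>m (dim_row A) (dim_col A)"
proof -
  have "x + x = 0" for x :: 'a
    using of_nat_CHAR[where 'a = 'a] assms by (metis mult_2 mult_zero_left of_nat_numeral)
  then show ?thesis by (intro eq_matI) auto
qed

text \<open>The square of d \<otimes> 1 + 1 \<otimes> d is twice d \<otimes> d, the two cross terms
  being equal, and so vanishes in characteristic 2.\<close>

lemma tensor_sqz_in_sqz:
  fixes A B :: "'k::field mat"
  assumes char: "CHAR('k) = 2" and o: "A \<in> sqz" "B \<in> sqz"
  shows "tensor_sqz A B \<in> sqz"
proof (rule sqzI)
  note d = sqzD[OF o(1)] sqzD[OF o(2)]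
  show "dim_row (tensor_sqz A B) = dim_row A * dim_row B" "dim_col (tensor_sqz A B) = dim_row A * dim_row B"
    using d by simp_all
  have "tensor_sqz A B * tensor_sqz A B = kron A B + kron A B"
    using d by (simp add: tensor_sqz_def mult_add_dim add_mult_dim kron_mult kron_zero_left kron_zero_right)
  then show "tensor_sqz A B * tensor_sqz A B = 0\<^sub>m (dim_row A * dim_row B) (dim_row A * dim_row B)"
    using d by (simp add: add_self_char_2[OF char])
qed

lemma kron_intertwiners:
  fixes A B :: "'k::field mat"
  assumes o: "A \<in> sqz" "B \<in> sqz" "A' \<in> sqz" "B' \<in> sqz" and f: "f \<in> intertwiners A A'" and g: "g \<in> intertwiners B B'"
  shows "kron f g \<in> intertwiners (tensor_sqz A B) (tensor_sqz A' B')"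
proof (rule intertwinersI)
  note d = intertwinersD[OF f] intertwinersD[OF g] o[THEN sqzD(1)]
  show "tensor_sqz A' B' * kron f g = kron f g * tensor_sqz A B"
    using d by (simp add: tensor_sqz_def mult_add_dim add_mult_dim kron_mult)
qed (use f g o in \<open>auto simp: intertwiners_def sqz_def\<close>)

lemma tensor_sqz_assoc:
  assumes "dim_col A = dim_row A" "dim_col B = dim_row B" "dim_col D = dim_row D"
  shows "tensor_sqz (tensor_sqz A B) D = tensor_sqz A (tensor_sqz B D)"
  using assms by (simp add: tensor_sqz_def kron_add_left kron_add_right kron_assoc add_assoc_dim mult.assoc flip: kron_one)

lemma tensor_sqz_unit:
  assumes "dim_col A = dim_row A"
  shows "tensor_sqz (0\<^sub>m (Suc 0) (Suc 0)) A = A" "tensor_sqz A (0\<^sub>m (Suc 0) (Suc 0)) = A"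
  using assms by (simp_all add: tensor_sqz_def kron_zero_left kron_zero_right)

lemma is_iso_one: "A \<in> sqz \<Longrightarrow> dim_row A = n \<Longrightarrow> is_iso sqz_cat A A (1\<^sub>m n)"
  using one_intertwiner[of A] by (auto simp: is_iso_def is_inverse_def intro!: exI[of _ "1\<^sub>m n"])

lemma braid_sqz_dim [simp]:
  "dim_row (braid_sqz A B) = dim_row A * dim_row B"
  "dim_col A = dim_row A \<Longrightarrow> dim_col B = dim_row B \<Longrightarrow> dim_col (braid_sqz A B) = dim_row A * dim_row B"
  by (simp_all add: braid_sqz_def)

lemma swap_mat_kron':
  fixes A :: "'a::comm_semiring_1 mat"
  assumes "dim_row A = a" "dim_row B = b"
  shows "swap_mat a b * kron A B = kron B A * swap_mat (dim_col A) (dim_col B)"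
  using swap_mat_kron[of A B] assms by simp

text \<open>The twist 1 + d \<otimes> d can be carried past \<open>kron f g\<close> because both
  morphisms commute with d; the rest is naturality of the flip.\<close>

lemma braid_sqz_natural:
  fixes A B :: "'k::field mat"
  assumes o: "A \<in> sqz" "B \<in> sqz" "A' \<in> sqz" "B' \<in> sqz" and f: "f \<in> intertwiners A A'" and g: "g \<in> intertwiners B B'"
  shows "braid_sqz A' B' * kron f g = kron g f * braid_sqz A B"
proof -
  note d = intertwinersD(1,2)[OF f] intertwinersD(1,2)[OF g] o[THEN sqzD(1)]
  have "braid_sqz A' B' * kron f g = swap_mat (dim_row A') (dim_row B') * (kron f g + kron (A' * f) (B' * g))"
    using d by (simp add: braid_sqz_def mult_assoc_dim add_mult_dim kron_mult)
  also have "\<dots> = (swap_mat (dim_row A') (dim_row B') * kron f g) * (1\<^sub>m (dim_row A * dim_row B) + kron A B)"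
    using d intertwinersD(3)[OF f] intertwinersD(3)[OF g] by (simp add: mult_assoc_dim mult_add_dim kron_mult)
  also have "\<dots> = kron g f * braid_sqz A B"
    using d by (subst swap_mat_kron') (simp_all add: braid_sqz_def mult_assoc_dim)
  finally show ?thesis .
qed

text \<open>The differential of an object is itself an endomorphism in the category. So naturality,
  applied to d \<otimes> 1 and 1 \<otimes> d, already shows that the braiding commutes with the
  differentials of the tensor products.\<close>

lemma braid_sqz_intertwiner:
  fixes A B :: "'k::field mat"
  assumes o: "A \<in> sqz" "B \<in> sqz"
  shows "braid_sqz A B \<in> intertwiners (tensor_sqz A B) (tensor_sqz B A)"
proof (rule intertwinersI)
  note d = o[THEN sqzD(1)]
  note n = braid_sqz_natural[OF o o]
  have A: "A \<in> intertwiners A A" and B: "B \<in> intertwiners B B" using d by (auto simp: intertwiners_def)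
  have "braid_sqz A B * tensor_sqz A B = kron (1\<^sub>m (dim_row B)) A * braid_sqz A B + kron B (1\<^sub>m (dim_row A)) * braid_sqz A B"
    unfolding tensor_sqz_def using d n[OF A one_intertwiner[OF o(2)]] n[OF one_intertwiner[OF o(1)] B]
    by (simp add: mult_add_dim)
  also have "\<dots> = tensor_sqz B A * braid_sqz A B"
    unfolding tensor_sqz_def using d by (subst add_mult_dim) (simp_all add: add_commute_dim mult.commute)
  finally show "tensor_sqz B A * braid_sqz A B = braid_sqz A B * tensor_sqz A B" ..
qed (use o in \<open>auto simp: sqz_def mult.commute\<close>)

text \<open>Carrying the flip past the twist leaves the square of 1 + d \<otimes> d, which is 1 + 2
  d \<otimes> d and hence 1 in characteristic 2.\<close>

lemma braid_sqz_symmetric: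
  fixes A B :: "'k::field mat"
  assumes char: "CHAR('k) = 2" and o: "A \<in> sqz" "B \<in> sqz"
  shows "braid_sqz B A * braid_sqz A B = 1\<^sub>m (dim_row A * dim_row B)"
proof -
  note d = o[THEN sqzD(1)] sqzD(2)[OF o(1)] sqzD(2)[OF o(2)]
  let ?ab = "dim_row A * dim_row B"
  let ?S = "swap_mat (dim_row A) (dim_row B)" and ?S' = "swap_mat (dim_row B) (dim_row A)"
  have "(1\<^sub>m ?ab + kron B A) * ?S = ?S * (1\<^sub>m ?ab + kron A B)"
    using d by (simp add: add_mult_dim mult_add_dim swap_mat_kron' mult.commute)
  moreover have "braid_sqz B A * braid_sqz A B = ?S' * ((1\<^sub>m ?ab + kron B A) * ?S) * (1\<^sub>m ?ab + kron A B)"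
    using d by (simp add: braid_sqz_def mult_assoc_dim mult.commute)
  ultimately have "braid_sqz B A * braid_sqz A B = ?S' * (?S * (1\<^sub>m ?ab + kron A B)) * (1\<^sub>m ?ab + kron A B)"
    by simp
  also have "\<dots> = (1\<^sub>m ?ab + kron A B) * (1\<^sub>m ?ab + kron A B)"
    using d by (simp add: mult.commute swap_mat_swap_mat flip: mult_assoc_dim)
  also have "\<dots> = 1\<^sub>m ?ab + (kron A B + kron A B)"
    using d by (simp add: add_mult_dim mult_add_dim kron_mult kron_zero_left add_assoc_dim)
  also have "\<dots> = 1\<^sub>m ?ab" using d by (simp add: add_self_char_2[OF char])
  finally show ?thesis .
qed

text \<open>With d_i acting on the i-th factor, the identity needed besides the hexagon of the flip
  is (1 + d_1 d_3)(1 + d_1 d_2) = 1 + d_1 (d_2 + d_3). The extra term of the product vanishes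
  because d_1 squares to zero.\<close>

lemma braid_sqz_hexagon:
  fixes A B D :: "'k::field mat"
  assumes o: "A \<in> sqz" "B \<in> sqz" "D \<in> sqz"
  shows "braid_sqz A (tensor_sqz B D)
    = kron (1\<^sub>m (dim_row B)) (braid_sqz A D) * kron (braid_sqz A B) (1\<^sub>m (dim_row D))"
proof -
  note d = o[THEN sqzD(1)] sqzD(2)[OF o(1)]
  let ?a = "dim_row A" and ?b = "dim_row B" and ?d = "dim_row D"
  let ?S = "swap_mat ?a ?b" and ?S' = "swap_mat ?a ?d"
  let ?M = "kron (kron A B) (1\<^sub>m ?d)" and ?N = "kron (kron A (1\<^sub>m ?b)) D"
  \<comment> \<open>The twist on the last two factors in the order \<open>B\<close>,
    \<open>A\<close>, \<open>D\<close>, pulled back along the first flip, becomes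
    \<open>?N\<close>.\<close>
  have "kron (kron (1\<^sub>m ?b) A) D * kron ?S (1\<^sub>m ?d) = kron ?S (1\<^sub>m ?d) * ?N"
    using d by (simp add: kron_mult swap_mat_kron' mult.commute)
  then have N: "(1\<^sub>m (?a * ?b * ?d) + kron (1\<^sub>m ?b) (kron A D)) * kron ?S (1\<^sub>m ?d) = kron ?S (1\<^sub>m ?d) * (1\<^sub>m (?a * ?b * ?d) + ?N)"
    using d by (simp add: add_mult_dim mult_add_dim mult_ac flip: kron_assoc)
  have one: "kron (1\<^sub>m ?b) (1\<^sub>m (?a * ?d)) = (1\<^sub>m (?a * ?b * ?d) :: 'k mat)" "kron (1\<^sub>m (?a * ?b)) (1\<^sub>m ?d) = (1\<^sub>m (?a * ?b * ?d) :: 'k mat)"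
    by (simp_all add: kron_one mult_ac)
  have 1: "kron (1\<^sub>m ?b) (braid_sqz A D) = kron (1\<^sub>m ?b) ?S' * (1\<^sub>m (?a * ?b * ?d) + kron (1\<^sub>m ?b) (kron A D))"
    using d by (simp add: braid_sqz_def kron_mult flip: one(1) kron_add_right)
  have 2: "kron (braid_sqz A B) (1\<^sub>m ?d) = kron ?S (1\<^sub>m ?d) * (1\<^sub>m (?a * ?b * ?d) + ?M)"
    using d by (simp add: braid_sqz_def kron_mult flip: one(2) kron_add_left)
  have "?N * ?M = 0\<^sub>m (?a * ?b * ?d) (?a * ?b * ?d)"
    using d by (simp add: kron_mult kron_zero_left)
  then have 3: "(1\<^sub>m (?a * ?b * ?d) + ?N) * (1\<^sub>m (?a * ?b * ?d) + ?M) = 1\<^sub>m (?a * ?b * ?d) + kron A (tensor_sqz B D)"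
    using d by (simp add: add_mult_dim mult_add_dim tensor_sqz_def kron_add_right kron_assoc mult.assoc)
      (intro eq_matI, auto simp: add_ac simp del: index_mult_mat(1))
  have "kron (1\<^sub>m ?b) (braid_sqz A D) * kron (braid_sqz A B) (1\<^sub>m ?d)
    = kron (1\<^sub>m ?b) ?S' * (((1\<^sub>m (?a * ?b * ?d) + kron (1\<^sub>m ?b) (kron A D)) * kron ?S (1\<^sub>m ?d)) * (1\<^sub>m (?a * ?b * ?d) + ?M))"
    unfolding 1 2 using d by (simp add: mult_assoc_dim mult_ac)
  also have "\<dots> = (kron (1\<^sub>m ?b) ?S' * kron ?S (1\<^sub>m ?d)) * ((1\<^sub>m (?a * ?b * ?d) + ?N) * (1\<^sub>m (?a * ?b * ?d) + ?M))"
    unfolding N using d by (simp add: mult_assoc_dim mult_ac)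
  also have "\<dots> = braid_sqz A (tensor_sqz B D)"
    unfolding 3 swap_mat_hexagon[symmetric] braid_sqz_def by (simp add: mult.assoc)
  finally show ?thesis ..
qed

lemma symmetric_monoidal_sqz:
  assumes char: "CHAR('k::field) = 2"
  shows "symmetric_monoidal_linear_category (sqz_cat :: 'k small_tensor_cat)"
proof (intro symmetric_monoidal_linear_category.intro linear_category_sqz symmetric_monoidal_linear_category_axioms.intro, goal_cases)
  case 1 then show ?case by (simp add: sqz_def)
next
  case 2 then show ?case by (simp add: tensor_sqz_in_sqz[OF char])
next
  case 3 then show ?case by (simp add: kron_intertwiners)
next
  case 4 then show ?case by (simp add: kron_one)
next
  case 5 then show ?case by (simp add: kron_mult intertwiners_def)
next
  case 6 then show ?case by (simp add: kron_add_right intertwiners_def)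
next
  case 7 then show ?case by (simp add: kron_add_left intertwiners_def)
next
  case 8 then show ?case by (simp add: kron_smult_right)
next
  case 9 then show ?case by (simp add: kron_smult_left)
next
  case (10 A B D) then show ?case
    by (simp add: tensor_sqz_assoc sqzD tensor_sqz_in_sqz[OF char] is_iso_one mult.assoc)
next
  case 11 then show ?case by (simp add: kron_assoc intertwiners_def)
next
  case 12 then show ?case by (simp add: tensor_sqz_unit sqzD is_iso_one)
next
  case 13 then show ?case by (simp add: intertwiners_def)
next
  case 14 then show ?case by (simp add: tensor_sqz_unit sqzD is_iso_one)
next
  case 15 then show ?case by (simp add: intertwiners_def)
next
  case 16 then show ?case by (simp add: kron_one mult.assoc)
next
  case 17 then show ?case by (simp add: kron_one)
next
  case 18 then show ?case by (simp add: braid_sqz_intertwiner)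
next
  case 19 then show ?case by (simp add: braid_sqz_natural)
next
  case 20 then show ?case by (simp add: braid_sqz_symmetric[OF char])
next
  case (21 A B D) then show ?case using braid_sqz_hexagon[of A B D] by (simp add: sqzD mult_ac)
qed

section \<open>Duals and dimensions\<close>

lemma kron_transpose: "transpose_mat (kron A B) = kron (transpose_mat A) (transpose_mat B)"
  by (rule eq_matI) (auto simp: kron_index less_multD)

text \<open>\<open>colv\<close> turns a matrix into the corresponding vector of a tensor product of spaces, row by row.\<close>

definition colv :: "'a mat \<Rightarrow> 'a mat" where
  "colv M = mat (dim_row M * dim_col M) 1 (\<lambda>(k, _). M $$ (k div dim_col M, k mod dim_col M))"

abbreviation rowv :: "'a mat \<Rightarrow> 'a mat" where
  "rowv M \<equiv> transpose_mat (colv M)"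

lemma colv_dim [simp]: "dim_row (colv M) = dim_row M * dim_col M" "dim_col (colv M) = 1"
  by (simp_all add: colv_def)

lemma colv_index: "k < dim_row M * dim_col M \<Longrightarrow> colv M $$ (k, 0) = M $$ (k div dim_col M, k mod dim_col M)"
  by (simp add: colv_def)

lemma colv_add:
  "dim_row M = dim_row N \<Longrightarrow> dim_col M = dim_col N \<Longrightarrow> colv (M + N) = colv M + colv N"
  by (rule eq_matI) (auto simp: colv_index less_multD)

lemma rowv_add:
  "dim_row M = dim_row N \<Longrightarrow> dim_col M = dim_col N \<Longrightarrow> rowv (M + N) = rowv M + rowv N"
  by (rule eq_matI) (auto simp: colv_index less_multD)

lemma colv_zero: "colv (0\<^sub>m a b) = 0\<^sub>m (a * b) 1"
  by (rule eq_matI) (auto simp: colv_index less_multD)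

lemma colv_inj:
  assumes "colv M = colv N" "dim_row M = dim_row N" "dim_col M = dim_col N"
  shows "M = N"
proof (rule eq_matI)
  fix i j assume ij: "i < dim_row N" "j < dim_col N"
  then have k: "i * dim_col N + j < dim_row N * dim_col N" by (rule digits_less)
  from arg_cong[OF assms(1), of "\<lambda>M. M $$ (i * dim_col N + j, 0)"] show "M $$ (i, j) = N $$ (i, j)"
    using assms(2,3) ij k by (simp add: colv_index)
qed (use assms in auto)

lemma ex_colv:
  assumes "dim_row v = a * b" "dim_col v = 1"
  shows "\<exists>M\<in>carrier_mat a b. v = colv M"
proof -
  have "v = colv (mat a b (\<lambda>(i, j). v $$ (i * b + j, 0)))"
    using assms by (intro eq_matI) (auto simp: colv_def less_multD)
  then show ?thesis by (metis mat_carrier)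
qed

text \<open>The vec identity: on a tensor viewed as a matrix, the two factors act by left and right
  multiplication. It turns conditions on evaluations and coevaluations into matrix
  equations.\<close>

lemma kron_colv:
  fixes X :: "'a::comm_semiring_1 mat"
  assumes "dim_col X = dim_row M" "dim_col Y = dim_col M"
  shows "kron X Y * colv M = colv (X * M * transpose_mat Y)"
proof (rule eq_matI)
  fix i j assume "i < dim_row (colv (X * M * transpose_mat Y))" "j < dim_col (colv (X * M * transpose_mat Y))"
  then have i: "i < dim_row X * dim_row Y" and j: "j = 0" by auto
  note b = less_multD[OF i]
  have "(kron X Y * colv M) $$ (i, j) = (\<Sum>s<dim_row M * dim_col M. kron X Y $$ (i, s) * colv M $$ (s, 0))"
    using assms i j by (subst index_mult_sum) auto
  also have "\<dots> = (\<Sum>s<dim_row M * dim_col M. X $$ (i div dim_row Y, s div dim_col M) *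
      Y $$ (i mod dim_row Y, s mod dim_col M) * M $$ (s div dim_col M, s mod dim_col M))"
    using assms i by (intro sum.cong) (auto simp: kron_index colv_index)
  also have "\<dots> = (\<Sum>p<dim_row M. \<Sum>q<dim_col M. X $$ (i div dim_row Y, p) * Y $$ (i mod dim_row Y, q) * M $$ (p, q))"
    by (rule sum_div_mod)
  also have "\<dots> = (\<Sum>q<dim_col M. \<Sum>p<dim_row M. X $$ (i div dim_row Y, p) * M $$ (p, q) * Y $$ (i mod dim_row Y, q))"
    by (subst sum.swap) (simp add: mult_ac)
  also have "\<dots> = colv (X * M * transpose_mat Y) $$ (i, j)"
    using assms i j b by (simp add: colv_index index_mult_sum sum_distrib_right del: index_mult_mat(1))
  finally show "(kron X Y * colv M) $$ (i, j) = colv (X * M * transpose_mat Y) $$ (i, j)" .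
qed (use assms in auto)

lemma rowv_kron:
  fixes X :: "'a::comm_semiring_1 mat"
  assumes "dim_row X = dim_row M" "dim_row Y = dim_col M"
  shows "rowv M * kron X Y = rowv (transpose_mat X * M * Y)"
  using assms kron_colv[of "transpose_mat X" M "transpose_mat Y"]
  by (metis (no_types, lifting) colv_dim(1) index_transpose_mat(2,3) kron_dim(1) kron_transpose transpose_mult_dim transpose_transpose)

lemma swap_mat_colv:
  fixes M :: "'a::comm_semiring_1 mat"
  assumes "dim_row M = a" "dim_col M = b"
  shows "swap_mat a b * colv M = colv (transpose_mat M)"
proof (rule eq_matI)
  fix i j assume "i < dim_row (colv (transpose_mat M))" "j < dim_col (colv (transpose_mat M))"
  then have i: "i < b * a" and j: "j = 0" using assms by auto
  note b = less_multD[OF i]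
  have lt: "i mod a * b + i div a < a * b" using digits_less[of "i mod a" a "i div a" b] b by simp
  have "(swap_mat a b * colv M) $$ (i, j) = (\<Sum>k<a * b. swap_mat a b $$ (i, k) * colv M $$ (k, 0))"
    using assms i j by (subst index_mult_sum) (auto simp: mult.commute)
  also have "\<dots> = (\<Sum>k<a * b. if k = i mod a * b + i div a then colv M $$ (k, 0) else 0)"
  proof (rule sum.cong)
    fix k assume k: "k \<in> {..<a * b}"
    then have "i = k mod b * a + k div b \<longleftrightarrow> k = i mod a * b + i div a"
      using less_multD[of k a b] b by auto
    then show "swap_mat a b $$ (i, k) * colv M $$ (k, 0) = (if k = i mod a * b + i div a then colv M $$ (k, 0) else 0)"
      using i k by (simp add: swap_mat_def perm_mat_def mult.commute[of b a])
  qed simp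
  also have "\<dots> = colv M $$ (i mod a * b + i div a, 0)" using lt by simp
  also have "\<dots> = colv (transpose_mat M) $$ (i, j)"
    using assms i j b lt by (simp add: colv_index)
  finally show "(swap_mat a b * colv M) $$ (i, j) = colv (transpose_mat M) $$ (i, j)" .
qed (use assms in \<open>auto simp: mult.commute\<close>)

text \<open>The pairing of vectorised matrices is the trace form; the right-hand side is the trace
  of \<open>N * E\<close>. This is how the categorical dimension becomes a trace.\<close>

lemma rowv_colv_transpose:
  fixes E :: "'a::comm_semiring_1 mat"
  assumes "dim_row N = dim_col E" "dim_col N = dim_row E"
  shows "(rowv E * colv (transpose_mat N)) $$ (0, 0) = (\<Sum>j<dim_col E. (N * E) $$ (j, j))"
proof -
  have "(rowv E * colv (transpose_mat N)) $$ (0, 0)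
    = (\<Sum>k<dim_row E * dim_col E. E $$ (k div dim_col E, k mod dim_col E) * N $$ (k mod dim_col E, k div dim_col E))"
    using assms by (subst index_mult_sum) (auto simp: colv_index less_multD intro!: sum.cong)
  also have "\<dots> = (\<Sum>i<dim_row E. \<Sum>j<dim_col E. E $$ (i, j) * N $$ (j, i))"
    by (rule sum_div_mod)
  also have "\<dots> = (\<Sum>j<dim_col E. \<Sum>i<dim_row E. N $$ (j, i) * E $$ (i, j))"
    by (subst sum.swap) (simp add: mult.commute)
  also have "\<dots> = (\<Sum>j<dim_col E. (N * E) $$ (j, j))"
    using assms by (intro sum.cong) (auto simp: index_mult_sum simp del: index_mult_mat(1))
  finally show ?thesis .
qed

text \<open>With evaluation \<open>rowv E\<close> and coevaluation \<open>colv M\<close>,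
  contracting the inner factors of the zigzag composes the two matrices; the zigzag identity thus
  says that \<open>M * E\<close> is the identity.\<close>

lemma zigzag_mult:
  fixes E :: "'a::comm_semiring_1 mat"
  assumes "dim_row M = n" "dim_col M = d" "dim_row E = d" "dim_col E = n"
  shows "kron (1\<^sub>m n) (rowv E) * kron (colv M) (1\<^sub>m n) = M * E"
proof (rule eq_matI)
  fix i k assume "i < dim_row (M * E)" "k < dim_col (M * E)"
  then have ik: "i < n" "k < n" using assms by auto
  have digit3: "s div n div d = s div (d * n)" "s div n mod d = s mod (d * n) div n" "s mod n = s mod (d * n) mod n"
    if "0 < n" for s
    using that by (simp_all add: mult.commute[of d n] div_mult2_eq mod_mult2_eq)
  have "(kron (1\<^sub>m n) (rowv E) * kron (colv M) (1\<^sub>m n)) $$ (i, k)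
    = (\<Sum>s<n * (d * n). kron (1\<^sub>m n) (rowv E) $$ (i, s) * kron (colv M) (1\<^sub>m n) $$ (s, k))"
    using assms ik by (subst index_mult_sum) (auto simp: mult.assoc)
  also have "\<dots> = (\<Sum>s<n * (d * n). (if i = s div (d * n) then 1 else 0) * E $$ (s mod (d * n) div n, s mod (d * n) mod n)
     * (M $$ (s div (d * n), s mod (d * n) div n) * (if s mod (d * n) mod n = k then 1 else 0)))"
  proof (rule sum.cong)
    fix s assume "s \<in> {..<n * (d * n)}"
    then have s: "s < n * (d * n)" by simp
    note b = less_multD[OF s]
    have dn: "0 < n" "s mod (d * n) < d * n" "s < (n * d) * n" using b s by (auto simp: mult.assoc)
    have "kron (1\<^sub>m n) (rowv E) $$ (i, s) = (if i = s div (d * n) then 1 else 0) * E $$ (s mod (d * n) div n, s mod (d * n) mod n)"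
      using assms ik s b dn by (simp add: kron_index colv_index)
    moreover have "kron (colv M) (1\<^sub>m n) $$ (s, k) = M $$ (s div (d * n), s mod (d * n) div n) * (if s mod (d * n) mod n = k then 1 else 0)"
      using assms ik s b dn less_multD[OF dn(3)] by (simp add: kron_index colv_index flip: digit3)
    ultimately show "kron (1\<^sub>m n) (rowv E) $$ (i, s) * kron (colv M) (1\<^sub>m n) $$ (s, k)
      = (if i = s div (d * n) then 1 else 0) * E $$ (s mod (d * n) div n, s mod (d * n) mod n)
     * (M $$ (s div (d * n), s mod (d * n) div n) * (if s mod (d * n) mod n = k then 1 else 0))" by simp
  qed simp
  also have "\<dots> = (\<Sum>a<n. \<Sum>t<d * n. (if i = a then 1 else 0) * E $$ (t div n, t mod n)
     * (M $$ (a, t div n) * (if t mod n = k then 1 else 0)))"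
    by (rule sum_div_mod)
  also have "\<dots> = (\<Sum>a<n. if i = a then (\<Sum>t<d * n. E $$ (t div n, t mod n) * (M $$ (a, t div n) * (if t mod n = k then 1 else 0))) else 0)"
    by (intro sum.cong) auto
  also have "\<dots> = (\<Sum>t<d * n. E $$ (t div n, t mod n) * (M $$ (i, t div n) * (if t mod n = k then 1 else 0)))"
    using ik by simp
  also have "\<dots> = (\<Sum>b<d. \<Sum>c<n. E $$ (b, c) * (M $$ (i, b) * (if c = k then 1 else 0)))"
    by (rule sum_div_mod)
  also have "\<dots> = (\<Sum>b<d. \<Sum>c<n. if c = k then M $$ (i, b) * E $$ (b, c) else 0)"
    by (intro sum.cong) (auto simp: mult.commute)
  also have "\<dots> = (M * E) $$ (i, k)"
    using assms ik by (simp add: index_mult_sum del: index_mult_mat(1))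
  finally show "(kron (1\<^sub>m n) (rowv E) * kron (colv M) (1\<^sub>m n)) $$ (i, k) = (M * E) $$ (i, k)" .
qed (use assms in auto)

lemma zigzag_mult':
  fixes E :: "'a::comm_semiring_1 mat"
  assumes "dim_row M = n" "dim_col M = d" "dim_row E = d" "dim_col E = n"
  shows "kron (rowv E) (1\<^sub>m d) * kron (1\<^sub>m d) (colv M) = transpose_mat (E * M)"
proof -
  have "transpose_mat (kron (rowv E) (1\<^sub>m d) * kron (1\<^sub>m d) (colv M)) = kron (1\<^sub>m d) (rowv M) * kron (colv E) (1\<^sub>m d)"
    using assms by (subst transpose_mult_dim) (auto simp: kron_transpose mult_ac)
  also have "\<dots> = E * M" using assms by (intro zigzag_mult) auto
  finally show ?thesis by (metis transpose_transpose)
qed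

text \<open>The contragredient differential is \<open>- transpose_mat X\<close>, whose sign
  disappears in characteristic 2. With the identity matrix as evaluation and coevaluation, the
  morphism conditions come down to the vanishing of \<open>X + X\<close>.\<close>

lemma is_dual_transpose:
  fixes X :: "'k::field mat"
  assumes char: "CHAR('k) = 2" and X: "X \<in> sqz"
  shows "is_dual sqz_cat X (transpose_mat X) (rowv (1\<^sub>m (dim_row X))) (colv (1\<^sub>m (dim_row X)))"
proof -
  let ?n = "dim_row X"
  note d = sqzD(1)[OF X]
  have I: "kron (1\<^sub>m ?n) (rowv (1\<^sub>m ?n)) * kron (colv (1\<^sub>m ?n)) (1\<^sub>m ?n) = (1\<^sub>m ?n :: 'k mat)"
    by (subst zigzag_mult) auto
  have I': "kron (rowv (1\<^sub>m ?n)) (1\<^sub>m ?n) * kron (1\<^sub>m ?n) (colv (1\<^sub>m ?n)) = (1\<^sub>m ?n :: 'k mat)"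
    by (subst zigzag_mult'[of _ ?n]) auto
  have "rowv (1\<^sub>m ?n) * tensor_sqz (transpose_mat X) X = rowv X + rowv X"
    using d by (simp add: tensor_sqz_def mult_add_dim rowv_kron)
  then have ev: "rowv (1\<^sub>m ?n) \<in> intertwiners (tensor_sqz (transpose_mat X) X) (0\<^sub>m 1 1)"
    using d by (intro intertwinersI) (auto simp: add_self_char_2[OF char])
  have "tensor_sqz X (transpose_mat X) * colv (1\<^sub>m ?n) = colv X + colv X"
    using d by (simp add: tensor_sqz_def add_mult_dim kron_colv)
  then have coev: "colv (1\<^sub>m ?n) \<in> intertwiners (0\<^sub>m 1 1) (tensor_sqz X (transpose_mat X))"
    using d by (intro intertwinersI) (auto simp: add_self_char_2[OF char])
  have "is_inverse sqz_cat (tensor_sqz (tensor_sqz (transpose_mat X) X) (transpose_mat X))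
    (tensor_sqz (transpose_mat X) (tensor_sqz X (transpose_mat X))) (1\<^sub>m (?n * ?n * ?n)) (1\<^sub>m (?n * ?n * ?n))"
    using d one_intertwiner[OF tensor_sqz_in_sqz[OF char sqz_transpose[OF X] tensor_sqz_in_sqz[OF char X sqz_transpose[OF X]]]]
    by (simp add: is_inverse_def tensor_sqz_assoc mult.assoc)
  then show ?thesis
    unfolding is_dual_def sqz_cat_simps
    using d ev coev I I' sqz_transpose[OF X]
    by (auto simp: mult.assoc intro!: exI[of _ "1\<^sub>m (?n * ?n * ?n)"])
qed

section \<open>The categorical dimension as a trace\<close>

text \<open>The dual is arbitrary because \<open>cat_dim\<close> ranges over all duals. For
  \<open>ev = rowv E\<close> and \<open>coev = colv M\<close> the scalar is the trace of
  \<open>(M + X * M * transpose_mat D) * E\<close>. The zigzag makes \<open>M * E\<close> the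
  identity, and \<open>ev\<close> being a morphism gives \<open>transpose_mat D * E = E * X\<close>,
  so the twist contributes only \<open>X * X = 0\<close>.\<close>

lemma dual_trace:
  fixes X :: "'k::field mat"
  assumes char: "CHAR('k) = 2" and X: "X \<in> sqz" and dual: "is_dual sqz_cat X D ev coev"
  shows "ev * (braid_sqz X D * coev) = of_nat (dim_row X) \<cdot>\<^sub>m 1\<^sub>m 1"
proof -
  let ?n = "dim_row X" and ?d = "dim_row D"
  from dual have D: "D \<in> sqz" and ev: "ev \<in> intertwiners (tensor_sqz D X) (0\<^sub>m 1 1)"
    and coev: "coev \<in> intertwiners (0\<^sub>m 1 1) (tensor_sqz X D)"
    and zz: "1\<^sub>m ?n * (kron (1\<^sub>m ?n) ev * (1\<^sub>m (?n * ?d * ?n) * kron coev (1\<^sub>m ?n))) = 1\<^sub>m ?n"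
    by (simp_all add: is_dual_def)
  note d = sqzD(1)[OF X] sqzD(1)[OF D]
  obtain E where E: "E \<in> carrier_mat ?d ?n" "ev = rowv E"
    using ex_colv[of "transpose_mat ev" ?d ?n] intertwinersD(1,2)[OF ev] d by (auto, metis transpose_transpose)
  obtain M where M: "M \<in> carrier_mat ?n ?d" "coev = colv M"
    using ex_colv[of coev ?n ?d] intertwinersD(1,2)[OF coev] d by auto
  note dEM = carrier_matD[OF E(1)] carrier_matD[OF M(1)]
  have "kron (1\<^sub>m ?n) (rowv E) * kron (colv M) (1\<^sub>m ?n) = 1\<^sub>m ?n"
    using zz dEM unfolding E(2) M(2) by (simp add: mult.assoc)
  then have ME: "M * E = 1\<^sub>m ?n" using zigzag_mult[of M ?n ?d E] dEM by simp
  have "rowv (transpose_mat D * E + E * X) = rowv E * tensor_sqz D X"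
    using d dEM by (simp add: tensor_sqz_def mult_add_dim rowv_kron rowv_add)
  also have "\<dots> = rowv (0\<^sub>m ?d ?n)"
    using intertwinersD(3)[OF ev] d dEM unfolding E(2) by (simp add: colv_zero transpose_zero)
  finally have "colv (transpose_mat D * E + E * X) = colv (0\<^sub>m ?d ?n)" by (metis transpose_transpose)
  then have "transpose_mat D * E + E * X = 0\<^sub>m ?d ?n" by (rule colv_inj) (use d dEM in auto)
  then have "transpose_mat D * E + E * X + E * X = E * X" using d dEM by simp
  then have DE: "transpose_mat D * E = E * X"
    using d dEM by (simp add: add_assoc_dim add_self_char_2[OF char])
  let ?N = "M + X * M * transpose_mat D"
  have "braid_sqz X D * coev = swap_mat ?n ?d * colv ?N"
    unfolding M(2) braid_sqz_def using d dEM by (simp add: mult_assoc_dim add_mult_dim kron_colv colv_add)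
  also have "\<dots> = colv (transpose_mat ?N)"
    using d dEM by (intro swap_mat_colv) auto
  finally have 1: "braid_sqz X D * coev = colv (transpose_mat ?N)" .
  have "?N * E = M * E + X * (M * (transpose_mat D * E))" using d dEM by (simp add: add_mult_dim mult_assoc_dim)
  also have "\<dots> = M * E + X * (M * E * X)" unfolding DE using d dEM by (simp add: mult_assoc_dim)
  also have "\<dots> = 1\<^sub>m ?n" unfolding ME using d sqzD(2)[OF X] by simp
  finally have NE: "?N * E = 1\<^sub>m ?n" .
  have "(ev * (braid_sqz X D * coev)) $$ (0, 0) = of_nat ?n"
    unfolding 1 E(2) using d dEM by (subst rowv_colv_transpose) (auto simp: NE)
  moreover have "dim_row (ev * (braid_sqz X D * coev)) = 1" "dim_col (ev * (braid_sqz X D * coev)) = 1"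
    unfolding 1 E(2) by auto
  ultimately show ?thesis by (intro eq_matI) auto
qed

lemma cat_dim_sqz:
  fixes X :: "'k::field mat"
  assumes char: "CHAR('k) = 2" and X: "X \<in> sqz"
  shows "cat_dim sqz_cat X = of_nat (dim_row X)"
  unfolding cat_dim_def sqz_cat_simps
proof (rule the_equality)
  show "\<exists>D ev coev. is_dual sqz_cat X D ev coev \<and>
    ev * (braid_sqz X D * coev) = of_nat (dim_row X) \<cdot>\<^sub>m 1\<^sub>m (dim_row (0\<^sub>m (Suc 0) (Suc 0) :: 'k mat))"
    using is_dual_transpose[OF char X] dual_trace[OF char X is_dual_transpose[OF char X]] by auto
next
  fix a :: 'k
  assume "\<exists>D ev coev. is_dual sqz_cat X D ev coev \<and>
    ev * (braid_sqz X D * coev) = a \<cdot>\<^sub>m 1\<^sub>m (dim_row (0\<^sub>m (Suc 0) (Suc 0) :: 'k mat))"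
  then have "a \<cdot>\<^sub>m 1\<^sub>m 1 = (of_nat (dim_row X) \<cdot>\<^sub>m 1\<^sub>m 1 :: 'k mat)"
    using dual_trace[OF char X] by auto
  from arg_cong[OF this, of "\<lambda>M. M $$ (0, 0)"] show "a = of_nat (dim_row X)" by simp
qed

lemma symmetric_tensor_category_sqz:
  assumes char: "CHAR('k::field) = 2"
  shows "symmetric_tensor_category (sqz_cat :: 'k small_tensor_cat)"
proof (intro symmetric_tensor_category.intro locally_finite_sqz symmetric_monoidal_sqz char
    symmetric_tensor_category_axioms.intro, goal_cases)
  case (1 X)
  then show ?case using is_dual_transpose[OF char] by auto
next
  case (2 X)
  then show ?case using is_dual_transpose[OF char, of "transpose_mat X"] sqz_transpose[of X] by auto
next
  case 3
  have "a \<cdot>\<^sub>m 1\<^sub>m 1 = (b \<cdot>\<^sub>m 1\<^sub>m 1 :: 'k mat) \<Longrightarrow> a = b" for a b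
    by (auto simp: mat_eq_iff)
  moreover have "f = (f $$ (0, 0)) \<cdot>\<^sub>m 1\<^sub>m 1" if "f \<in> intertwiners (0\<^sub>m 1 1) (0\<^sub>m 1 1)" for f :: "'k mat"
    using that by (intro eq_matI) (auto simp: intertwiners_def)
  moreover have "a \<cdot>\<^sub>m 1\<^sub>m 1 \<in> intertwiners (0\<^sub>m 1 1) (0\<^sub>m 1 1 :: 'k mat)" for a
    by (intro intertwinersI) auto
  ultimately show ?case by (auto simp: bij_betw_def inj_on_def image_iff)
qed

section \<open>Symmetric and exterior powers of square-zero matrices\<close>

text \<open>The matrix of id \<otimes> N \<otimes> id between tensor powers of a
  \<open>p\<close>-dimensional space, for matrices \<open>N\<close> that carry no
  differential.\<close>

definition relation_mat :: "'a::comm_ring_1 mat \<Rightarrow> nat \<Rightarrow> nat \<Rightarrow> nat \<Rightarrow> 'a mat" where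
  "relation_mat N p i m = kron (1\<^sub>m (p ^ i)) (kron N (1\<^sub>m (p ^ m)))"

lemma relation_mat_dim [simp]:
  "dim_row (relation_mat N p i m) = p ^ i * (dim_row N * p ^ m)"
  "dim_col (relation_mat N p i m) = p ^ i * (dim_col N * p ^ m)"
  by (simp_all add: relation_mat_def)

lemma relation_mat_Suc: "kron (1\<^sub>m p) (relation_mat N p i m) = relation_mat N p (Suc i) m"
  unfolding relation_mat_def by (simp add: kron_one flip: kron_assoc)

lemma relation_mat_mult:
  "dim_col A = dim_row B \<Longrightarrow> relation_mat (A * B) p i m = relation_mat A p i m * relation_mat B p i m"
  by (simp add: relation_mat_def kron_mult)

text \<open>A morphism out of \<open>X\<^sup>\<otimes>\<^sup>n\<close> kills the ideal generated by \<open>j : J \<rightarrow> X \<otimes> X\<close> iff it kills the one generated by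
  any matrix with the same column space as \<open>j\<close>, which need not be a morphism. This makes the choice
  of the image or kernel \<open>J\<close> irrelevant.\<close>

definition kills :: "'a::comm_ring_1 mat \<Rightarrow> 'a mat \<Rightarrow> nat \<Rightarrow> nat \<Rightarrow> bool" where
  "kills h N p n \<longleftrightarrow> (\<forall>i m. i + m + 2 = n \<longrightarrow>
     h * relation_mat N p i m = 0\<^sub>m (dim_row h) (p ^ i * (dim_col N * p ^ m)))"

definition same_columns :: "'a::comm_ring_1 mat \<Rightarrow> 'a mat \<Rightarrow> bool" where
  "same_columns j N \<longleftrightarrow> dim_row j = dim_row N \<and>
     (\<exists>e. dim_row e = dim_col j \<and> N = j * e) \<and> (\<exists>s. dim_row s = dim_col N \<and> j = N * s)"

lemma kills_mult:
  assumes "kills h j p n" "dim_row e = dim_col j" "dim_row j = p * p" "dim_col h = p ^ n"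
  shows "kills h (j * e) p n"
  unfolding kills_def
proof (intro allI impI)
  fix i m assume n: "i + m + 2 = n"
  then have "p ^ n = p ^ i * (p * p * p ^ m)" by (simp add: power_add power2_eq_square flip: n)
  then have "h * relation_mat (j * e) p i m = (h * relation_mat j p i m) * relation_mat e p i m"
    using assms by (simp add: relation_mat_mult mult_assoc_dim)
  also have "\<dots> = 0\<^sub>m (dim_row h) (p ^ i * (dim_col (j * e) * p ^ m))"
    using assms n by (simp add: kills_def)
  finally show "h * relation_mat (j * e) p i m = 0\<^sub>m (dim_row h) (p ^ i * (dim_col (j * e) * p ^ m))" .
qed

lemma kills_same_columns:
  assumes "same_columns j N" "dim_row N = p * p" "dim_col h = p ^ n"
  shows "kills h j p n \<longleftrightarrow> kills h N p n"
proof
  obtain e s where es: "dim_row j = dim_row N" "dim_row e = dim_col j" "N = j * e" "dim_row s = dim_col N" "j = N * s"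
    using assms(1) unfolding same_columns_def by blast
  show "kills h N p n" if "kills h j p n"
    unfolding es(3) using that by (rule kills_mult) (use es(1,2) assms in auto)
  show "kills h j p n" if "kills h N p n"
    by (subst es(5), rule kills_mult[OF that]) (use es(4) assms in auto)
qed

lemma tens_pow_sqz:
  fixes X :: "'k::field mat"
  assumes char: "CHAR('k) = 2" and X: "X \<in> sqz"
  shows "tens_pow sqz_cat X n \<in> sqz" "dim_row (tens_pow sqz_cat X n) = dim_row X ^ n"
proof -
  have "(0\<^sub>m (Suc 0) (Suc 0) :: 'k mat) \<in> sqz" by (simp add: sqz_def)
  then show "tens_pow sqz_cat X n \<in> sqz" by (induction n) (auto simp: tensor_sqz_in_sqz[OF char X])
  show "dim_row (tens_pow sqz_cat X n) = dim_row X ^ n" by (induction n) auto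
qed

lemma ideal_map_sqz:
  fixes X :: "'k::field mat"
  assumes char: "CHAR('k) = 2" and X: "X \<in> sqz" and j: "dim_row j = dim_row X * dim_row X"
  shows "ideal_map sqz_cat X j i m = relation_mat j (dim_row X) i m"
proof (induction i)
  case 0
  show ?case using j by (simp add: tens_pow_sqz[OF char X] relation_mat_def)
next
  case (Suc i)
  then show ?case by (simp add: relation_mat_Suc)
qed

lemma ideal_src_sqz:
  fixes X :: "'k::field mat"
  assumes char: "CHAR('k) = 2" and X: "X \<in> sqz"
  shows "dim_row (ideal_src sqz_cat X J i m) = dim_row X ^ i * (dim_row J * dim_row X ^ m)"
  by (induction i) (auto simp: tens_pow_sqz[OF char X])

section \<open>Degree parts up to isomorphism\<close>

text \<open>An ideal enters a degree part only through the maps that kill it, so \<open>J\<close>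
  and \<open>j\<close> can be exchanged for the fixed matrix \<open>N\<close>. All objects among
  which \<open>sym_pow\<close> or \<open>ext_pow\<close> may choose then satisfy one and the same
  condition.\<close>

lemma is_degree_part_sqz:
  fixes X :: "'k::field mat"
  assumes char: "CHAR('k) = 2" and X: "X \<in> sqz" and j: "j \<in> intertwiners J (tensor_sqz X X)"
    and N: "same_columns j N"
  shows "is_degree_part sqz_cat X J j n Q q \<longleftrightarrow> Q \<in> sqz \<and> q \<in> intertwiners (tens_pow sqz_cat X n) Q \<and>
    kills q N (dim_row X) n \<and>
    (\<forall>W\<in>sqz. \<forall>h\<in>intertwiners (tens_pow sqz_cat X n) W. kills h N (dim_row X) n \<longrightarrow>
      (\<exists>!u. u \<in> intertwiners Q W \<and> u * q = h))"
proof -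
  let ?p = "dim_row X"
  have dj: "dim_row j = ?p * ?p" "dim_col j = dim_row J" using intertwinersD(1,2)[OF j] by auto
  have dN: "dim_row N = ?p * ?p" using N dj by (simp add: same_columns_def)
  have key: "(\<forall>i m. i + m + 2 = n \<longrightarrow> h * ideal_map sqz_cat X j i m = 0\<^sub>m (dim_row W) (dim_row (ideal_src sqz_cat X J i m)))
    \<longleftrightarrow> kills h N ?p n" if h: "h \<in> intertwiners (tens_pow sqz_cat X n) W" for h W
  proof -
    have dh: "dim_row h = dim_row W" "dim_col h = ?p ^ n"
      using intertwinersD(1,2)[OF h] tens_pow_sqz(2)[OF char X] by auto
    have "kills h N ?p n \<longleftrightarrow> kills h j ?p n"
      by (rule kills_same_columns[OF N dN dh(2), symmetric])
    then show ?thesis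
      by (simp only: kills_def ideal_map_sqz[OF char X dj(1)] ideal_src_sqz[OF char X] dh dj)
  qed
  show ?thesis
    unfolding is_degree_part_def sqz_cat_simps by (simp only: key cong: conj_cong ball_cong)
qed

text \<open>Both sides are traces, of \<open>A * B\<close> and of \<open>B * A\<close>. It serves to
  compare the dimensions of isomorphic objects.\<close>

lemma of_nat_dim_eq:
  fixes A :: "'a::comm_ring_1 mat"
  assumes "A \<in> carrier_mat m n" "B \<in> carrier_mat n m" "A * B = 1\<^sub>m m" "B * A = 1\<^sub>m n"
  shows "(of_nat m :: 'a) = of_nat n"
proof -
  have "(of_nat m :: 'a) = (\<Sum>i<m. (A * B) $$ (i, i))" using assms by simp
  also have "\<dots> = (\<Sum>i<m. \<Sum>k<n. A $$ (i, k) * B $$ (k, i))"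
    using assms(1,2) by (intro sum.cong) (auto simp: index_mult_sum simp del: index_mult_mat(1))
  also have "\<dots> = (\<Sum>k<n. \<Sum>i<m. B $$ (k, i) * A $$ (i, k))"
    by (subst sum.swap) (simp add: mult.commute)
  also have "\<dots> = (\<Sum>k<n. (B * A) $$ (k, k))"
    using assms(1,2) by (intro sum.cong) (auto simp: index_mult_sum simp del: index_mult_mat(1))
  also have "\<dots> = of_nat n" using assms by simp
  finally show ?thesis .
qed

text \<open>The object picked by \<open>SOME\<close> shares its universal property with
  \<open>Q\<close> and is isomorphic to it. \<open>R\<close> stands for being an image or a kernel.
  Universality of \<open>Q\<close> is assumed in linear form, through a section \<open>s\<close>:
  every matrix \<open>h\<close> that kills the relations equals \<open>h * (s * q)\<close>.\<close>

lemma cat_dim_degree_part: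
  fixes X :: "'k::field mat"
  assumes char: "CHAR('k) = 2" and X: "X \<in> sqz"
    and ex: "\<exists>J j. R J j"
    and R: "\<And>J j. R J j \<Longrightarrow> j \<in> intertwiners J (tensor_sqz X X) \<and> same_columns j N"
    and Q: "Q \<in> sqz" and q: "q \<in> intertwiners (tens_pow sqz_cat X n) Q" "kills q N (dim_row X) n"
    and s: "s \<in> carrier_mat (dim_row X ^ n) (dim_row Q)" "q * s = 1\<^sub>m (dim_row Q)"
    and univ: "\<And>h. dim_col h = dim_row X ^ n \<Longrightarrow> kills h N (dim_row X) n \<Longrightarrow> h * (s * q) = h"
  shows "cat_dim sqz_cat (SOME Q. \<exists>J j q. R J j \<and> is_degree_part sqz_cat X J j n Q q) = of_nat (dim_row Q)"
proof -
  let ?T = "tens_pow sqz_cat X n" and ?p = "dim_row X"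
  have T: "?T \<in> sqz" "dim_row ?T = ?p ^ n" using tens_pow_sqz[OF char X] by auto
  note dq = intertwinersD(1,2)[OF q(1)] carrier_matD[OF s(1)] sqzD(1)[OF Q] sqzD(1)[OF T(1)] T(2)
  \<comment> \<open>The factor is \<open>h * s\<close>. It commutes with the differentials because
    \<open>h\<close> and \<open>q\<close> do and \<open>q * s\<close> is the identity, although
    \<open>s\<close> is just a linear map.\<close>
  have uniq: "\<exists>!u. u \<in> intertwiners Q W \<and> u * q = h" if W: "W \<in> sqz" and h: "h \<in> intertwiners ?T W" and k: "kills h N ?p n" for W h
  proof (rule ex1I[of _ "h * s"])
    note dh = intertwinersD(1,2)[OF h] sqzD(1)[OF W]
    have hsq: "h * s * q = h" using univ[OF _ k] dh dq by (simp add: mult_assoc_dim)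
    have "W * (h * s) = W * h * s" using dh dq by (simp add: mult_assoc_dim)
    also have "\<dots> = h * s * q * ?T * s" unfolding hsq intertwinersD(3)[OF h] ..
    also have "\<dots> = h * s * (q * ?T) * s" using dh dq by (simp add: mult_assoc_dim)
    also have "\<dots> = h * s * (Q * q) * s" unfolding intertwinersD(3)[OF q(1)] ..
    also have "\<dots> = h * s * Q" using dh dq s(2) by (simp add: mult_assoc_dim)
    finally show "h * s \<in> intertwiners Q W \<and> h * s * q = h"
      using dh dq hsq by (auto intro: intertwinersI)
  next
    fix u assume u: "u \<in> intertwiners Q W \<and> u * q = h"
    then have "dim_col u = dim_row Q" by (auto simp: intertwiners_def)
    with u dq s(2) show "u = h * s" by (auto simp: mult_assoc_dim)
  qed
  obtain J j where J: "R J j" using ex by blast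
  note dpart = is_degree_part_sqz[OF char X conjunct1[OF R] conjunct2[OF R]]
  have "is_degree_part sqz_cat X J j n Q q"
    unfolding dpart[OF J J] by (intro conjI ballI impI Q q uniq)
  with J have "\<exists>Q. \<exists>J j q. R J j \<and> is_degree_part sqz_cat X J j n Q q" by blast
  \<comment> \<open>The choice may come from another pair \<open>J'\<close>, \<open>j'\<close>;
    \<open>R\<close> still gives it the column space of \<open>N\<close>.\<close>
  then obtain J' j' q' Q' where
    Q': "Q' = (SOME Q. \<exists>J j q. R J j \<and> is_degree_part sqz_cat X J j n Q q)"
    and R': "R J' j'" "is_degree_part sqz_cat X J' j' n Q' q'"
    by (metis (mono_tags, lifting) someI_ex)
  note R2 = R'(2)[unfolded dpart[OF R'(1) R'(1)]]
  have dp: "Q' \<in> sqz" "q' \<in> intertwiners ?T Q'" "kills q' N ?p n"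
    using R2 by simp_all
  have uniq': "\<exists>!u. u \<in> intertwiners Q' W \<and> u * q' = h" if "W \<in> sqz" "h \<in> intertwiners ?T W" "kills h N ?p n" for W h
    using R2 that by simp
  have ex1_eq: "a = b" if "\<exists>!x. P x" "P a" "P b" for P and a b :: "'k mat"
    by (rule trans[OF the1_equality[OF that(1,2), symmetric] the1_equality[OF that(1,3)]])
  from uniq[OF dp] obtain u where u: "u \<in> intertwiners Q Q'" "u * q = q'" by blast
  from uniq'[OF Q q] obtain v where v: "v \<in> intertwiners Q' Q" "v * q' = q" by blast
  note d = dq intertwinersD(1,2)[OF u(1)] intertwinersD(1,2)[OF v(1)] intertwinersD(1,2)[OF dp(2)] sqzD(1)[OF dp(1)]
  have uv: "u * v = 1\<^sub>m (dim_row Q')"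
  proof (rule ex1_eq[OF uniq'[OF dp]])
    have "u * v * q' = q'" using u(2) v(2) d by (simp add: mult_assoc_dim)
    then show "u * v \<in> intertwiners Q' Q' \<and> u * v * q' = q'"
      using comp_intertwiners[OF dp(1) Q dp(1) v(1) u(1)] by blast
    show "1\<^sub>m (dim_row Q') \<in> intertwiners Q' Q' \<and> 1\<^sub>m (dim_row Q') * q' = q'"
      using one_intertwiner[OF dp(1)] d by simp
  qed
  have vu: "v * u = 1\<^sub>m (dim_row Q)"
  proof (rule ex1_eq[OF uniq[OF Q q]])
    have "v * u * q = q" using u(2) v(2) d by (simp add: mult_assoc_dim)
    then show "v * u \<in> intertwiners Q Q \<and> v * u * q = q"
      using comp_intertwiners[OF Q dp(1) Q u(1) v(1)] by blast
    show "1\<^sub>m (dim_row Q) \<in> intertwiners Q Q \<and> 1\<^sub>m (dim_row Q) * q = q"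
      using one_intertwiner[OF Q] d by simp
  qed
  have "(of_nat (dim_row Q') :: 'k) = of_nat (dim_row Q)"
    by (rule of_nat_dim_eq[OF _ _ uv vu]) (use d in auto)
  then show ?thesis unfolding Q'[symmetric] cat_dim_sqz[OF char dp(1)] .
qed

text \<open>\<open>F\<close> factors through its image \<open>i\<close> because the cokernel map
  \<open>q\<close> kills \<open>F\<close>. Conversely, the explicit quotient map \<open>C\<close>
  factors through \<open>q\<close> and so kills \<open>i\<close>, and the certificate for
  \<open>C\<close> writes \<open>i\<close> as \<open>F * (G * i)\<close>.\<close>

lemma image_same_columns:
  fixes A :: "'k::field mat"
  assumes o: "A \<in> sqz" "B \<in> sqz" and im: "is_image sqz_cat A B F I i"
  shows "i \<in> intertwiners I B \<and> same_columns i F"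
proof -
  from im obtain Q q where c: "is_cokernel sqz_cat A B F Q q" and k: "is_kernel sqz_cat B Q q I i"
    by (auto simp: is_image_def)
  from c have F: "F \<in> intertwiners A B" and Q: "Q \<in> sqz" and q: "q \<in> intertwiners B Q" and qF: "q * F = 0\<^sub>m (dim_row Q) (dim_row A)"
    by (simp_all add: is_cokernel_def)
  from k have I: "I \<in> sqz" and i: "i \<in> intertwiners I B" and qi: "q * i = 0\<^sub>m (dim_row Q) (dim_row I)"
    by (simp_all add: is_kernel_def)
  note d = intertwinersD(1,2)[OF F] intertwinersD(1,2)[OF q] intertwinersD(1,2)[OF i]
  from k o(1) F qF obtain e where e: "e \<in> intertwiners A I" "i * e = F"
    unfolding is_kernel_def sqz_cat_simps by blast
  have "F \<in> carrier_mat (dim_row B) (dim_row A)" using d by auto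
  from cokernel_split[OF this] obtain r C S G where
    cc: "C \<in> carrier_mat r (dim_row B)" "S \<in> carrier_mat (dim_row B) r" "G \<in> carrier_mat (dim_row A) (dim_row B)"
    and ee: "C * F = 0\<^sub>m r (dim_row A)" "S * C + F * G = 1\<^sub>m (dim_row B)" by blast
  note dc = carrier_matD[OF cc(1)] carrier_matD[OF cc(2)] carrier_matD[OF cc(3)]
  note C = cokernel_object[OF o F cc ee]
  have "C * F = 0\<^sub>m (dim_row (C * B * S)) (dim_row A)" using ee dc by simp
  with c C obtain u where u: "u \<in> intertwiners Q (C * B * S)" "u * q = C"
    unfolding is_cokernel_def sqz_cat_simps by blast
  have "C * i = u * (q * i)" using intertwinersD(1,2)[OF u(1)] d by (simp add: mult_assoc_dim flip: u(2))
  also have "\<dots> = 0\<^sub>m r (dim_row I)" using qi intertwinersD(1,2)[OF u(1)] d dc by simp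
  finally have Ci: "C * i = 0\<^sub>m r (dim_row I)" .
  have "i = (S * C + F * G) * i" using ee d by simp
  also have "\<dots> = S * (C * i) + F * (G * i)" using d dc by (simp add: add_mult_dim mult_assoc_dim)
  also have "\<dots> = F * (G * i)" using d dc Ci by simp
  finally have "i = F * (G * i)" .
  moreover have "dim_row (G * i) = dim_col F" using d dc by simp
  ultimately have "\<exists>s. dim_row s = dim_col F \<and> i = F * s" by blast
  moreover have "\<exists>e. dim_row e = dim_col i \<and> F = i * e"
    using intertwinersD(1)[OF e(1)] e(2) d by metis
  ultimately show ?thesis using i d by (simp add: same_columns_def)
qed

lemma ex_image_sqz:
  fixes A :: "'k::field mat"
  assumes o: "A \<in> sqz" "B \<in> sqz" and F: "F \<in> intertwiners A B"
  shows "\<exists>I i. is_image sqz_cat A B F I i"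
proof -
  obtain Q q where c: "is_cokernel sqz_cat A B F Q q" using ex_cokernel_sqz[OF o F] by blast
  then have "Q \<in> sqz" "q \<in> intertwiners B Q" by (simp_all add: is_cokernel_def)
  then show ?thesis using ex_kernel_sqz[of B Q q] o c by (auto simp: is_image_def)
qed

section \<open>The free module of rank one by explicit matrices\<close>

lemma all_less_small:
  "(\<forall>i<2::nat. P i) \<longleftrightarrow> P 0 \<and> P 1"
  "(\<forall>i<4::nat. P i) \<longleftrightarrow> P 0 \<and> P 1 \<and> P 2 \<and> P 3"
  "(\<forall>i<8::nat. P i) \<longleftrightarrow> P 0 \<and> P 1 \<and> P 2 \<and> P 3 \<and> P 4 \<and> P 5 \<and> P 6 \<and> P 7"
  by (simp_all add: eval_nat_numeral All_less_Suc conj_ac)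

lemma mat_eq_entriesI:
  assumes "dim_row A = m" "dim_row B = m" "dim_col A = n" "dim_col B = n" "\<forall>i<m. \<forall>j<n. A $$ (i, j) = B $$ (i, j)"
  shows "A = B"
  using assms by (intro eq_matI) auto

lemma sum_lessThan_small:
  fixes f :: "nat \<Rightarrow> 'a::comm_monoid_add"
  shows "sum f {..<2} = f 0 + f 1" "sum f {..<4} = f 0 + f 1 + f 2 + f 3"
    "sum f {..<8} = f 0 + f 1 + f 2 + f 3 + f 4 + f 5 + f 6 + f 7"
  by (simp_all add: eval_nat_numeral)

definition jordan2 :: "'a::comm_ring_1 \<Rightarrow> 'a mat" where
  "jordan2 c = mat 2 2 (\<lambda>(r, s). if r = 1 \<and> s = 0 then c else 0)"

text \<open>Matrices refer to the bases \<open>x, y = d x\<close> of \<open>P = jordan2 1\<close> and \<open>xx, xy, yx, yy\<close> of \<open>P \<otimes> P\<close>. In degree \<open>n > 0\<close> both \<open>S P\<close> and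
  \<open>\<Lambda> P\<close> have the basis \<open>x\<^sup>n\<close>, \<open>x\<^sup>n\<^sup>-\<^sup>1 y\<close>, on which \<open>d\<close> acts by \<open>jordan2 n\<close>; \<open>mul_P\<close> is multiplication by an
  element of \<open>P\<close> from the left.\<close>

definition rel_P :: "'a::comm_ring_1 mat" where
  "rel_P = mat 4 4 (\<lambda>(r, s). if (r, s) \<in> {(3, 0), (1, 1), (2, 1), (1, 2), (2, 2)} then 1 else 0)"

text \<open>Lifts the images under \<open>rel_P\<close>: yy goes to xx, and xy + yx goes to
  xy.\<close>

definition homotopy_P :: "'a::comm_ring_1 mat" where
  "homotopy_P = mat 4 4 (\<lambda>(r, s). if (r, s) \<in> {(1, 2), (0, 3)} then 1 else 0)"

definition mul_P :: "'a::comm_ring_1 mat" where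
  "mul_P = mat 2 4 (\<lambda>(r, s). if (r, s) \<in> {(0, 0), (1, 1), (1, 2)} then 1 else 0)"

definition unit_x :: "'a::comm_ring_1 mat" where
  "unit_x = mat 2 1 (\<lambda>(r, s). if r = 0 then 1 else 0)"

definition split_P :: "'a::comm_ring_1 mat" where
  "split_P = mat 4 4 (\<lambda>(r, s). if (r, s) \<in> {(1, 1), (0, 3)} then 1 else 0)"

lemmas P_defs = jordan2_def rel_P_def homotopy_P_def mul_P_def unit_x_def split_P_def

lemma P_dims [simp]:
  "dim_row (jordan2 c) = 2" "dim_col (jordan2 c) = 2" "dim_row rel_P = 4" "dim_col rel_P = 4"
  "dim_row homotopy_P = 4" "dim_col homotopy_P = 4" "dim_row mul_P = 2" "dim_col mul_P = 4"
  "dim_row unit_x = 2" "dim_col unit_x = 1" "dim_row split_P = 4" "dim_col split_P = 4"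
  by (simp_all add: P_defs)

lemmas small_mat = index_mult_sum kron_index sum_lessThan_small P_defs

lemma char_2_add:
  assumes "CHAR('a::comm_ring_1) = 2"
  shows "a + a = (0 :: 'a)" "- a = (a :: 'a)" "(2 :: 'a) = 0"
proof -
  show 2: "(2 :: 'a) = 0" using of_nat_CHAR[where 'a = 'a] assms by simp
  then show "a + a = 0" by (metis mult_2 mult_zero_left)
  then show "- a = a" by (metis minus_unique)
qed

lemma jordan2_sqz: "jordan2 c \<in> sqz"
proof (rule sqzI)
  show "jordan2 c * jordan2 c = 0\<^sub>m 2 2"
    by (rule mat_eq_entriesI[of _ 2 _ 2]) (simp_all add: all_less_small small_mat del: index_mult_mat(1))
qed simp_all

lemma mul_P_unit_x: "mul_P * kron (1\<^sub>m 2) unit_x = (1\<^sub>m 2 :: 'a::comm_ring_1 mat)"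
  by (rule mat_eq_entriesI[of _ 2 _ 2]) (simp_all add: all_less_small small_mat del: index_mult_mat(1))

text \<open>The Leibniz rule: d x^n = n x^(n-1) y implies d x^(n+1) = (n+1) x^n y, whence the
  parameter \<open>1 + c\<close>.\<close>

lemma mul_P_intertwines:
  "mul_P * tensor_sqz (jordan2 1) (jordan2 c) = jordan2 (1 + c) * (mul_P :: 'a::comm_ring_1 mat)"
  by (rule mat_eq_entriesI[of _ 2 _ 4]) (simp_all add: all_less_small small_mat tensor_sqz_def del: index_mult_mat(1))

text \<open>Exactly the words with at most one letter y survive, wherever it stands. Having the
  entries explicitly keeps the next entrywise check small.\<close>

lemma mul_P_mul_P:
  "mul_P * kron (1\<^sub>m 2) mul_P
    = (mat 2 8 (\<lambda>(r, s). if (r, s) \<in> {(0, 0), (1, 1), (1, 2), (1, 4)} then 1 else 0) :: 'a::comm_ring_1 mat)"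
  by (rule mat_eq_entriesI[of _ 2 _ 8]) (simp_all add: all_less_small small_mat del: index_mult_mat(1))

text \<open>A relation meets the multiplication in two ways: on the last two letters of a word, or
  on two letters in front of a nonempty tail that is already reduced.\<close>

lemma mul_P_rel_P:
  assumes "CHAR('a::comm_ring_1) = 2"
  shows "mul_P * rel_P = (0\<^sub>m 2 4 :: 'a mat)"
    "mul_P * kron (1\<^sub>m 2) mul_P * kron rel_P (1\<^sub>m 2) = (0\<^sub>m 2 8 :: 'a mat)"
  subgoal by (rule mat_eq_entriesI[of _ 2 _ 4]) (simp_all add: all_less_small small_mat char_2_add[OF assms] del: index_mult_mat(1))
  subgoal unfolding mul_P_mul_P by (rule mat_eq_entriesI[of _ 2 _ 8]) (simp_all add: all_less_small small_mat char_2_add[OF assms] del: index_mult_mat(1))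
  done

text \<open>Reduction to the normal forms xx and yx, with the difference exhibited as a relation: xy
  differs from yx by the image of xy under \<open>rel_P\<close>, and yy is the image of xx.\<close>

lemma split_P:
  assumes "CHAR('a::comm_ring_1) = 2"
  shows "kron (1\<^sub>m 2) unit_x * mul_P + rel_P * split_P = (1\<^sub>m 4 :: 'a mat)"
  by (rule mat_eq_entriesI[of _ 4 _ 4]) (simp_all add: all_less_small small_mat char_2_add[OF assms] del: index_mult_mat(1))

text \<open>A contracting homotopy: it shows that the kernel of \<open>c - 1\<close> on \<open>P \<otimes> P\<close> is contained in its image.\<close>

lemma homotopy_P:
  assumes "CHAR('a::comm_ring_1) = 2"
  shows "rel_P * homotopy_P + homotopy_P * rel_P = (1\<^sub>m 4 :: 'a mat)"
  by (rule mat_eq_entriesI[of _ 4 _ 4]) (simp_all add: all_less_small small_mat char_2_add[OF assms] del: index_mult_mat(1))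

lemma rel_P_square:
  assumes "CHAR('a::comm_ring_1) = 2"
  shows "rel_P * rel_P = (0\<^sub>m 4 4 :: 'a mat)"
  by (rule mat_eq_entriesI[of _ 4 _ 4]) (simp_all add: all_less_small small_mat char_2_add[OF assms] del: index_mult_mat(1))

lemma braid_minus_id_P:
  assumes "CHAR('k::field) = 2"
  shows "braid_minus_id sqz_cat (jordan2 1) = (rel_P :: 'k mat)"
  by (rule mat_eq_entriesI[of _ 4 _ 4])
    (simp_all add: all_less_small braid_minus_id_def braid_sqz_def swap_mat_def perm_mat_def
      small_mat char_2_add[OF assms] del: index_mult_mat(1))

section \<open>Reduction of words in x and y\<close>

primrec pow_unit_x :: "nat \<Rightarrow> 'a::comm_ring_1 mat" where
  "pow_unit_x 0 = 1\<^sub>m 1"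
| "pow_unit_x (Suc n) = kron unit_x (pow_unit_x n)"

text \<open>The projection from tensor degree \<open>n + 1\<close>, not \<open>n\<close>: degree 0
  is one-dimensional and is treated separately.\<close>

primrec quot_P :: "nat \<Rightarrow> 'a::comm_ring_1 mat" where
  "quot_P 0 = 1\<^sub>m 2"
| "quot_P (Suc n) = mul_P * kron (1\<^sub>m 2) (quot_P n)"

lemma pow_unit_x_dim [simp]: "dim_row (pow_unit_x n) = 2 ^ n" "dim_col (pow_unit_x n) = 1"
  by (induction n) auto

lemma quot_P_dim [simp]: "dim_row (quot_P n) = 2" "dim_col (quot_P n) = 2 * 2 ^ n"
  by (induction n) auto

text \<open>The section appends \<open>n\<close> letters x to a vector. In the induction step the
  tail x...x is the section applied to x, so \<open>quot_P n\<close> returns x, and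
  \<open>mul_P_unit_x\<close> remains.\<close>

lemma quot_P_section: "quot_P n * kron (1\<^sub>m 2) (pow_unit_x n) = (1\<^sub>m 2 :: 'a::comm_ring_1 mat)"
proof (induction n)
  case 0
  show ?case by (simp add: kron_one)
next
  case (Suc n)
  have "kron unit_x (pow_unit_x n) = kron (1\<^sub>m 2) (pow_unit_x n) * (unit_x :: 'a mat)"
    using kron_mult[of "1\<^sub>m 2" unit_x "pow_unit_x n" "1\<^sub>m 1 :: 'a mat"] by simp
  then have "quot_P n * kron unit_x (pow_unit_x n) = (unit_x :: 'a mat)"
    using Suc.IH by (simp flip: mult_assoc_dim)
  then show ?case by (simp add: mult_assoc_dim kron_mult mul_P_unit_x)
qed

lemma quot_P_intertwines:
  assumes char: "CHAR('k::field) = 2"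
  shows "jordan2 (of_nat (Suc n)) * quot_P n = quot_P n * tens_pow sqz_cat (jordan2 1 :: 'k mat) (Suc n)"
proof (induction n)
  case 0
  show ?case by (simp add: tensor_sqz_unit)
next
  case (Suc n)
  let ?P = "jordan2 1 :: 'k mat" and ?J = "jordan2 (of_nat (Suc n)) :: 'k mat"
  let ?T = "tens_pow sqz_cat ?P (Suc n)"
  have T: "dim_row ?T = 2 * 2 ^ n" "dim_col ?T = 2 * 2 ^ n"
    using tens_pow_sqz[OF char jordan2_sqz, of 1 "Suc n"] by (auto simp: sqz_def)
  have "quot_P (Suc n) * tens_pow sqz_cat ?P (Suc (Suc n)) = mul_P * kron (1\<^sub>m 2) (quot_P n) * tensor_sqz ?P ?T"
    by simp
  also have "\<dots> = mul_P * (kron (1\<^sub>m 2) (quot_P n) * (kron ?P (1\<^sub>m (2 * 2 ^ n)) + kron (1\<^sub>m 2) ?T))"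
    unfolding tensor_sqz_def T(1) using T by (simp add: mult_assoc_dim del: tens_pow.simps)
  also have "\<dots> = mul_P * (kron ?P (quot_P n) + kron (1\<^sub>m 2) (?J * quot_P n))"
    unfolding Suc.IH using T by (simp add: mult_add_dim kron_mult del: tens_pow.simps)
  also have "\<dots> = mul_P * (tensor_sqz ?P ?J * kron (1\<^sub>m 2) (quot_P n))"
    by (simp add: tensor_sqz_def add_mult_dim kron_mult del: of_nat_Suc)
  also have "\<dots> = mul_P * tensor_sqz ?P ?J * kron (1\<^sub>m 2) (quot_P n)"
    by (intro mult_assoc_dim[symmetric]) auto
  also have "\<dots> = jordan2 (of_nat (Suc (Suc n))) * quot_P (Suc n)"
    unfolding mul_P_intertwines by (simp add: mult_assoc_dim)
  finally show ?case ..
qed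

text \<open>A relation away from the front lies in the tail and is killed by induction. One at the
  front commutes with the reduction of the letters behind it, which leaves the two cases of
  \<open>mul_P_rel_P\<close>.\<close>

lemma kills_quot_P:
  assumes char: "CHAR('a::comm_ring_1) = 2"
  shows "kills (quot_P n) (rel_P :: 'a mat) 2 (Suc n)"
proof (induction n)
  case 0
  show ?case by (simp add: kills_def)
next
  case (Suc n)
  have "quot_P (Suc n) * relation_mat (rel_P :: 'a mat) 2 i m = 0\<^sub>m 2 (2 ^ i * (4 * 2 ^ m))" if im: "i + m + 2 = Suc (Suc n)" for i m
  proof (cases i)
    case (Suc i')
    have pw: "2 ^ i' * (4 * 2 ^ m) = 2 * (2 ^ n :: nat)"
      using im Suc by (auto simp: power_add[symmetric] algebra_simps)
    have "quot_P n * relation_mat (rel_P :: 'a mat) 2 i' m = 0\<^sub>m 2 (2 ^ i' * (4 * 2 ^ m))"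
      using Suc.IH im Suc by (simp add: kills_def)
    moreover have "quot_P (Suc n) * relation_mat (rel_P :: 'a mat) 2 (Suc i') m
      = mul_P * kron (1\<^sub>m 2) (quot_P n * relation_mat rel_P 2 i' m)"
      by (simp add: pw mult_assoc_dim kron_mult flip: relation_mat_Suc)
    ultimately show ?thesis unfolding Suc by (simp add: kron_zero_right mult_ac)
  next
    case 0
    then have m: "m = n" using im by simp
    have *: "relation_mat (rel_P :: 'a mat) 2 i m = kron rel_P (1\<^sub>m (2 ^ n))"
      by (simp add: relation_mat_def 0 m)
    show ?thesis
    proof (cases n)
      case 0
      then show ?thesis unfolding * using mul_P_rel_P(1)[OF char] by (simp add: kron_one m \<open>i = 0\<close>)
    next
      case (Suc n')
      have "quot_P (Suc n) = mul_P * (kron (1\<^sub>m 2) mul_P * kron (1\<^sub>m 4) (quot_P n' :: 'a mat))"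
        using kron_assoc[of "1\<^sub>m 2" "1\<^sub>m 2" "quot_P n' :: 'a mat"] by (simp add: Suc kron_mult kron_one)
      then have "quot_P (Suc n) * kron rel_P (1\<^sub>m (2 ^ n))
        = mul_P * kron (1\<^sub>m 2) mul_P * (kron rel_P (quot_P n' :: 'a mat))"
        by (simp add: Suc mult_assoc_dim kron_mult)
      also have "\<dots> = mul_P * kron (1\<^sub>m 2) mul_P * kron rel_P (1\<^sub>m 2) * kron (1\<^sub>m 4) (quot_P n' :: 'a mat)"
        by (simp add: mult_assoc_dim kron_mult)
      also have "\<dots> = 0\<^sub>m 2 (4 * (2 * 2 ^ n'))"
        unfolding mul_P_rel_P(2)[OF char] by simp
      finally show ?thesis unfolding * by (simp add: \<open>i = 0\<close> m Suc)
    qed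
  qed
  then show ?case by (simp add: kills_def)
qed

text \<open>Writing the identity of the first factor as a sum of terms u u^T reduces the claim to
  the maps obtained from \<open>h\<close> by fixing the first tensor factor, to which an induction
  hypothesis can be applied.\<close>

lemma kron_one_2_fixedI:
  fixes h :: "'a::comm_ring_1 mat"
  assumes h: "dim_col h = 2 * a" and Z: "dim_row Z = a" "dim_col Z = a"
    and fx: "\<And>u. dim_row u = 2 \<Longrightarrow> dim_col u = 1 \<Longrightarrow> h * kron u (1\<^sub>m a) * Z = h * kron u (1\<^sub>m a)"
  shows "h * kron (1\<^sub>m 2) Z = h"
proof -
  define u :: "nat \<Rightarrow> 'a mat" where "u c = mat 2 1 (\<lambda>(r, s). if r = c then 1 else 0)" for c
  have du [simp]: "dim_row (u c) = 2" "dim_col (u c) = 1" for c by (simp_all add: u_def)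
  have one: "1\<^sub>m 2 = u 0 * transpose_mat (u 0) + u 1 * transpose_mat (u 1)"
    by (rule mat_eq_entriesI[of _ 2 _ 2])
      (simp_all add: all_less_small index_mult_sum u_def del: index_mult_mat(1))
  have uu: "h * kron (u c * transpose_mat (u c)) Z = h * kron (u c * transpose_mat (u c)) (1\<^sub>m a)" for c
  proof -
    have 1: "kron (u c * transpose_mat (u c)) W = kron (u c) (1\<^sub>m a) * W * kron (transpose_mat (u c)) (1\<^sub>m a)"
      if "dim_row W = a" "dim_col W = a" for W
    proof -
      have "kron (u c) (1\<^sub>m a) * W = kron (u c) W"
        using kron_mult[of "u c" "1\<^sub>m 1" "1\<^sub>m a" W] that by simp
      then show ?thesis using that by (simp add: kron_mult)
    qed
    have "h * kron (u c * transpose_mat (u c)) Z = (h * kron (u c) (1\<^sub>m a) * Z) * kron (transpose_mat (u c)) (1\<^sub>m a)"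
      using h Z by (simp add: 1 mult_assoc_dim)
    also have "\<dots> = h * kron (u c * transpose_mat (u c)) (1\<^sub>m a)"
      unfolding fx[OF du] using h by (simp add: 1 mult_assoc_dim)
    finally show ?thesis .
  qed
  have "h * kron (1\<^sub>m 2) Z = h * kron (1\<^sub>m 2) (1\<^sub>m a)"
    unfolding one using h Z by (simp add: kron_add_left mult_add_dim uu)
  then show ?thesis using h by (simp add: kron_one)
qed

text \<open>A map killing the relations is determined by its values on a vector followed by letters
  x. With the first letter fixed, induction brings the rest of the word to this form; the first two
  letters are reduced last. \<open>h\<close> varies in the induction because it is replaced by such
  restrictions.\<close>

lemma quot_P_universal:
  fixes h :: "'a::comm_ring_1 mat"
  assumes char: "CHAR('a) = 2" and h: "dim_col h = 2 ^ Suc n" "kills h rel_P 2 (Suc n)"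
  shows "h * (kron (1\<^sub>m 2) (pow_unit_x n) * quot_P n) = h"
  using h
proof (induction n arbitrary: h)
  case 0
  then show ?case by (simp add: kron_one)
next
  case (Suc n)
  let ?q = "quot_P n :: 'a mat" and ?t = "pow_unit_x n :: 'a mat"
  let ?s = "kron (1\<^sub>m 2) ?t"
  have dh: "dim_col h = 2 * (2 * 2 ^ n)" using Suc.prems by simp
  have "h * kron (1\<^sub>m 2) (?s * ?q) = h"
  proof (rule kron_one_2_fixedI[OF dh])
    fix u :: "'a mat" assume u: "dim_row u = 2" "dim_col u = 1"
    let ?h = "h * kron u (1\<^sub>m (2 * 2 ^ n))"
    have "?h * relation_mat rel_P 2 i m = 0\<^sub>m (dim_row h) (2 ^ i * (4 * 2 ^ m))" if im: "i + m + 2 = Suc n" for i m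
    proof -
      have pw: "2 ^ i * (4 * 2 ^ m) = 2 * (2 ^ n :: nat)"
        using im by (auto simp: power_add[symmetric] algebra_simps)
      \<comment> \<open>With the first letter fixed, a relation at position \<open>i\<close> is one
        at position \<open>Suc i\<close> for the original map.\<close>
      have "kron u (1\<^sub>m (2 * 2 ^ n)) * relation_mat rel_P 2 i m = kron u (relation_mat rel_P 2 i m)"
        using kron_mult[of u "1\<^sub>m 1" "1\<^sub>m (2 * 2 ^ n)" "relation_mat rel_P 2 i m"] u pw by simp
      also have "\<dots> = relation_mat rel_P 2 (Suc i) m * kron u (1\<^sub>m (2 * 2 ^ n))"
        using u pw by (simp add: kron_mult flip: relation_mat_Suc)
      finally have "?h * relation_mat rel_P 2 i m = h * relation_mat rel_P 2 (Suc i) m * kron u (1\<^sub>m (2 * 2 ^ n))"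
        using dh u pw by (simp add: mult_assoc_dim)
      also have "h * relation_mat rel_P 2 (Suc i) m = 0\<^sub>m (dim_row h) (2 * (2 * 2 ^ n))"
      proof -
        have "Suc i + m + 2 = Suc (Suc n)" using im by simp
        then have "h * relation_mat rel_P 2 (Suc i) m = 0\<^sub>m (dim_row h) (2 ^ Suc i * (dim_col (rel_P :: 'a mat) * 2 ^ m))"
          using Suc.prems(2) unfolding kills_def by blast
        also have "2 ^ Suc i * (dim_col (rel_P :: 'a mat) * 2 ^ m) = 2 * (2 * 2 ^ n)"
          unfolding pw[symmetric] by simp
        finally show ?thesis .
      qed
      finally show ?thesis unfolding pw using u by simp
    qed
    then have "kills ?h rel_P 2 (Suc n)" by (simp add: kills_def)
    moreover have "dim_col ?h = 2 ^ Suc n" using u by simp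
    ultimately show "?h * (?s * ?q) = ?h" by (intro Suc.IH)
  qed simp_all
  then have 1: "h * (kron (1\<^sub>m 2) ?s * kron (1\<^sub>m 2) ?q) = h" by (simp add: kron_mult)
  have s4: "kron (1\<^sub>m 2) ?s = kron (1\<^sub>m 4) ?t"
    using kron_assoc[of "1\<^sub>m 2" "1\<^sub>m 2" ?t] by (simp add: kron_one)
  have "h * kron rel_P (1\<^sub>m (2 ^ n)) = 0\<^sub>m (dim_row h) (4 * 2 ^ n)"
    using Suc.prems(2) by (auto simp: kills_def relation_mat_def dest: spec[of _ 0])
  then have "h * kron rel_P (1\<^sub>m (2 ^ n)) * kron split_P ?t = 0\<^sub>m (dim_row h) 4" by simp
  then have 2: "h * kron (rel_P * split_P) ?t = 0\<^sub>m (dim_row h) 4"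
    using dh by (simp add: mult_assoc_dim kron_mult)
  \<comment> \<open>All letters behind the first two are now x; \<open>split_P\<close> reduces the
    first two, and \<open>h\<close> kills its correction term.\<close>
  have "h * kron (1\<^sub>m 2) ?s = h * kron (kron (1\<^sub>m 2) unit_x * mul_P + rel_P * split_P) ?t"
    unfolding s4 split_P[OF char] ..
  also have "\<dots> = h * kron (kron (1\<^sub>m 2) unit_x * mul_P) ?t"
    using dh 2 by (simp add: kron_add_left mult_add_dim)
  also have "\<dots> = h * (kron (kron (1\<^sub>m 2) unit_x) ?t * mul_P)"
    using kron_mult[of "kron (1\<^sub>m 2) unit_x" mul_P ?t "1\<^sub>m 1"] by simp
  finally have 3: "h * kron (1\<^sub>m 2) ?s = h * (kron (1\<^sub>m 2) (kron unit_x ?t) * mul_P)"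
    by (simp add: kron_assoc)
  have "h * (kron (1\<^sub>m 2) (pow_unit_x (Suc n)) * quot_P (Suc n))
    = h * (kron (1\<^sub>m 2) (kron unit_x ?t) * mul_P) * kron (1\<^sub>m 2) ?q"
    using dh by (simp add: mult_assoc_dim)
  also have "\<dots> = h * (kron (1\<^sub>m 2) ?s * kron (1\<^sub>m 2) ?q)"
    unfolding 3[symmetric] using dh by (simp add: mult_assoc_dim)
  finally show ?case unfolding 1 .
qed

section \<open>Powers with 2-adic exponents\<close>

lemma digit_eq_0_or_1: "digit t j = 0 \<or> digit t j = 1"
  using digit_le_1[of t j] by auto

lemma digits_eqI: "(\<And>j. digit s j = digit t j) \<Longrightarrow> s = t"
  by (rule two_adic_eqI) (simp add: residue_eq_sum_digits)

lemma fps_nth_mult_one_plus_X_power: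
  fixes A :: "'a::comm_ring_1 fps"
  assumes "d \<le> 1" "n < m"
  shows "fps_nth (A * (1 + fps_X ^ m) ^ d) n = fps_nth A n"
proof -
  from assms(1) consider "d = 0" | "d = 1" by linarith
  then show ?thesis
    using assms(2) by cases (simp_all add: distrib_left fps_X_power_mult_right_nth)
qed

definition partial_powr :: "two_adic \<Rightarrow> nat \<Rightarrow> 'a::comm_ring_1 fps" where
  "partial_powr t J = (\<Prod>j<J. (1 + fps_X ^ (2 ^ j)) ^ digit t j)"

text \<open>A factor with index at least \<open>J\<close> changes coefficients only in degrees from
  \<open>2 ^ J\<close> on.\<close>

lemma partial_powr_stable:
  assumes "n < 2 ^ J" "J \<le> K"
  shows "fps_nth (partial_powr t K :: 'a::comm_ring_1 fps) n = fps_nth (partial_powr t J) n"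
  using assms(2)
proof (induction K rule: dec_induct)
  case (step K)
  have "n < 2 ^ K" using assms(1) step(1) by (meson less_le_trans one_le_numeral power_increasing)
  then show ?case
    using step.IH by (simp add: partial_powr_def fps_nth_mult_one_plus_X_power[OF digit_le_1])
qed simp

lemma partial_powr_nth_0: "fps_nth (partial_powr t J :: 'a::comm_ring_1 fps) 0 = 1"
  using partial_powr_stable[of 0 0 J t] by (simp add: partial_powr_def)

lemma one_plus_powr_nth:
  assumes "n < 2 ^ J"
  shows "fps_nth (one_plus_powr (fps_X :: 'a::field fps) t) n = fps_nth (partial_powr t J) n"
proof -
  \<comment> \<open>The coefficient of degree \<open>n\<close> can be read off from the partial
    product with \<open>n\<close> factors because \<open>n < 2 ^ n\<close>.\<close>
  define p :: "'a fps" where "p = Abs_fps (\<lambda>n. fps_nth (partial_powr t n) n)"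
  have p: "fps_nth (partial_powr t K) n = fps_nth p n" if "n < 2 ^ K" for n K
  proof -
    have "n < 2 ^ n" by (rule less_exp)
    then have "fps_nth (partial_powr t (max n K)) n = fps_nth (partial_powr t n :: 'a fps) n"
      "fps_nth (partial_powr t (max n K)) n = fps_nth (partial_powr t K :: 'a fps) n"
      using partial_powr_stable[of n n "max n K" t] partial_powr_stable[of n K "max n K" t] that by auto
    then show ?thesis by (simp add: p_def)
  qed
  have "(\<lambda>K. \<Prod>j\<le>K. (1 + fps_X ^ (2 ^ j)) ^ digit t j) \<longlonglongrightarrow> p"
  proof (rule tendsto_fpsI)
    fix n
    have "n < 2 ^ Suc K" if "n \<le> K" for K
      using that by (meson le_imp_less_Suc less_exp less_trans)
    then have "fps_nth (\<Prod>j\<le>K. (1 + fps_X ^ (2 ^ j)) ^ digit t j) n = fps_nth p n" if "n \<le> K" for K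
      using p[of n "Suc K"] that by (simp add: partial_powr_def lessThan_Suc_atMost)
    then show "\<forall>\<^sub>F K in sequentially. fps_nth (\<Prod>j\<le>K. (1 + fps_X ^ (2 ^ j)) ^ digit t j) n = fps_nth p n"
      by (rule eventually_sequentiallyI)
  qed
  \<comment> \<open>Convergence of an infinite product requires a nonzero limit; the constant
    coefficient 1 ensures it.\<close>
  moreover have "p \<noteq> 0"
  proof
    assume "p = 0"
    then show False using p[of 0 0] partial_powr_nth_0[of t 0, where 'a = 'a] by simp
  qed
  ultimately have "(\<lambda>j. (1 + fps_X ^ (2 ^ j)) ^ digit t j) has_prod p"
    by (auto simp: has_prod_def raw_has_prod_def)
  then have "one_plus_powr fps_X t = p"
    unfolding one_plus_powr_def by (rule has_prod_unique[symmetric])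
  then show ?thesis using p[OF assms] by simp
qed

lemma one_plus_powr_eqI:
  assumes "\<And>J. \<exists>K\<ge>J. \<forall>n<2 ^ K. fps_nth f n = fps_nth (partial_powr t K) n"
  shows "one_plus_powr (fps_X :: 'a::field fps) t = f"
proof (rule fps_ext)
  fix n
  obtain K where K: "K \<ge> n" "\<And>n. n < 2 ^ K \<Longrightarrow> fps_nth f n = fps_nth (partial_powr t K) n" using assms by blast
  have "n < 2 ^ K" using K(1) by (meson less_exp less_le_trans one_le_numeral power_increasing)
  then show "fps_nth (one_plus_powr fps_X t) n = fps_nth f n"
    using K(2) by (simp add: one_plus_powr_nth)
qed

text \<open>The coefficient at \<open>2 ^ j\<close> reveals digit \<open>j\<close>: the earlier
  factors agree by induction, and the later ones do not reach this degree. Uniqueness is what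
  evaluates the definite descriptions in \<open>Dim_plus\<close> and
  \<open>Dim_minus\<close>.\<close>

lemma one_plus_powr_inj:
  assumes "one_plus_powr (fps_X :: 'a::field fps) s = one_plus_powr fps_X t"
  shows "s = t"
proof (rule digits_eqI)
  fix j
  show "digit s j = digit t j"
  proof (induction j rule: less_induct)
    case (less j)
    have eq: "partial_powr s j = (partial_powr t j :: 'a fps)"
      unfolding partial_powr_def using less by (intro prod.cong) auto
    have nth: "fps_nth (partial_powr u (Suc j) :: 'a fps) (2 ^ j) = fps_nth (partial_powr u j) (2 ^ j) + of_nat (digit u j)" for u
      using digit_eq_0_or_1[of u j] partial_powr_nth_0[of u j, where 'a = 'a]
      by (auto simp: partial_powr_def distrib_left fps_X_power_mult_right_nth)
    have "fps_nth (partial_powr s (Suc j)) (2 ^ j) = fps_nth (partial_powr t (Suc j) :: 'a fps) (2 ^ j)"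
      using assms one_plus_powr_nth[of "2 ^ j" "Suc j" s, where 'a = 'a] one_plus_powr_nth[of "2 ^ j" "Suc j" t, where 'a = 'a] by simp
    then have "(of_nat (digit s j) :: 'a) = of_nat (digit t j)"
      unfolding nth eq by simp
    then show ?case using digit_eq_0_or_1[of s j] digit_eq_0_or_1[of t j] by auto
  qed
qed

section \<open>The exponents 0, 1 and -1\<close>

lemma residue_one: "residue 1 n = (if n = 0 then 0 else 1)"
  by (cases n) (simp_all add: residue_simps)

lemma residue_minus_one: "residue (-1) n = 2 ^ n - 1"
  by (simp add: residue_simps mod_minus_eq zmod_minus1)

lemma digit_0: "digit 0 j = 0"
  by (simp add: digit_def residue_simps)

lemma digit_1: "digit 1 j = (if j = 0 then 1 else 0)"
  by (simp add: digit_def residue_one)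

lemma digit_minus_1: "digit (-1) j = 1"
proof -
  have "(2 ^ Suc j - 1) div 2 ^ j = (1 :: int)"
    by (rule int_div_pos_eq[where r = "2 ^ j - 1"]) auto
  then show ?thesis by (simp add: digit_def residue_minus_one)
qed

lemma one_plus_powr_0: "one_plus_powr (fps_X :: 'a::field fps) 0 = 1"
  by (rule one_plus_powr_eqI) (auto simp: partial_powr_def digit_0)

lemma one_plus_powr_1: "one_plus_powr (fps_X :: 'a::field fps) 1 = 1 + fps_X"
proof (rule one_plus_powr_eqI)
  have "partial_powr 1 (Suc J) = (1 + fps_X :: 'a fps)" for J
    by (induction J) (simp_all add: partial_powr_def digit_1)
  then show "\<exists>K\<ge>J. \<forall>n<2 ^ K. fps_nth (1 + fps_X) n = fps_nth (partial_powr 1 K :: 'a fps) n" for J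
    by (intro exI[of _ "Suc J"]) auto
qed

text \<open>All binary digits of -1 are 1, and each factor 1 + z^(2^J) doubles the length of the
  geometric sum.\<close>

lemma one_plus_powr_minus_1: "one_plus_powr (fps_X :: 'a::field fps) (-1) = Abs_fps (\<lambda>_. 1)"
proof (rule one_plus_powr_eqI)
  have "partial_powr (-1) J = (\<Sum>n<2 ^ J. fps_X ^ n :: 'a fps)" for J
  proof (induction J)
    case 0
    show ?case by (simp add: partial_powr_def)
  next
    case (Suc J)
    have "(\<Sum>n<a + b. fps_X ^ n) = (\<Sum>n<a. fps_X ^ n) + (\<Sum>n<b. fps_X ^ n) * (fps_X ^ a :: 'a fps)" for a b
      by (induction b) (simp_all add: algebra_simps power_add)
    from this[of "2 ^ J" "2 ^ J"]
    show ?case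
      using Suc.IH by (simp add: partial_powr_def digit_minus_1 distrib_left mult_2)
  qed
  then have "fps_nth (partial_powr (-1) J :: 'a fps) n = 1" if "n < 2 ^ J" for n J
    using that by (simp add: fps_sum_nth)
  then show "\<exists>K\<ge>J. \<forall>n<2 ^ K. fps_nth (Abs_fps (\<lambda>_. 1)) n = fps_nth (partial_powr (-1) K :: 'a fps) n" for J
    by auto
qed

section \<open>The two objects and the theorem\<close>

lemma braid_minus_id_intertwiner:
  fixes X :: "'k::field mat"
  assumes char: "CHAR('k) = 2" and X: "X \<in> sqz"
  shows "braid_minus_id sqz_cat X \<in> intertwiners (tensor_sqz X X) (tensor_sqz X X)"
proof -
  have T: "tensor_sqz X X \<in> sqz" by (rule tensor_sqz_in_sqz[OF char X X])
  show ?thesis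
    using add_intertwiners[OF T T braid_sqz_intertwiner[OF X X] smult_intertwiners[OF T T one_intertwiner[OF T]], of "-1"]
    by (simp add: braid_minus_id_def)
qed

lemma cat_dim_sym_pow:
  fixes X :: "'k::field mat"
  assumes char: "CHAR('k) = 2" and X: "X \<in> sqz" and N: "braid_minus_id sqz_cat X = N"
    and Q: "Q \<in> sqz" "q \<in> intertwiners (tens_pow sqz_cat X n) Q" "kills q N (dim_row X) n"
      "s \<in> carrier_mat (dim_row X ^ n) (dim_row Q)" "q * s = 1\<^sub>m (dim_row Q)"
      "\<And>h. dim_col h = dim_row X ^ n \<Longrightarrow> kills h N (dim_row X) n \<Longrightarrow> h * (s * q) = h"
  shows "cat_dim sqz_cat (sym_pow sqz_cat X n) = of_nat (dim_row Q)"
proof -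
  have T: "tensor_sqz X X \<in> sqz" by (rule tensor_sqz_in_sqz[OF char X X])
  show ?thesis unfolding sym_pow_def sqz_cat_simps
  proof (rule cat_dim_degree_part[OF char X _ _ Q])
    show "\<exists>J j. is_image sqz_cat (tensor_sqz X X) (tensor_sqz X X) (braid_minus_id sqz_cat X) J j"
      by (rule ex_image_sqz[OF T T braid_minus_id_intertwiner[OF char X]])
    show "j \<in> intertwiners J (tensor_sqz X X) \<and> same_columns j N"
      if "is_image sqz_cat (tensor_sqz X X) (tensor_sqz X X) (braid_minus_id sqz_cat X) J j" for J j
      using image_same_columns[OF T T that] unfolding N .
  qed
qed

text \<open>An image always has the columns of c - 1 itself, whereas a kernel has to be described
  for each object separately; hence the hypothesis on \<open>N\<close>.\<close>

lemma cat_dim_ext_pow: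
  fixes X :: "'k::field mat"
  assumes char: "CHAR('k) = 2" and X: "X \<in> sqz"
    and N: "\<And>J j. is_kernel sqz_cat (tensor_sqz X X) (tensor_sqz X X) (braid_minus_id sqz_cat X) J j \<Longrightarrow> same_columns j N"
    and Q: "Q \<in> sqz" "q \<in> intertwiners (tens_pow sqz_cat X n) Q" "kills q N (dim_row X) n"
      "s \<in> carrier_mat (dim_row X ^ n) (dim_row Q)" "q * s = 1\<^sub>m (dim_row Q)"
      "\<And>h. dim_col h = dim_row X ^ n \<Longrightarrow> kills h N (dim_row X) n \<Longrightarrow> h * (s * q) = h"
  shows "cat_dim sqz_cat (ext_pow sqz_cat X n) = of_nat (dim_row Q)"
proof -
  have T: "tensor_sqz X X \<in> sqz" by (rule tensor_sqz_in_sqz[OF char X X])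
  show ?thesis unfolding ext_pow_def sqz_cat_simps
  proof (rule cat_dim_degree_part[OF char X _ _ Q])
    show "\<exists>J j. is_kernel sqz_cat (tensor_sqz X X) (tensor_sqz X X) (braid_minus_id sqz_cat X) J j"
      by (rule ex_kernel_sqz[OF T T braid_minus_id_intertwiner[OF char X]])
    show "j \<in> intertwiners J (tensor_sqz X X) \<and> same_columns j N"
      if "is_kernel sqz_cat (tensor_sqz X X) (tensor_sqz X X) (braid_minus_id sqz_cat X) J j" for J j
      using N[OF that] that by (simp add: is_kernel_def)
  qed
qed

text \<open>\<open>rel_P\<close> squares to zero, so it factors through its kernel \<open>j\<close>;
  applied to \<open>j\<close>, the homotopy identity loses its second term and writes
  \<open>j\<close> as \<open>rel_P * (homotopy_P * j)\<close>.\<close>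

lemma kernel_rel_P:
  assumes char: "CHAR('k::field) = 2"
    and k: "is_kernel sqz_cat (tensor_sqz (jordan2 1) (jordan2 1)) (tensor_sqz (jordan2 1) (jordan2 1)) (rel_P :: 'k mat) J j"
  shows "same_columns j (rel_P :: 'k mat)"
proof -
  let ?T = "tensor_sqz (jordan2 1) (jordan2 1) :: 'k mat"
  have T: "?T \<in> sqz" by (rule tensor_sqz_in_sqz[OF char jordan2_sqz jordan2_sqz])
  from k have N: "rel_P \<in> intertwiners ?T ?T" and j: "j \<in> intertwiners J ?T"
    and Nj: "rel_P * j = 0\<^sub>m 4 (dim_row J)" by (simp_all add: is_kernel_def)
  note d = intertwinersD(1,2)[OF j]
  have "rel_P * rel_P = (0\<^sub>m (dim_row ?T) (dim_row ?T) :: 'k mat)" using rel_P_square[OF char] by simp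
  then obtain e where e: "e \<in> intertwiners ?T J" "j * e = rel_P"
    using k N T unfolding is_kernel_def sqz_cat_simps by blast
  have "j = (rel_P * homotopy_P + homotopy_P * rel_P) * j" using homotopy_P[OF char] d by simp
  also have "\<dots> = rel_P * (homotopy_P * j) + homotopy_P * (rel_P * j)"
    using d by (simp add: add_mult_dim mult_assoc_dim)
  also have "\<dots> = rel_P * (homotopy_P * j)" using d by (simp add: Nj)
  finally have "\<exists>s. dim_row s = dim_col (rel_P :: 'k mat) \<and> j = rel_P * s" by (intro exI[of _ "homotopy_P * j"]) simp
  moreover have "\<exists>e. dim_row e = dim_col j \<and> rel_P = j * e"
    using e intertwinersD(1)[OF e(1)] d by metis
  ultimately show ?thesis using d by (simp add: same_columns_def)
qed

lemma cat_dim_powers_P: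
  assumes char: "CHAR('k::field) = 2"
  shows "cat_dim sqz_cat (sym_pow sqz_cat (jordan2 1 :: 'k mat) n) = (if n = 0 then 1 else 0)"
    and "cat_dim sqz_cat (ext_pow sqz_cat (jordan2 1 :: 'k mat) n) = (if n = 0 then 1 else 0)"
proof -
  let ?P = "jordan2 1 :: 'k mat"
  have ker: "same_columns j (rel_P :: 'k mat)"
    if "is_kernel sqz_cat (tensor_sqz ?P ?P) (tensor_sqz ?P ?P) (braid_minus_id sqz_cat ?P) J j" for J j
    using kernel_rel_P[OF char] that unfolding braid_minus_id_P[OF char] .
  note sym = cat_dim_sym_pow[OF char jordan2_sqz braid_minus_id_P[OF char]]
  \<comment> \<open>One witness serves both powers: the unit in degree 0, and in positive degree a
    two-dimensional quotient, whose dimension is 0 in characteristic 2.\<close>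
  have "\<exists>Q q s. Q \<in> sqz \<and> q \<in> intertwiners (tens_pow sqz_cat ?P n) Q \<and> kills q rel_P (dim_row ?P) n \<and>
      s \<in> carrier_mat (dim_row ?P ^ n) (dim_row Q) \<and> q * s = 1\<^sub>m (dim_row Q) \<and>
      (\<forall>h. dim_col h = dim_row ?P ^ n \<longrightarrow> kills h rel_P (dim_row ?P) n \<longrightarrow> h * (s * q) = h) \<and>
      (of_nat (dim_row Q) :: 'k) = (if n = 0 then 1 else 0)"
  proof (cases n)
    case 0
    show ?thesis
      by (rule exI[of _ "0\<^sub>m 1 1"], rule exI[of _ "1\<^sub>m 1"], rule exI[of _ "1\<^sub>m 1"])
        (use 0 in \<open>auto simp: sqz_def kills_def intertwiners_def\<close>)
  next
    case (Suc m)
    show ?thesis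
    proof (rule exI[of _ "jordan2 (of_nat (Suc m))"], rule exI[of _ "quot_P m"],
        rule exI[of _ "kron (1\<^sub>m 2) (pow_unit_x m)"], intro conjI allI impI)
      show "quot_P m \<in> intertwiners (tens_pow sqz_cat ?P n) (jordan2 (of_nat (Suc m)))"
        unfolding Suc using quot_P_intertwines[OF char, of m] tens_pow_sqz(2)[OF char jordan2_sqz, of 1 "Suc m"]
        by (intro intertwinersI) auto
      show "h * (kron (1\<^sub>m 2) (pow_unit_x m) * quot_P m) = h"
        if "dim_col h = dim_row ?P ^ n" "kills h rel_P (dim_row ?P) n" for h :: "'k mat"
        using quot_P_universal[OF char, where h = h and n = m] that by (simp add: Suc)
    qed (use jordan2_sqz kills_quot_P[OF char, of m] quot_P_section in \<open>auto simp: Suc char_2_add[OF char]\<close>)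
  qed
  then obtain Q q s where Q: "Q \<in> sqz" "q \<in> intertwiners (tens_pow sqz_cat ?P n) Q" "kills q rel_P (dim_row ?P) n"
      "s \<in> carrier_mat (dim_row ?P ^ n) (dim_row Q)" "q * s = 1\<^sub>m (dim_row Q)"
      "\<And>h. dim_col h = dim_row ?P ^ n \<Longrightarrow> kills h rel_P (dim_row ?P) n \<Longrightarrow> h * (s * q) = h"
      and dim: "(of_nat (dim_row Q) :: 'k) = (if n = 0 then 1 else 0)"
    by (elim exE conjE) (rule that, assumption+, simp only:)
  show "cat_dim sqz_cat (sym_pow sqz_cat ?P n) = (if n = 0 then 1 else 0)"
    unfolding dim[symmetric] by (rule sym[OF Q])
  show "cat_dim sqz_cat (ext_pow sqz_cat ?P n) = (if n = 0 then 1 else 0)"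
    unfolding dim[symmetric] by (rule cat_dim_ext_pow[OF char jordan2_sqz _ Q]) (rule ker)
qed

section \<open>Powers of the unit object\<close>

lemma tensor_unit_unit: "tensor_sqz (0\<^sub>m 1 1) (0\<^sub>m 1 1) = (0\<^sub>m 1 1 :: 'k::field mat)"
  by (simp add: tensor_sqz_unit)

lemma tens_pow_unit: "tens_pow sqz_cat (0\<^sub>m 1 1 :: 'k::field mat) n = 0\<^sub>m 1 1"
  by (induction n) (simp_all add: tensor_sqz_unit)

lemma braid_minus_id_unit: "braid_minus_id sqz_cat (0\<^sub>m 1 1 :: 'k::field mat) = 0\<^sub>m 1 1"
  by (simp add: braid_minus_id_def braid_sqz_def swap_mat_one kron_zero_left) (auto intro!: eq_matI)

text \<open>On 1 \<otimes> 1 the braiding is the identity. The image of c - 1 is zero, so all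
  symmetric powers are 1; its kernel is everything, so the exterior powers vanish from degree 2
  on.\<close>

lemma cat_dim_powers_unit:
  assumes char: "CHAR('k::field) = 2"
  shows "cat_dim sqz_cat (sym_pow sqz_cat (0\<^sub>m 1 1 :: 'k mat) n) = 1"
    and "cat_dim sqz_cat (ext_pow sqz_cat (0\<^sub>m 1 1 :: 'k mat) n) = (if n \<le> 1 then 1 else 0)"
proof -
  let ?I = "0\<^sub>m 1 1 :: 'k mat"
  have I: "?I \<in> sqz" by (simp add: sqz_def)
  have O: "(0\<^sub>m 0 0 :: 'k mat) \<in> sqz" by (simp add: sqz_def)
  have "kills (1\<^sub>m 1) ?I 1 n" by (simp add: kills_def relation_mat_def kron_zero_left kron_zero_right)
  then show "cat_dim sqz_cat (sym_pow sqz_cat ?I n) = 1"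
    using cat_dim_sym_pow[OF char I braid_minus_id_unit I, where q = "1\<^sub>m 1" and n = n and s = "1\<^sub>m 1"] one_intertwiner[OF I]
    unfolding tens_pow_unit by simp
  have ker: "same_columns j (1\<^sub>m 1)"
    if k: "is_kernel sqz_cat (tensor_sqz ?I ?I) (tensor_sqz ?I ?I) (braid_minus_id sqz_cat ?I) J j" for J j
  proof -
    note k' = k[unfolded tensor_unit_unit braid_minus_id_unit]
    then have j: "j \<in> intertwiners J ?I" by (simp add: is_kernel_def)
    note d = intertwinersD(1,2)[OF j]
    have "?I * 1\<^sub>m 1 = 0\<^sub>m (dim_row ?I) (dim_row ?I)" "1\<^sub>m 1 \<in> intertwiners ?I ?I"
      using one_intertwiner[OF I] by simp_all
    then obtain e where "e \<in> intertwiners ?I J" "j * e = 1\<^sub>m 1"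
      using k' I unfolding is_kernel_def sqz_cat_simps by blast
    then have "dim_row e = dim_col j \<and> 1\<^sub>m 1 = j * e" using d by (auto simp: intertwiners_def)
    moreover have "dim_row j = dim_col (1\<^sub>m 1 :: 'k mat) \<and> j = 1\<^sub>m 1 * j" using d by simp
    ultimately show ?thesis unfolding same_columns_def using d by auto
  qed
  show "cat_dim sqz_cat (ext_pow sqz_cat ?I n) = (if n \<le> 1 then 1 else 0)"
  proof (cases "n \<le> 1")
    case True
    then have "kills (1\<^sub>m 1) (1\<^sub>m 1 :: 'k mat) 1 n" by (simp add: kills_def)
    then show ?thesis
      using cat_dim_ext_pow[OF char I ker I, where q = "1\<^sub>m 1" and n = n and s = "1\<^sub>m 1"] one_intertwiner[OF I] True
      unfolding tens_pow_unit by simp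
  next
    case False
    \<comment> \<open>The quotient is the zero object, given by empty matrices; the relation is the
      identity matrix here, so \<open>h\<close> itself must vanish.\<close>
    have "h * (0\<^sub>m 1 0 * 0\<^sub>m 0 1) = h" if h: "dim_col h = 1" "kills h (1\<^sub>m 1) 1 n" for h :: "'k mat"
    proof -
      have "0 + (n - 2) + 2 = n" using False by simp
      then have "h * relation_mat (1\<^sub>m 1) 1 0 (n - 2) = 0\<^sub>m (dim_row h) (1 ^ 0 * (dim_col (1\<^sub>m 1 :: 'k mat) * 1 ^ (n - 2)))"
        using h(2) unfolding kills_def by blast
      then have "h = 0\<^sub>m (dim_row h) 1" using h(1) by (simp add: relation_mat_def)
      moreover have "h * (0\<^sub>m 1 0 * 0\<^sub>m 0 1) = 0\<^sub>m (dim_row h) 1" using h(1) by simp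
      ultimately show ?thesis by simp
    qed
    moreover have "0\<^sub>m 0 1 * 0\<^sub>m 1 0 = (1\<^sub>m 0 :: 'k mat)" by (rule eq_matI) auto
    moreover have "kills (0\<^sub>m 0 1) (1\<^sub>m 1 :: 'k mat) 1 n" by (auto simp: kills_def)
    moreover have "0\<^sub>m 0 1 \<in> intertwiners ?I (0\<^sub>m 0 0)" using zero_intertwiner[OF I O] by simp
    ultimately show ?thesis
      using cat_dim_ext_pow[OF char I ker O, where q = "0\<^sub>m 0 1" and n = n and s = "0\<^sub>m 1 0"] False
      unfolding tens_pow_unit by simp
  qed
qed

lemma Dim_sqz:
  assumes char: "CHAR('k::field) = 2"
  shows "Dim_plus sqz_cat (0\<^sub>m 1 1 :: 'k mat) = 1" "Dim_minus sqz_cat (0\<^sub>m 1 1 :: 'k mat) = 1"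
    "Dim_plus sqz_cat (jordan2 1 :: 'k mat) = 0" "Dim_minus sqz_cat (jordan2 1 :: 'k mat) = 0"
proof -
  \<comment> \<open>As -z = z in characteristic 2, both dimensions are read off from powers of 1 +
    z.\<close>
  have neg: "- fps_X = (fps_X :: 'k fps)"
    by (rule fps_ext) (simp add: char_2_add[OF char])
  have plus: "Dim_plus sqz_cat X = t" if "Abs_fps (\<lambda>j. cat_dim sqz_cat (sym_pow sqz_cat X j)) = one_plus_powr fps_X (- t)"
    for X :: "'k mat" and t
    unfolding Dim_plus_def neg that by (rule the_equality) (auto dest: one_plus_powr_inj)
  have minus: "Dim_minus sqz_cat X = t" if "Abs_fps (\<lambda>j. cat_dim sqz_cat (ext_pow sqz_cat X j)) = one_plus_powr fps_X t"
    for X :: "'k mat" and t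
    unfolding Dim_minus_def that by (rule the_equality) (auto dest: one_plus_powr_inj)
  show "Dim_plus sqz_cat (0\<^sub>m 1 1 :: 'k mat) = 1"
    by (rule plus) (simp only: cat_dim_powers_unit[OF char] one_plus_powr_minus_1)
  show "Dim_minus sqz_cat (0\<^sub>m 1 1 :: 'k mat) = 1"
    by (rule minus, rule fps_ext) (simp only: cat_dim_powers_unit[OF char] one_plus_powr_1, auto simp: fps_X_def)
  show "Dim_plus sqz_cat (jordan2 1 :: 'k mat) = 0"
    by (rule plus, rule fps_ext) (simp add: cat_dim_powers_P[OF char] one_plus_powr_0)
  show "Dim_minus sqz_cat (jordan2 1 :: 'k mat) = 0"
    by (rule minus, rule fps_ext) (simp add: cat_dim_powers_P[OF char] one_plus_powr_0)
qed

text \<open>The two sides agree modulo 2; their residues modulo 4 separate them.\<close>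

lemma one_plus_one_two_adic: "1 + 1 \<noteq> (0 :: two_adic)"
proof
  assume "1 + 1 = (0 :: two_adic)"
  then have "residue (1 + 1) 2 = residue 0 2" by (rule arg_cong)
  then have "(1 mod 2\<^sup>2 + 1 mod 2\<^sup>2) mod 2\<^sup>2 = (0 :: int)" unfolding residue_simps .
  then show False by simp
qed

text \<open>The vector y spans a submodule, the class of x spans the quotient, and d vanishes on
  both. The linear splittings \<open>f'\<close> and \<open>g'\<close> supply the certificate for
  kernel and cokernel at once.\<close>

lemma short_exact_P:
  "short_exact sqz_cat (0\<^sub>m 1 1) (jordan2 1 :: 'k::field mat) (0\<^sub>m 1 1)
    (mat 2 1 (\<lambda>(r, s). if r = 1 then 1 else 0)) (mat 1 2 (\<lambda>(r, s). if s = 0 then 1 else 0))"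
proof -
  let ?P = "jordan2 1 :: 'k mat" and ?I = "0\<^sub>m 1 1 :: 'k mat"
  define f g f' g' :: "'k mat" where "f = mat 2 1 (\<lambda>(r, s). if r = 1 then 1 else 0)"
    and "g = mat 1 2 (\<lambda>(r, s). if s = 0 then 1 else 0)"
    and "f' = mat 1 2 (\<lambda>(r, s). if s = 1 then 1 else 0)" and "g' = mat 2 1 (\<lambda>(r, s). if r = 0 then 1 else 0)"
  note defs = f_def g_def f'_def g'_def
  have I: "?I \<in> sqz" by (simp add: sqz_def)
  have c: "f \<in> carrier_mat (dim_row ?P) 1" "f' \<in> carrier_mat 1 (dim_row ?P)" "g' \<in> carrier_mat (dim_row ?P) (dim_row ?I)"
    "g \<in> carrier_mat 1 (dim_row ?P)"
    by (simp_all add: defs)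
  note d = carrier_matD[OF c(1)] carrier_matD[OF c(2)] carrier_matD[OF c(3)] carrier_matD[OF c(4)]
  have all1: "(\<forall>i<Suc 0. Q i) \<longleftrightarrow> Q 0" for Q by simp
  note entries = all_less_small all1 index_mult_sum sum_lessThan_small defs jordan2_def
  have e: "f' * f = 1\<^sub>m 1" "g * f = 0\<^sub>m (dim_row ?I) 1" "f' * ?P * f = ?I"
    by (rule mat_eq_entriesI[of _ 1 _ 1], simp_all add: entries del: index_mult_mat(1))+
  have e3: "f * f' + g' * g = 1\<^sub>m (dim_row ?P)"
    by (rule mat_eq_entriesI[of _ 2 _ 2]) (simp_all add: entries del: index_mult_mat(1))
  have eP: "g * ?P = 0\<^sub>m 1 2"
    by (rule mat_eq_entriesI[of _ 1 _ 2]) (simp_all add: entries del: index_mult_mat(1))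
  have Pe: "?P * f = 0\<^sub>m 2 1"
    by (rule mat_eq_entriesI[of _ 2 _ 1]) (simp_all add: entries del: index_mult_mat(1))
  have g: "g \<in> intertwiners ?P ?I" using d eP by (intro intertwinersI) auto
  have f: "f \<in> intertwiners ?I ?P" using d Pe by (intro intertwinersI) auto
  have "is_kernel sqz_cat ?P ?I g ?I f"
    using is_kernel_split(2)[OF jordan2_sqz I g c(1,2,3) e(1,2) e3] unfolding e(3) .
  moreover have "g \<noteq> 0\<^sub>m 1 (dim_row ?P)" by (simp add: mat_eq_iff defs)
  then have "is_cokernel sqz_cat ?I ?P f ?I g"
    using row_cokernel[OF jordan2_sqz I f g c(4) _ c(1,2) _ _ e3] c(3) e(2) by simp
  ultimately show ?thesis
    using I jordan2_sqz unfolding short_exact_def defs by simp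
qed

theorem mainTheorem5:
  assumes "CHAR('k::alg_closed_field) = 2"
  shows "\<exists>(C :: 'k small_tensor_cat) X Y Z f g.
    symmetric_tensor_category C \<and> short_exact C X Y Z f g \<and>
    Dim_plus C Y \<noteq> Dim_plus C X + Dim_plus C Z \<and>
    Dim_minus C Y \<noteq> Dim_minus C X + Dim_minus C Z"
proof (intro exI conjI)
  show "symmetric_tensor_category (sqz_cat :: 'k small_tensor_cat)"
    by (rule symmetric_tensor_category_sqz[OF assms])
  show "short_exact (sqz_cat :: 'k small_tensor_cat) (0\<^sub>m 1 1) (jordan2 1) (0\<^sub>m 1 1)
    (mat 2 1 (\<lambda>(r, s). if r = 1 then 1 else 0)) (mat 1 2 (\<lambda>(r, s). if s = 0 then 1 else 0))"
    by (rule short_exact_P)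
qed (simp_all only: Dim_sqz[OF assms] one_plus_one_two_adic[symmetric] not_False_eq_True)

end
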